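(* Let $n\ge 2$ and let $P\Sigma_n$ be the basis-conjugating automorphism group of the free group $F_n=\langle x_1,\dots,x_n\rangle$, that is, the group of all automorphisms of $F_n$ which send each generator $x_i$ to a conjugate of itself. Then the (first) Bieri-Neumann-Strebel invariant of $P\Sigma_n$ is given by \[ \Sigma(P\Sigma_n)=H^1(P\Sigma_n;\mathbb{R})\setminus R^1(P\Sigma_n,\mathbb{R}), \] where $R^1(P\Sigma_n,\mathbb{R})\subset H^1(P\Sigma_n;\mathbb{R})$ is the first resonance variety of the cohomology ring $H^*(P\Sigma_n;\mathbb{R})$.
   Context: BNS invariant: for a finitely generated group $G$, let $\mathcal{C}$ be the Cayley graph of $G$ corresponding to a finite generating set. Given an additive character $\chi\colon G\to\mathbb{R}$ (a group homomorphism), let $\mathcal{C}_+(\chi)$ be the full subgraph of $\mathcal{C}$ on the vertex set $\{g\in G\mid \chi(g)\ge 0\}$. The (first) BNS invariant of $G$ is the conical subset \[ \Sigma(G)=\{\chi\in\operatorname{Hom}(G,\mathbb{R})\setminus\{0\}\mid \mathcal{C}_+(\chi)\text{ is connected}\} \] of $\operatorname{Hom}(G,\mathbb{R})=H^1(G;\mathbb{R})$; it is independent of the choice of finite generating set. Resonance: let $A=H^*(P\Sigma_n;\mathbb{R})$, a finite-dimensional graded connected algebra with $a\cdot a=0$ for each $a\in A^1$. For $a\in A^1$, left multiplication $\delta_a(x)=ax$ defines a cochain complex $(A,\delta_a)$: $A^0\to A^1\to A^2\to\cdots$. The first resonance variety is $R^1(P\Sigma_n,\mathbb{R})=\{a\in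 A^1\mid H^1(A,\delta_a)\neq 0\}$. Structure of $P\Sigma_n$: it is generated by the automorphisms $\beta_{i,j}$, $1\le i\ne j\le n$, with $\beta_{i,j}(x_i)=x_j^{-1}x_ix_j$ and $\beta_{i,j}(x_k)=x_k$ for $k\ne i$. By a theorem of McCool, it has a presentation with these generators and with relations $[\beta_{i,j},\beta_{k,l}]$, $[\beta_{i,k},\beta_{j,k}]$, $[\beta_{i,j},\beta_{i,k}\beta_{j,k}]$, where the indices in each relation are distinct and $[u,v]=uvu^{-1}v^{-1}$. By a theorem of Jensen, McCammond and Meier, $H^*(P\Sigma_n;\mathbb{Z})$ is the quotient of the exterior algebra over $\mathbb{Z}$ on degree-one generators $e_{p,q}$, $1\le p\ne q\le n$ (dual to the classes $[\beta_{p,q}]$), by the two-sided ideal generated by $e_{i,j}e_{j,i}$ for $1\le i<j\le n$ and $(e_{k,i}-e_{j,i})(e_{k,j}-e_{i,j})$ for $1\le k\le n$, $1\le i<j\le n$, $k\notin\{i,j\}$. The same presentation holds with $\mathbb{R}$ coefficients. *)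

theory Defs
  imports
    Complex_Main
    "HOL-Algebra.Bij"
    "HOL-Algebra.Coset"
    "HOL-Algebra.Generated_Groups"
    "Graph_Theory.Digraph_Component"
begin

subsection \<open>The free group on \<open>x\<^sub>1, \<dots>, x\<^sub>n\<close>\<close>

text \<open>
  The letter \<open>(i, True)\<close> stands for \<open>x\<^sub>i\<close> and \<open>(i, False)\<close> for its inverse.
  Elements of the free group are the freely reduced words.
\<close>

type_synonym letter = "nat \<times> bool"
type_synonym word = "letter list"

definition inv_letter :: "letter \<Rightarrow> letter" where
  "inv_letter a = (fst a, \<not> snd a)"

definition reduced :: "word \<Rightarrow> bool" where
  "reduced w \<longleftrightarrow> successively (\<lambda>a b. b \<noteq> inv_letter a) w"

definition red_cons :: "letter \<Rightarrow> word \<Rightarrow> word" where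
  "red_cons a w = (if w \<noteq> [] \<and> hd w = inv_letter a then tl w else a # w)"

definition free_group :: "nat \<Rightarrow> word monoid" where
  "free_group n =
    \<lparr>carrier = {w. reduced w \<and> fst ` set w \<subseteq> {1..n}},
     monoid.mult = (\<lambda>u v. foldr red_cons u v),
     one = []\<rparr>"

definition gen :: "nat \<Rightarrow> word" where
  "gen i = [(i, True)]"

lemma inv_letter_inv_letter [simp]: "inv_letter (inv_letter a) = a"
  by (simp add: inv_letter_def)

lemma inv_letter_neq [simp]: "inv_letter a \<noteq> a" "a \<noteq> inv_letter a"
  by (auto simp: inv_letter_def prod_eq_iff)

lemma fst_inv_letter [simp]: "fst (inv_letter a) = fst a"
  by (simp add: inv_letter_def)

lemma reduced_Nil [simp]: "reduced []"
  by (simp add: reduced_def)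

lemma reduced_Cons: "reduced (a # w) \<longleftrightarrow> reduced w \<and> (w = [] \<or> hd w \<noteq> inv_letter a)"
  by (cases w) (auto simp: reduced_def)

lemma reduced_red_cons [simp]: "reduced w \<Longrightarrow> reduced (red_cons a w)"
  by (cases w) (auto simp: red_cons_def reduced_Cons)

lemma reduced_foldr [simp]: "reduced w \<Longrightarrow> reduced (foldr red_cons u w)"
  by (induction u) auto

lemma set_foldr_red_cons: "set (foldr red_cons u w) \<subseteq> set u \<union> set w"
proof (induction u)
  case (Cons a u)
  have "set (red_cons a v) \<subseteq> insert a (set v)" for v
    by (cases v) (auto simp: red_cons_def)
  with Cons show ?case by fastforce
qed simp

lemma red_cons_cancel: "reduced w \<Longrightarrow> red_cons a (red_cons (inv_letter a) w) = w"
  by (cases w) (auto simp: red_cons_def reduced_Cons)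

lemma foldr_red_cons_red_cons:
  assumes "reduced z" "reduced w"
  shows "foldr red_cons (red_cons a z) w = red_cons a (foldr red_cons z w)"
proof (cases "z \<noteq> [] \<and> hd z = inv_letter a")
  case True
  then obtain z' where z: "z = inv_letter a # z'" by (cases z) auto
  with assms show ?thesis by (simp add: red_cons_cancel) (simp add: red_cons_def)
next
  case False
  then show ?thesis by (auto simp: red_cons_def)
qed

lemma foldr_red_cons_assoc:
  "reduced v \<Longrightarrow> reduced w \<Longrightarrow>
    foldr red_cons (foldr red_cons u v) w = foldr red_cons u (foldr red_cons v w)"
  by (induction u) (auto simp: foldr_red_cons_red_cons)

lemma foldr_red_cons_Nil: "reduced w \<Longrightarrow> foldr red_cons w [] = w"
  by (induction w) (auto simp: reduced_Cons red_cons_def)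

lemma foldr_red_cons_rev:
  "reduced v \<Longrightarrow> foldr red_cons (rev (map inv_letter w)) (foldr red_cons w v) = v"
proof (induction w arbitrary: v)
  case (Cons a w)
  have "red_cons (inv_letter a) (red_cons a z) = z" if "reduced z" for z
    using red_cons_cancel[OF that, of "inv_letter a"] by simp
  with Cons show ?case by simp
qed simp

theorem group_free_group: "group (free_group n)"
proof (rule groupI, goal_cases)
  case (1 x y)
  then show ?case using set_foldr_red_cons[of x y]
    by (fastforce simp: free_group_def)
next
  case 2 then show ?case by (simp add: free_group_def)
next
  case (3 x y z)
  then show ?case by (simp add: free_group_def foldr_red_cons_assoc)
next
  case (4 x) then show ?case by (simp add: free_group_def)
next
  case (5 x)
  let ?y = "foldr red_cons (rev (map inv_letter x)) []"
  have "foldr red_cons ?y x = foldr red_cons (rev (map inv_letter x)) (foldr red_cons x [])"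
    using 5 by (simp add: free_group_def foldr_red_cons_assoc foldr_red_cons_Nil)
  also have "\<dots> = []" by (simp add: foldr_red_cons_rev)
  finally have "foldr red_cons ?y x = []" .
  moreover have "?y \<in> carrier (free_group n)"
    using 5 set_foldr_red_cons[of "rev (map inv_letter x)" "[]"]
    by (fastforce simp: free_group_def)
  ultimately show ?case by (intro bexI[of _ ?y]) (simp_all add: free_group_def)
qed

lemma gen_in_free_group: "i \<in> {1..n} \<Longrightarrow> gen i \<in> carrier (free_group n)"
  by (simp add: free_group_def gen_def reduced_Cons)

theorem free_group_universal:
  assumes "group H" and f: "\<And>i. i \<in> {1..n} \<Longrightarrow> f i \<in> carrier H"
  shows "\<exists>!h. h \<in> hom (free_group n) H \<inter> extensional (carrier (free_group n)) \<and>
              (\<forall>i\<in>{1..n}. h (gen i) = f i)"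
proof -
  interpret H: group H by fact
  interpret F: group "free_group n" by (rule group_free_group)
  define e where "e a = (if snd a then f (fst a) else inv\<^bsub>H\<^esub> f (fst a))" for a :: letter
  define h where "h w = foldr (\<lambda>a r. e a \<otimes>\<^bsub>H\<^esub> r) w \<one>\<^bsub>H\<^esub>" for w
  have e: "e a \<in> carrier H" if "fst a \<in> {1..n}" for a using f[OF that] by (simp add: e_def)
  have e_inv: "e a \<otimes>\<^bsub>H\<^esub> e (inv_letter a) = \<one>\<^bsub>H\<^esub>" if "fst a \<in> {1..n}" for a
    using f[OF that] by (simp add: e_def inv_letter_def)
  have h: "h w \<in> carrier H" if "fst ` set w \<subseteq> {1..n}" for w
    using that by (induction w) (auto simp: h_def e)
  have h_red: "h (red_cons a w) = e a \<otimes>\<^bsub>H\<^esub> h w" if "fst ` set (a # w) \<subseteq> {1..n}" for a w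
  proof (cases "w \<noteq> [] \<and> hd w = inv_letter a")
    case True
    then obtain w' where w: "w = inv_letter a # w'" by (cases w) auto
    have "e a \<otimes>\<^bsub>H\<^esub> h w = (e a \<otimes>\<^bsub>H\<^esub> e (inv_letter a)) \<otimes>\<^bsub>H\<^esub> h w'"
      using that w h[of w'] by (simp add: h_def e H.m_assoc)
    also have "\<dots> = h w'" using that w h[of w'] by (simp add: e_inv)
    finally show ?thesis using w by (simp add: red_cons_def)
  next
    case False
    then show ?thesis by (auto simp: h_def red_cons_def)
  qed
  have h_mult: "h (foldr red_cons u v) = h u \<otimes>\<^bsub>H\<^esub> h v"
    if "fst ` set u \<subseteq> {1..n}" "fst ` set v \<subseteq> {1..n}" for u v
    using that
  proof (induction u)
    case Nil then show ?case using h[of v] by (simp add: h_def)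
  next
    case (Cons a u)
    have "fst ` set (a # foldr red_cons u v) \<subseteq> {1..n}"
      using Cons.prems set_foldr_red_cons[of u v] by fastforce
    then have "h (foldr red_cons (a # u) v) = e a \<otimes>\<^bsub>H\<^esub> h (foldr red_cons u v)"
      by (simp add: h_red)
    also have "\<dots> = (e a \<otimes>\<^bsub>H\<^esub> h u) \<otimes>\<^bsub>H\<^esub> h v"
      using Cons h[of u] h[of v] by (simp add: e H.m_assoc)
    finally show ?case by (simp add: h_def)
  qed
  have ex: "restrict h (carrier (free_group n)) \<in> hom (free_group n) H"
    using F.m_closed by (auto simp: hom_def h_mult free_group_def intro!: h)
  have ex': "restrict h (carrier (free_group n)) (gen i) = f i" if "i \<in> {1..n}" for i
    using gen_in_free_group[OF that] f[OF that] by (simp add: h_def gen_def e_def)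
  have "g w = h w" if g: "g \<in> hom (free_group n) H" "\<forall>i\<in>{1..n}. g (gen i) = f i"
    and "w \<in> carrier (free_group n)" for g w
    using that(3)
  proof (induction w)
    case Nil
    show ?case using hom_one[OF g(1) group_free_group \<open>group H\<close>] by (simp add: free_group_def h_def)
  next
    case (Cons a w)
    then have w: "w \<in> carrier (free_group n)" and a: "[a] \<in> carrier (free_group n)"
      and i: "fst a \<in> {1..n}"
      by (auto simp: free_group_def reduced_Cons)
    have aw: "a # w = [a] \<otimes>\<^bsub>free_group n\<^esub> w"
      using Cons.prems by (auto simp: free_group_def reduced_Cons red_cons_def)
    have "g [a] = e a"
    proof (cases "snd a")
      case True
      then have "[a] = gen (fst a)" by (simp add: gen_def prod_eq_iff)
      then show ?thesis using g(2) i True by (simp add: e_def)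
    next
      case False
      have "[a] \<otimes>\<^bsub>free_group n\<^esub> gen (fst a) = \<one>\<^bsub>free_group n\<^esub>"
        using False by (simp add: free_group_def gen_def red_cons_def inv_letter_def prod_eq_iff)
      then have "[a] = inv\<^bsub>free_group n\<^esub> gen (fst a)"
        using F.inv_equality[of "[a]" "gen (fst a)"] a gen_in_free_group[OF i] by simp
      then have "g [a] = inv\<^bsub>H\<^esub> g (gen (fst a))"
        using group_hom.hom_inv[of "free_group n" H g "gen (fst a)"] g(1) gen_in_free_group[OF i]
        by (simp add: group_hom_def group_hom_axioms_def F.is_group H.is_group)
      then show ?thesis using g(2) i False by (simp add: e_def)
    qed
    then show ?case
      unfolding aw using hom_mult[OF g(1) a w] Cons.IH[OF w]
      by (simp add: h_def flip: aw)
  qed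
  then have "g = restrict h (carrier (free_group n))"
    if "g \<in> hom (free_group n) H" "g \<in> extensional (carrier (free_group n))"
      "\<forall>i\<in>{1..n}. g (gen i) = f i" for g
    using that by (intro extensionalityI[of _ "carrier (free_group n)"]) auto
  then show ?thesis
    using ex ex' by (intro ex1I[of _ "restrict h (carrier (free_group n))"]) blast+
qed


subsection \<open>The basis-conjugating automorphism group\<close>

definition basis_conjugating :: "nat \<Rightarrow> (word \<Rightarrow> word) set" where
  "basis_conjugating n =
    {\<phi> \<in> carrier (AutoGroup (free_group n)).
      \<forall>i\<in>{1..n}. \<exists>w\<in>carrier (free_group n).
        \<phi> (gen i) = inv\<^bsub>free_group n\<^esub> w \<otimes>\<^bsub>free_group n\<^esub> gen i \<otimes>\<^bsub>free_group n\<^esub> w}"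

definition PSigma :: "nat \<Rightarrow> (word \<Rightarrow> word) monoid" where
  "PSigma n = (AutoGroup (free_group n))\<lparr>carrier := basis_conjugating n\<rparr>"

lemma PSigma_subgroup: "subgroup (basis_conjugating n) (AutoGroup (free_group n))"
proof -
  let ?F = "free_group n" and ?A = "AutoGroup (free_group n)"
  interpret F: group ?F by (rule group_free_group)
  interpret A: group ?A by (rule F.AutoGroup)
  have carr: "carrier ?A = hom ?F ?F \<inter> Bij (carrier ?F)" by (simp add: AutoGroup_def auto_def)
  have hommult: "\<phi> (x \<otimes>\<^bsub>?F\<^esub> y) = \<phi> x \<otimes>\<^bsub>?F\<^esub> \<phi> y" "\<phi> x \<in> carrier ?F"
    "\<phi> (inv\<^bsub>?F\<^esub> x) = inv\<^bsub>?F\<^esub> \<phi> x"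
    if "\<phi> \<in> carrier ?A" "x \<in> carrier ?F" "y \<in> carrier ?F" for \<phi> x y
  proof -
    have h: "\<phi> \<in> hom ?F ?F" using that carr by auto
    show "\<phi> (x \<otimes>\<^bsub>?F\<^esub> y) = \<phi> x \<otimes>\<^bsub>?F\<^esub> \<phi> y" "\<phi> x \<in> carrier ?F" using h that by (auto simp: hom_def)
    show "\<phi> (inv\<^bsub>?F\<^esub> x) = inv\<^bsub>?F\<^esub> \<phi> x"
      using group_hom.hom_inv[of ?F ?F \<phi> x] h that by (simp add: group_hom_def group_hom_axioms_def F.is_group)
  qed
  have app: "(\<phi> \<otimes>\<^bsub>?A\<^esub> \<psi>) x = \<phi> (\<psi> x)"
    if "\<phi> \<in> carrier ?A" "\<psi> \<in> carrier ?A" "x \<in> carrier ?F" for \<phi> \<psi> x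
    using that by (simp add: carr AutoGroup_def BijGroup_def auto_def compose_def)
  have one: "\<one>\<^bsub>?A\<^esub> = (\<lambda>x\<in>carrier ?F. x)" by (simp add: AutoGroup_def BijGroup_def)
  show ?thesis
  proof (rule A.subgroupI, goal_cases)
    case 1 then show ?case by (auto simp: basis_conjugating_def)
  next
    case 2
    have "\<one>\<^bsub>?A\<^esub> \<in> basis_conjugating n"
      unfolding basis_conjugating_def one[symmetric]
      using gen_in_free_group[of _ n]
      by (auto simp: one intro!: bexI[of _ "\<one>\<^bsub>?F\<^esub>"] simp flip: One_nat_def)
         (use A.one_closed one in auto)
    then show ?case by blast
  next
    case (3 \<phi>)
    then have \<phi>: "\<phi> \<in> carrier ?A" and i: "inv\<^bsub>?A\<^esub> \<phi> \<in> carrier ?A" by (auto simp: basis_conjugating_def)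
    have inv_app: "(inv\<^bsub>?A\<^esub> \<phi>) (\<phi> x) = x" if "x \<in> carrier ?F" for x
      using app[OF i \<phi> that] \<phi> that by (simp add: one)
    have "\<exists>w\<in>carrier ?F. (inv\<^bsub>?A\<^esub> \<phi>) (gen k) = inv\<^bsub>?F\<^esub> w \<otimes>\<^bsub>?F\<^esub> gen k \<otimes>\<^bsub>?F\<^esub> w" if k: "k \<in> {1..n}" for k
    proof -
      obtain w where w: "w \<in> carrier ?F" "\<phi> (gen k) = inv\<^bsub>?F\<^esub> w \<otimes>\<^bsub>?F\<^esub> gen k \<otimes>\<^bsub>?F\<^esub> w"
        using 3 k unfolding basis_conjugating_def by blast
      note g = gen_in_free_group[OF k]
      let ?i = "inv\<^bsub>?A\<^esub> \<phi>"
      have "gen k = inv\<^bsub>?F\<^esub> (?i w) \<otimes>\<^bsub>?F\<^esub> ?i (gen k) \<otimes>\<^bsub>?F\<^esub> ?i w"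
        using inv_app[OF g] w g i by (simp add: hommult)
      then have "?i (gen k) = inv\<^bsub>?F\<^esub> (inv\<^bsub>?F\<^esub> (?i w)) \<otimes>\<^bsub>?F\<^esub> gen k \<otimes>\<^bsub>?F\<^esub> inv\<^bsub>?F\<^esub> (?i w)"
        using hommult(2)[OF i w(1) w(1)] hommult(2)[OF i g g] g
        by (metis F.inv_closed F.inv_inv F.inv_solve_left F.inv_solve_right F.m_assoc F.m_closed)
      then show ?thesis using hommult(2)[OF i w(1) w(1)] by blast
    qed
    with i show ?case by (simp add: basis_conjugating_def)
  next
    case (4 \<phi> \<psi>)
    then have \<phi>: "\<phi> \<in> carrier ?A" and \<psi>: "\<psi> \<in> carrier ?A" by (auto simp: basis_conjugating_def)
    have "\<exists>w\<in>carrier ?F. (\<phi> \<otimes>\<^bsub>?A\<^esub> \<psi>) (gen k) = inv\<^bsub>?F\<^esub> w \<otimes>\<^bsub>?F\<^esub> gen k \<otimes>\<^bsub>?F\<^esub> w" if k: "k \<in> {1..n}" for k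
    proof -
      obtain w where w: "w \<in> carrier ?F" "\<phi> (gen k) = inv\<^bsub>?F\<^esub> w \<otimes>\<^bsub>?F\<^esub> gen k \<otimes>\<^bsub>?F\<^esub> w"
        using 4 k unfolding basis_conjugating_def by blast
      obtain v where v: "v \<in> carrier ?F" "\<psi> (gen k) = inv\<^bsub>?F\<^esub> v \<otimes>\<^bsub>?F\<^esub> gen k \<otimes>\<^bsub>?F\<^esub> v"
        using 4 k unfolding basis_conjugating_def by blast
      note g = gen_in_free_group[OF k]
      have "(\<phi> \<otimes>\<^bsub>?A\<^esub> \<psi>) (gen k) = inv\<^bsub>?F\<^esub> (w \<otimes>\<^bsub>?F\<^esub> \<phi> v) \<otimes>\<^bsub>?F\<^esub> gen k \<otimes>\<^bsub>?F\<^esub> (w \<otimes>\<^bsub>?F\<^esub> \<phi> v)"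
        using w v g \<phi> by (simp add: app[OF \<phi> \<psi> g] hommult F.inv_mult_group F.m_assoc)
      then show ?thesis using hommult(2)[OF \<phi> v(1) v(1)] w by blast
    qed
    with \<phi> \<psi> show ?case by (simp add: basis_conjugating_def)
  qed
qed

theorem group_PSigma: "group (PSigma n)"
  using group.subgroup_imp_group[OF group.AutoGroup[OF group_free_group] PSigma_subgroup]
  by (simp add: PSigma_def)


subsection \<open>Characters and the Bieri-Neumann-Strebel invariant\<close>

definition real_group :: "real monoid" where
  "real_group = \<lparr>carrier = UNIV, monoid.mult = (+), one = 0\<rparr>"

definition characters :: "('a, 'b) monoid_scheme \<Rightarrow> ('a \<Rightarrow> real) set" where
  "characters G = hom G real_group \<inter> extensional (carrier G)"

text \<open>
  The arc \<open>(g, s)\<close> joins \<open>g\<close> to \<open>g \<otimes> s\<close>. The notion of connectedness used below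
  ignores the orientation of arcs, so \<open>S\<close> need not be closed under inverses.
\<close>

definition cayley_graph :: "('a, 'b) monoid_scheme \<Rightarrow> 'a set \<Rightarrow> ('a, 'a \<times> 'a) pre_digraph" where
  "cayley_graph G S =
    \<lparr>verts = carrier G, arcs = carrier G \<times> S, tail = fst, head = (\<lambda>(g, s). g \<otimes>\<^bsub>G\<^esub> s)\<rparr>"

definition bns_invariant :: "('a, 'b) monoid_scheme \<Rightarrow> 'a set \<Rightarrow> ('a \<Rightarrow> real) set" where
  "bns_invariant G S =
    {\<chi> \<in> characters G - {\<lambda>x\<in>carrier G. 0}.
      Digraph_Component.connected
        (induce_subgraph (cayley_graph G S) {g \<in> carrier G. \<chi> g \<ge> 0})}"


subsection \<open>Real cohomology of a group\<close>

text \<open>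
  Inhomogeneous cochains with trivial coefficients: a \<open>k\<close>-cochain is a real function on
  \<open>k\<close>-tuples of group elements, represented as lists of length \<open>k\<close>.
\<close>

definition tuples :: "('a, 'b) monoid_scheme \<Rightarrow> nat \<Rightarrow> 'a list set" where
  "tuples G k = {xs. set xs \<subseteq> carrier G \<and> length xs = k}"

definition cochains :: "('a, 'b) monoid_scheme \<Rightarrow> nat \<Rightarrow> ('a list \<Rightarrow> real) monoid" where
  "cochains G k =
    \<lparr>carrier = extensional (tuples G k),
     monoid.mult = (\<lambda>f g. \<lambda>xs\<in>tuples G k. f xs + g xs),
     one = (\<lambda>xs\<in>tuples G k. 0)\<rparr>"

definition coboundary ::
    "('a, 'b) monoid_scheme \<Rightarrow> nat \<Rightarrow> ('a list \<Rightarrow> real) \<Rightarrow> 'a list \<Rightarrow> real" where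
  "coboundary G k f =
    (\<lambda>xs\<in>tuples G (Suc k).
      f (tl xs)
      + (\<Sum>i<k. (-1) ^ Suc i * f (take i xs @ (xs ! i \<otimes>\<^bsub>G\<^esub> xs ! Suc i) # drop (i + 2) xs))
      + (-1) ^ Suc k * f (butlast xs))"

definition cocycles :: "('a, 'b) monoid_scheme \<Rightarrow> nat \<Rightarrow> ('a list \<Rightarrow> real) set" where
  "cocycles G k = kernel (cochains G k) (cochains G (Suc k)) (coboundary G k)"

definition coboundaries :: "('a, 'b) monoid_scheme \<Rightarrow> nat \<Rightarrow> ('a list \<Rightarrow> real) set" where
  "coboundaries G k =
    (case k of 0 \<Rightarrow> {\<one>\<^bsub>cochains G 0\<^esub>} | Suc j \<Rightarrow> coboundary G j ` carrier (cochains G j))"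

definition cohomology :: "('a, 'b) monoid_scheme \<Rightarrow> nat \<Rightarrow> ('a list \<Rightarrow> real) set monoid" where
  "cohomology G k = (cochains G k)\<lparr>carrier := cocycles G k\<rparr> Mod coboundaries G k"

definition cohomology_class ::
    "('a, 'b) monoid_scheme \<Rightarrow> nat \<Rightarrow> ('a list \<Rightarrow> real) \<Rightarrow> ('a list \<Rightarrow> real) set" where
  "cohomology_class G k f = coboundaries G k #>\<^bsub>cochains G k\<^esub> f"

definition cup ::
    "('a, 'b) monoid_scheme \<Rightarrow> nat \<Rightarrow> nat \<Rightarrow> ('a list \<Rightarrow> real) \<Rightarrow> ('a list \<Rightarrow> real) \<Rightarrow> 'a list \<Rightarrow> real" where
  "cup G p q f g = (\<lambda>xs\<in>tuples G (p + q). f (take p xs) * g (drop p xs))"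

text \<open>
  The class of \<open>cup G p q f g\<close> does not depend on the representatives \<open>f \<in> a\<close>, \<open>g \<in> b\<close>,
  so the union below is a single cohomology class.
\<close>

definition cup_class ::
    "('a, 'b) monoid_scheme \<Rightarrow> nat \<Rightarrow> nat \<Rightarrow> ('a list \<Rightarrow> real) set \<Rightarrow> ('a list \<Rightarrow> real) set
      \<Rightarrow> ('a list \<Rightarrow> real) set" where
  "cup_class G p q a b =
    (\<Union>f\<in>a. \<Union>g\<in>b. cohomology_class G (p + q) (cup G p q f g))"

text \<open>The identification of \<open>Hom(G, \<real>)\<close> with \<open>H\<^sup>1(G; \<real>)\<close>.\<close>

definition char_class :: "('a, 'b) monoid_scheme \<Rightarrow> ('a \<Rightarrow> real) \<Rightarrow> ('a list \<Rightarrow> real) set" where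
  "char_class G \<chi> = cohomology_class G 1 (\<lambda>xs\<in>tuples G 1. \<chi> (hd xs))"


lemma tuples_1: "xs \<in> tuples G 1 \<longleftrightarrow> (\<exists>x\<in>carrier G. xs = [x])"
  by (auto simp: tuples_def length_Suc_conv)

lemma tuples_2: "xs \<in> tuples G 2 \<longleftrightarrow> (\<exists>x\<in>carrier G. \<exists>y\<in>carrier G. xs = [x, y])"
  by (auto simp: tuples_def numeral_2_eq_2 length_Suc_conv)

lemma coboundaries_1: "coboundaries G 1 = {\<one>\<^bsub>cochains G 1\<^esub>}"
proof -
  have eq: "coboundary G 0 f = \<one>\<^bsub>cochains G 1\<^esub>" for f
    by (rule ext) (auto simp: coboundary_def cochains_def restrict_def tuples_1[simplified])
  have "carrier (cochains G 0) \<noteq> {}" by (auto simp: cochains_def extensional_def)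
  then show ?thesis by (auto simp: coboundaries_def eq[simplified])
qed

lemma class_1:
  assumes "f \<in> carrier (cochains G 1)"
  shows "cohomology_class G 1 f = {f}"
proof -
  have "(\<lambda>xs\<in>tuples G 1. f xs) = f" using assms by (simp add: cochains_def extensional_restrict)
  then show ?thesis unfolding cohomology_class_def coboundaries_1
    by (simp add: r_coset_def cochains_def cong: restrict_cong)
qed

lemma cocycles_1:
  "f \<in> cocycles G 1 \<longleftrightarrow> f \<in> extensional (tuples G 1) \<and>
     (\<forall>x\<in>carrier G. \<forall>y\<in>carrier G. f [x \<otimes>\<^bsub>G\<^esub> y] = f [x] + f [y])"
proof -
  have "coboundary G 1 f = \<one>\<^bsub>cochains G 2\<^esub> \<longleftrightarrow>
    (\<forall>x\<in>carrier G. \<forall>y\<in>carrier G. f [y] - f [x \<otimes>\<^bsub>G\<^esub> y] + f [x] = 0)"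
  proof -
    have v: "coboundary G 1 f [x, y] = f [y] - f [x \<otimes>\<^bsub>G\<^esub> y] + f [x]"
      if "x \<in> carrier G" "y \<in> carrier G" for x y
      using that by (simp add: coboundary_def tuples_def)
    have "coboundary G 1 f = \<one>\<^bsub>cochains G 2\<^esub> \<longleftrightarrow> (\<forall>xs\<in>tuples G 2. coboundary G 1 f xs = 0)"
      by (auto simp: coboundary_def cochains_def fun_eq_iff restrict_def numeral_2_eq_2)
    also have "\<dots> \<longleftrightarrow> (\<forall>x\<in>carrier G. \<forall>y\<in>carrier G. coboundary G 1 f [x, y] = 0)"
      unfolding Ball_def tuples_2 by blast
    finally show ?thesis using v by simp
  qed
  then show ?thesis
    by (auto simp: cocycles_def kernel_def cochains_def numeral_2_eq_2 algebra_simps)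
qed

lemma carrier_cohomology: "carrier (cohomology G k) = cohomology_class G k ` cocycles G k"
  by (auto simp: cohomology_def carrier_FactGroup cohomology_class_def r_coset_def)

theorem char_class_bij:
  assumes "group G"
  shows "bij_betw (char_class G) (characters G) (carrier (cohomology G 1))"
proof -
  interpret group G by fact
  have cc: "char_class G \<chi> = {\<lambda>xs\<in>tuples G 1. \<chi> (hd xs)}" for \<chi>
    unfolding char_class_def by (rule class_1) (simp add: cochains_def)
  have c1: "carrier (cohomology G 1) = (\<lambda>f. {f}) ` cocycles G 1"
    unfolding carrier_cohomology
    by (intro image_cong refl class_1) (auto simp: cocycles_def kernel_def)
  show ?thesis
  proof (rule bij_betw_imageI)
    show "inj_on (char_class G) (characters G)"
    proof (rule inj_onI)
      fix a b assume ab: "a \<in> characters G" "b \<in> characters G" "char_class G a = char_class G b"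
      have "a x = b x" if "x \<in> carrier G" for x
      proof -
        have "[x] \<in> tuples G 1" using that by (simp add: tuples_def)
        then show ?thesis using ab(3) by (auto simp: cc dest: fun_cong[of _ _ "[x]"])
      qed
      then show "a = b" using ab by (auto simp: characters_def intro: extensionalityI)
    qed
    show "char_class G ` characters G = carrier (cohomology G 1)"
    proof (intro equalityI subsetI)
      fix K assume "K \<in> char_class G ` characters G"
      then obtain \<chi> where \<chi>: "\<chi> \<in> characters G" "K = char_class G \<chi>" by auto
      have "(\<lambda>xs\<in>tuples G 1. \<chi> (hd xs)) \<in> cocycles G 1"
        using \<chi>(1) by (auto simp: cocycles_1[simplified] tuples_1[simplified] characters_def hom_def real_group_def)
      then show "K \<in> carrier (cohomology G 1)" unfolding c1 \<chi>(2) cc by simp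
    next
      fix K assume "K \<in> carrier (cohomology G 1)"
      then obtain f where f: "f \<in> cocycles G 1" "K = {f}" unfolding c1 by auto
      let ?\<chi> = "\<lambda>x\<in>carrier G. f [x]"
      have "?\<chi> \<in> characters G"
        using f(1) by (auto simp: cocycles_1[simplified] characters_def hom_def real_group_def)
      moreover have "(\<lambda>xs\<in>tuples G 1. ?\<chi> (hd xs)) = f"
        using f(1) by (intro extensionalityI[of _ "tuples G 1"]) (auto simp: cocycles_1[simplified] tuples_1[simplified])
      ultimately show "K \<in> char_class G ` characters G" unfolding cc f(2) by (intro image_eqI[of _ _ ?\<chi>]) auto
    qed
  qed
qed


subsection \<open>The first resonance variety\<close>

text \<open>
  For \<open>a \<in> A\<^sup>1\<close>, \<open>A = H\<^sup>*(G; \<real>)\<close>, the differential \<open>\<delta>\<^sub>a\<close> is left multiplication by \<open>a\<close>;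
  \<open>resonance_cohomology G a\<close> is \<open>H\<^sup>1(A, \<delta>\<^sub>a)\<close>.
\<close>

definition resonance_diff ::
    "('a, 'b) monoid_scheme \<Rightarrow> ('a list \<Rightarrow> real) set \<Rightarrow> nat
      \<Rightarrow> ('a list \<Rightarrow> real) set \<Rightarrow> ('a list \<Rightarrow> real) set" where
  "resonance_diff G a k x = cup_class G 1 k a x"

definition resonance_cohomology ::
    "('a, 'b) monoid_scheme \<Rightarrow> ('a list \<Rightarrow> real) set \<Rightarrow> ('a list \<Rightarrow> real) set set monoid" where
  "resonance_cohomology G a =
    (cohomology G 1)\<lparr>carrier := kernel (cohomology G 1) (cohomology G 2) (resonance_diff G a 1)\<rparr>
      Mod (resonance_diff G a 0 ` carrier (cohomology G 0))"

definition resonance_variety :: "('a, 'b) monoid_scheme \<Rightarrow> ('a list \<Rightarrow> real) set set" where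
  "resonance_variety G =
    {a \<in> carrier (cohomology G 1).
      carrier (resonance_cohomology G a) \<noteq> {\<one>\<^bsub>resonance_cohomology G a\<^esub>}}"

end

theory Submission
  imports Defs "HOL-Library.Sublist"
begin

text \<open>
  Let \<open>A\<close> be a subgroup that, with each \<open>z\<close> such that \<open>\<chi> z \<noteq> 0\<close>, contains the centralizer of \<open>z\<close>.
  The elements that fix the end of the Cayley graph to which \<open>t, t\<^sup>2, t\<^sup>3, \<dots>\<close> converges in the direction of
  increasing \<open>\<chi>\<close> form such a subgroup, and so do the zeros of \<open>b - \<lambda> \<chi>\<close> when \<open>\<chi> \<union> b = 0\<close>, since then
  \<open>\<chi> x b y = \<chi> y b x\<close> for commuting \<open>x, y\<close>. Hence if a suitable \<open>t\<close> with \<open>\<chi> t \<noteq> 0\<close> generates the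
  whole group in this sense, \<open>\<chi>\<close> lies in the BNS invariant and is not resonant. Conversely, if
  \<open>\<chi>\<close> factors through an epimorphism onto a nonabelian free group, it is resonant (free groups have no
  second cohomology) and not in the BNS invariant (their Cayley graphs are trees).

  In \<open>P\<Sigma>\<^sub>n\<close> the commutation relations among the \<open>\<beta>\<^sub>i\<^sub>j\<close>, which generate by Nielsen reduction, give the
  first alternative unless \<open>\<chi>\<close> is supported on \<open>{\<beta>\<^sub>i\<^sub>j, \<beta>\<^sub>j\<^sub>i}\<close>, or on the six \<open>\<beta>\<close> with indices in
  \<open>{i, j, k}\<close> with vanishing sum on each inner automorphism. In these two cases \<open>\<chi>\<close> factors through
  \<open>P\<Sigma>\<^sub>2 = F\<^sub>2\<close>, respectively \<open>P\<Sigma>\<^sub>3 / Inn F\<^sub>3 = F\<^sub>3\<close>; freeness of the latter follows by ping-pong on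
  triples of vertices of the Bass--Serre tree of \<open>\<langle>x\<^sub>i\<rangle> * \<langle>x\<^sub>j\<rangle> * \<langle>x\<^sub>k\<rangle>\<close>.
\<close>

section \<open>Characters and the BNS invariant of a group\<close>

text \<open>Neither invariant is computed. For a single character \<chi>, membership in the BNS
  invariant and nonresonance are shown to follow the same dichotomy.

  The obstacle is the construction of homomorphisms out of P\<Sigma>_n: prescribing their values on
  the \<beta> requires a presentation, whereas Nielsen reduction yields generation. So the free
  quotients are built from the other side. Automorphisms in P\<Sigma>_n act on the free group F_I on
  the x_i with i in I, because the remaining generators only go to conjugates of themselves; the
  kernel N of this action (for triples, modulo conjugations) is normal. A homomorphism \<psi> from
  F_I to P\<Sigma>_n can be prescribed freely on the basis. If \<psi> is injective modulo N and its
  image generates P\<Sigma>_n together with N, then P\<Sigma>_n is a semidirect product of N and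
  \<psi>(F_I), and the projection is the desired epimorphism. Injectivity modulo N rests on the
  trivial centre of F_2 for pairs and on ping-pong for triples.\<close>

lemma character_mult:
  assumes "\<chi> \<in> characters G" "x \<in> carrier G" "y \<in> carrier G"
  shows "\<chi> (x \<otimes>\<^bsub>G\<^esub> y) = \<chi> x + \<chi> y"
  using assms by (auto simp: characters_def hom_def real_group_def)

lemma restrict_in_characters:
  assumes "group G" "\<And>x y. x \<in> carrier G \<Longrightarrow> y \<in> carrier G \<Longrightarrow> f (x \<otimes>\<^bsub>G\<^esub> y) = f x + f y"
  shows "restrict f (carrier G) \<in> characters G"
proof -
  interpret group G by fact
  show ?thesis using assms(2) by (auto simp: characters_def hom_def real_group_def)
qed

lemma (in group) commute_inv:
  assumes "h \<otimes> z = z \<otimes> h" "h \<in> carrier G" "z \<in> carrier G"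
  shows "h \<otimes> inv z = inv z \<otimes> h"
proof -
  have "inv z \<otimes> (h \<otimes> z) = h"
    using assms inv_solve_left[of h z "h \<otimes> z"] by simp
  then show ?thesis using assms inv_solve_right[of "inv z \<otimes> h" h z] by (simp add: m_assoc)
qed

lemma ex_large_multiple:
  fixes a b :: real
  assumes "a > 0"
  obtains K :: nat where "\<And>k. k \<ge> K \<Longrightarrow> b \<le> real k * a"
proof -
  obtain K :: nat where "b / a \<le> K" using real_arch_simple by blast
  then have "b \<le> real K * a" using assms by (simp add: field_simps)
  then have "b \<le> real k * a" if "k \<ge> K" for k
    using that assms by (meson less_imp_le mult_right_mono of_nat_mono order_trans)
  then show thesis using that by blast
qed

locale group_character = group G for G (structure) +
  fixes \<chi> :: "'a \<Rightarrow> real" and S :: "'a set"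
  assumes char: "\<chi> \<in> characters G"
    and gens: "S \<subseteq> carrier G" "generate G S = carrier G"
begin

lemma chi_mult [simp]: "x \<in> carrier G \<Longrightarrow> y \<in> carrier G \<Longrightarrow> \<chi> (x \<otimes> y) = \<chi> x + \<chi> y"
  using character_mult[OF char] .

lemma chi_one [simp]: "\<chi> \<one> = 0"
  using chi_mult[of \<one> \<one>] by simp

lemma chi_inv [simp]: "x \<in> carrier G \<Longrightarrow> \<chi> (inv x) = - \<chi> x"
  using chi_mult[of x "inv x"] by simp

lemma chi_pow [simp]: "x \<in> carrier G \<Longrightarrow> \<chi> (x [^] (k::nat)) = k * \<chi> x"
  by (induction k) (auto simp: algebra_simps)

text \<open>Adjacency in the full subgraph on {\<chi> \<ge> r}, arcs unoriented. The BNS invariant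
  concerns r = 0; the other levels occur because translation by g shifts heights by \<chi>
  g.\<close>

definition step :: "real \<Rightarrow> 'a \<Rightarrow> 'a \<Rightarrow> bool" where
  "step r g h \<longleftrightarrow> g \<in> carrier G \<and> h \<in> carrier G \<and> r \<le> \<chi> g \<and> r \<le> \<chi> h \<and>
    (\<exists>s\<in>S. h = g \<otimes> s \<or> g = h \<otimes> s)"

text \<open>Reflexivity is unrestricted: \<open>conn r g g\<close> holds below level r as well,
  while a path with at least one edge stays in the subgraph.\<close>

definition conn :: "real \<Rightarrow> 'a \<Rightarrow> 'a \<Rightarrow> bool" where
  "conn r = (step r)\<^sup>*\<^sup>*"

lemma conn_refl [simp]: "conn r g g"
  by (simp add: conn_def)

lemma conn_trans [trans]: "conn r g h \<Longrightarrow> conn r h k \<Longrightarrow> conn r g k"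
  unfolding conn_def by (rule rtranclp_trans)

lemma conn_sym: "conn r g h \<Longrightarrow> conn r h g"
proof -
  have "symp (step r)" unfolding step_def by (intro sympI) blast
  then have "symp (conn r)" unfolding conn_def by (rule symp_rtranclp)
  then show "conn r g h \<Longrightarrow> conn r h g" by (rule sympD)
qed

lemma conn_mono: "conn r g h \<Longrightarrow> q \<le> r \<Longrightarrow> conn q g h"
proof -
  assume "q \<le> r"
  then have "step r \<le> step q" by (auto simp: step_def)
  then show "conn r g h \<Longrightarrow> conn q g h"
    unfolding conn_def using rtranclp_mono by blast
qed

text \<open>Left translations are automorphisms of the Cayley graph and change \<chi> by a
  constant.\<close>

lemma conn_left_mult:
  assumes "conn r g h" "x \<in> carrier G"
  shows "conn (r + \<chi> x) (x \<otimes> g) (x \<otimes> h)"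
  using assms(1) unfolding conn_def
proof (induction rule: rtranclp_induct)
  case (step y z)
  then obtain s where s: "s \<in> S" "z = y \<otimes> s \<or> y = z \<otimes> s"
    and yz: "y \<in> carrier G" "z \<in> carrier G" "r \<le> \<chi> y" "r \<le> \<chi> z"
    unfolding step_def by blast
  have "s \<in> carrier G" using s gens(1) by blast
  then have "x \<otimes> z = x \<otimes> y \<otimes> s \<or> x \<otimes> y = x \<otimes> z \<otimes> s"
    using s(2) yz assms(2) by (auto simp: m_assoc)
  then have "group_character.step G \<chi> S (r + \<chi> x) (x \<otimes> y) (x \<otimes> z)"
    using yz s(1) assms(2) by (auto simp: step_def)
  with step show ?case by (simp add: rtranclp.rtrancl_into_rtrancl)
qed simp

text \<open>The path from x to x g that spells g in the generators is a left translate of one fixed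
  path, so its loss of height c does not depend on x.\<close>

lemma conn_right_mult:
  assumes "g \<in> carrier G"
  obtains c where "\<And>x. x \<in> carrier G \<Longrightarrow> conn (\<chi> x - c) x (x \<otimes> g)"
proof -
  have "g \<in> generate G S" using assms gens by simp
  then have "\<exists>c. \<forall>x\<in>carrier G. conn (\<chi> x - c) x (x \<otimes> g)"
  proof (induction rule: generate.induct)
    case one
    then show ?case by auto
  next
    case (incl s)
    have "step (\<chi> x - \<bar>\<chi> s\<bar>) x (x \<otimes> s)" if "x \<in> carrier G" for x
      using that incl gens(1) by (auto simp: step_def)
    then show ?case unfolding conn_def by blast
  next
    case (inv s)
    then have s: "s \<in> carrier G" using gens(1) by auto
    have "step (\<chi> x - \<bar>\<chi> s\<bar>) x (x \<otimes> inv s)" if x: "x \<in> carrier G" for x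
    proof -
      have "x = x \<otimes> inv s \<otimes> s" using x s by (simp add: m_assoc)
      then show ?thesis using x s inv by (auto simp: step_def)
    qed
    then show ?case unfolding conn_def by blast
  next
    case (eng g h)
    then have gh: "g \<in> carrier G" "h \<in> carrier G" using gens by auto
    obtain c where c: "\<forall>x\<in>carrier G. conn (\<chi> x - c) x (x \<otimes> g)" using eng by auto
    obtain d where d: "\<forall>x\<in>carrier G. conn (\<chi> x - d) x (x \<otimes> h)" using eng by auto
    \<comment> \<open>The second path starts at height \<chi> x + \<chi> g, hence its loss relative
      to \<chi> x is d - \<chi> g.\<close>
    let ?c = "max c (d - \<chi> g)"
    have "conn (\<chi> x - ?c) x (x \<otimes> (g \<otimes> h))" if x: "x \<in> carrier G" for x
    proof -
      have "conn (\<chi> x - ?c) x (x \<otimes> g)" using c x by (auto intro: conn_mono)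
      also have "conn (\<chi> (x \<otimes> g) - d) (x \<otimes> g) (x \<otimes> g \<otimes> h)" by (rule bspec[OF d]) (use x gh in simp)
      then have "conn (\<chi> x - ?c) (x \<otimes> g) (x \<otimes> g \<otimes> h)"
        by (rule conn_mono) (use x gh in auto)
      finally show ?thesis using x gh by (simp add: m_assoc)
    qed
    then show ?case by blast
  qed
  then show thesis using that by blast
qed

lemma connected_iff:
  "Digraph_Component.connected (induce_subgraph (cayley_graph G S) {g \<in> carrier G. \<chi> g \<ge> 0})
    \<longleftrightarrow> (\<forall>g\<in>carrier G. \<chi> g \<ge> 0 \<longrightarrow> conn 0 \<one> g)"
proof -
  let ?V = "{g \<in> carrier G. \<chi> g \<ge> 0}"
  let ?M = "with_proj (mk_symmetric (induce_subgraph (cayley_graph G S) ?V))"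
  have V: "verts ?M = ?V" by simp
  have E: "(u, v) \<in> arcs_ends ?M \<longleftrightarrow> step 0 u v" for u v
  proof -
    have "(u, v) \<in> arcs_ends ?M \<longleftrightarrow>
        (\<exists>g s. g \<in> ?V \<and> s \<in> S \<and> g \<otimes> s \<in> ?V \<and> (u = g \<and> v = g \<otimes> s \<or> v = g \<and> u = g \<otimes> s))"
      by (simp add: mk_symmetric_def cayley_graph_def) blast
    also have "\<dots> \<longleftrightarrow> step 0 u v" unfolding step_def by blast
    finally show ?thesis .
  qed
  have R: "u \<rightarrow>\<^sup>*\<^bsub>?M\<^esub> v \<longleftrightarrow> conn 0 u v" if "u \<in> ?V" for u v
  proof
    assume "u \<rightarrow>\<^sup>*\<^bsub>?M\<^esub> v"
    then show "conn 0 u v" unfolding reachable_def conn_def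
    proof (induction rule: rtrancl_on_induct)
      case (step y z)
      then show ?case using E[of y z] by (meson rtranclp.rtrancl_into_rtrancl)
    qed simp
  next
    assume "conn 0 u v"
    then show "u \<rightarrow>\<^sup>*\<^bsub>?M\<^esub> v" unfolding reachable_def conn_def
    proof (induction rule: rtranclp_induct)
      case base
      then show ?case using that V by auto
    next
      case (step y z)
      then have "(y, z) \<in> arcs_ends ?M" "z \<in> verts ?M" using E[of y z] V by (auto simp: step_def)
      then show ?case by (rule rtrancl_on_into_rtrancl_on[OF step.IH])
    qed
  qed
  have 1: "\<one> \<in> ?V" by simp
  show ?thesis unfolding connected_def strongly_connected_def V
  proof (intro iffI conjI ballI impI)
    assume "?V \<noteq> {} \<and> (\<forall>u\<in>?V. \<forall>v\<in>?V. u \<rightarrow>\<^sup>*\<^bsub>?M\<^esub> v)"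
    then show "conn 0 \<one> g" if "g \<in> carrier G" "0 \<le> \<chi> g" for g using R[OF 1] 1 that by blast
  next
    assume *: "\<forall>g\<in>carrier G. 0 \<le> \<chi> g \<longrightarrow> conn 0 \<one> g"
    show "?V \<noteq> {}" using 1 by blast
    show "u \<rightarrow>\<^sup>*\<^bsub>?M\<^esub> v" if "u \<in> ?V" "v \<in> ?V" for u v
      unfolding R[OF that(1)] using that * by (blast intro: conn_sym conn_trans)
  qed
qed

text \<open>Rays are compared at equal exponents. For \<chi> t > 0 a shift of the exponent would
  describe the same end, since neighbouring points of the ray are joined at heights tending to
  infinity.\<close>

definition up_end :: "'a \<Rightarrow> 'a set" where
  "up_end t = {g \<in> carrier G. \<forall>r. \<exists>K. \<forall>k\<ge>K. conn r (t [^] (k::nat)) (g \<otimes> t [^] k)}"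

lemma up_end_carrier: "g \<in> up_end t \<Longrightarrow> g \<in> carrier G"
  unfolding up_end_def by blast

lemma up_endD:
  "g \<in> up_end t \<Longrightarrow> \<exists>K. \<forall>k\<ge>K. conn r (t [^] (k::nat)) (g \<otimes> t [^] k)"
  by (simp add: up_end_def)

text \<open>Translating by g or \<open>inv g\<close> changes the height of a path by a constant,
  which is absorbed by the quantifier over all levels r.\<close>

lemma subgroup_up_end:
  assumes t: "t \<in> carrier G"
  shows "subgroup (up_end t) G"
proof (rule subgroupI)
  show "up_end t \<subseteq> carrier G" unfolding up_end_def by blast
  have "\<one> \<in> up_end t" using t by (simp add: up_end_def)
  then show "up_end t \<noteq> {}" by blast
next
  fix g assume g: "g \<in> up_end t"
  then have gc: "g \<in> carrier G" by (simp add: up_end_def)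
  have "\<exists>K. \<forall>k\<ge>K. conn r (t [^] (k::nat)) (inv g \<otimes> t [^] k)" for r
  proof -
    obtain K where K: "\<And>k. k \<ge> K \<Longrightarrow> conn (r + \<chi> g) (t [^] (k::nat)) (g \<otimes> t [^] k)"
      using up_endD[OF g] by blast
    have "conn r (t [^] k) (inv g \<otimes> t [^] k)" if "k \<ge> K" for k
    proof -
      have "inv g \<otimes> (g \<otimes> t [^] k) = t [^] k"
        using inv_solve_left'[of "t [^] k" g "g \<otimes> t [^] k"] gc t by simp
      then show ?thesis
        using conn_left_mult[OF K[OF that], of "inv g"] gc by (simp add: conn_sym)
    qed
    then show ?thesis by blast
  qed
  then show "inv g \<in> up_end t" using gc by (simp add: up_end_def)
next
  fix g h assume g: "g \<in> up_end t" and h: "h \<in> up_end t"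
  then have gh: "g \<in> carrier G" "h \<in> carrier G" by (simp_all add: up_end_def)
  have "\<exists>K. \<forall>k\<ge>K. conn r (t [^] (k::nat)) (g \<otimes> h \<otimes> t [^] k)" for r
  proof -
    obtain K where K: "\<And>k. k \<ge> K \<Longrightarrow> conn r (t [^] (k::nat)) (g \<otimes> t [^] k)"
      using up_endD[OF g] by blast
    obtain L where L: "\<And>k. k \<ge> L \<Longrightarrow> conn (r - \<chi> g) (t [^] (k::nat)) (h \<otimes> t [^] k)"
      using up_endD[OF h] by blast
    have "conn r (t [^] k) (g \<otimes> h \<otimes> t [^] k)" if "k \<ge> max K L" for k
    proof -
      have "conn r (t [^] k) (g \<otimes> t [^] k)" using K that by simp
      also have "conn r (g \<otimes> t [^] k) (g \<otimes> (h \<otimes> t [^] k))"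
        using conn_left_mult[OF L[of k], of g] that gh by simp
      finally show ?thesis using gh t by (simp add: m_assoc)
    qed
    then show ?thesis by blast
  qed
  then show "g \<otimes> h \<in> up_end t" using gh by (simp add: up_end_def)
qed

text \<open>As g t^k = t^k g, the path spelling g leads from t^k to g t^k. It loses at most c, while
  the height k \<chi> t of its start is unbounded.\<close>

lemma commuting_in_up_end:
  assumes t: "t \<in> carrier G" "\<chi> t > 0" and g: "g \<in> carrier G" "g \<otimes> t = t \<otimes> g"
  shows "g \<in> up_end t"
proof -
  obtain c where c: "\<And>x. x \<in> carrier G \<Longrightarrow> conn (\<chi> x - c) x (x \<otimes> g)"
    using conn_right_mult[OF g(1)] by blast
  have comm: "g \<otimes> t [^] k = t [^] k \<otimes> g" for k :: nat
  proof (induction k)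
    case (Suc k)
    have "g \<otimes> t [^] Suc k = g \<otimes> t [^] k \<otimes> t" using t g by (simp add: m_assoc)
    also have "\<dots> = t [^] k \<otimes> (g \<otimes> t)" using Suc t g by (simp add: m_assoc)
    also have "\<dots> = t [^] Suc k \<otimes> g" using t g by (simp add: m_assoc)
    finally show ?case .
  qed (use g in simp)
  have "\<exists>K. \<forall>k\<ge>K. conn r (t [^] (k::nat)) (g \<otimes> t [^] k)" for r
  proof -
    obtain K :: nat where K: "\<And>k. k \<ge> K \<Longrightarrow> r + c \<le> real k * \<chi> t"
      using ex_large_multiple[OF t(2)] by blast
    have "conn r (t [^] k) (g \<otimes> t [^] k)" if "k \<ge> K" for k
      using conn_mono[OF c[of "t [^] k"], of r] K[OF that] t by (simp add: comm)
    then show ?thesis by blast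
  qed
  then show ?thesis using g by (simp add: up_end_def)
qed

text \<open>
  The rays \<open>t, t\<^sup>2, \<dots>\<close> and \<open>z, z\<^sup>2, \<dots>\<close> can be joined arbitrarily high up.
\<close>
lemma up_end_subset:
  assumes t: "t \<in> carrier G" and z: "z \<in> up_end t" "\<chi> z > 0"
  shows "up_end z \<subseteq> up_end t"
proof
  fix h assume h: "h \<in> up_end z"
  have zc: "z \<in> carrier G" and hc: "h \<in> carrier G" using z h by (auto simp: up_end_def)
  have join: "\<exists>K. \<forall>k\<ge>K. \<exists>M. \<forall>m\<ge>M. conn r (t [^] (k::nat)) (z [^] (m::nat))" for r
  proof -
    obtain K where K: "\<And>k. k \<ge> K \<Longrightarrow> conn r (t [^] (k::nat)) (z \<otimes> t [^] k)"
      using up_endD[OF z(1)] by blast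
    have "\<exists>M. \<forall>m\<ge>M. conn r (t [^] k) (z [^] (m::nat))" if k: "k \<ge> K" for k
    proof -
      \<comment> \<open>Chain the translates by 1, z, z^2, ... of the path from t^k to z t^k; they
        stay above r because \<chi> z > 0.\<close>
      have 1: "conn r (t [^] k) (z [^] m \<otimes> t [^] k)" for m :: nat
      proof (induction m)
        case (Suc m)
        have "conn (r + \<chi> (z [^] m)) (z [^] m \<otimes> t [^] k) (z [^] m \<otimes> (z \<otimes> t [^] k))"
          by (rule conn_left_mult[OF K[OF k]]) (simp add: zc)
        then have "conn r (z [^] m \<otimes> t [^] k) (z [^] m \<otimes> (z \<otimes> t [^] k))"
          by (rule conn_mono) (use z zc in simp)
        then show ?case using Suc t zc by (auto simp: m_assoc intro: conn_trans)
      qed (simp add: t)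
      \<comment> \<open>Removing t^k on the right costs c, which depends on k; hence the bound M on
        m is chosen after k.\<close>
      obtain c where c: "\<And>x. x \<in> carrier G \<Longrightarrow> conn (\<chi> x - c) x (x \<otimes> t [^] k)"
        using conn_right_mult[of "t [^] k"] t by auto
      obtain M :: nat where M: "\<And>m. m \<ge> M \<Longrightarrow> r + c \<le> real m * \<chi> z"
        using ex_large_multiple[OF z(2)] by blast
      have "conn r (t [^] k) (z [^] m)" if "m \<ge> M" for m
        using conn_sym[OF conn_mono[OF c[of "z [^] m"], of r]] M[OF that] zc conn_trans[OF 1] by simp
      then show ?thesis by blast
    qed
    then show ?thesis by blast
  qed
  have "\<exists>K. \<forall>k\<ge>K. conn r (t [^] (k::nat)) (h \<otimes> t [^] k)" for r
  proof -
    \<comment> \<open>The joining path is used twice, as it stands and translated by h; the maximum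
      keeps both copies above r.\<close>
    obtain K where K: "\<And>k. k \<ge> K \<Longrightarrow> \<exists>M. \<forall>m\<ge>M. conn (max r (r - \<chi> h)) (t [^] (k::nat)) (z [^] (m::nat))"
      using join by blast
    obtain L where L: "\<And>m. m \<ge> L \<Longrightarrow> conn r (z [^] (m::nat)) (h \<otimes> z [^] m)"
      using up_endD[OF h] by blast
    have "conn r (t [^] k) (h \<otimes> t [^] k)" if k: "k \<ge> K" for k
    proof -
      obtain M where "\<And>m. m \<ge> M \<Longrightarrow> conn (max r (r - \<chi> h)) (t [^] k) (z [^] (m::nat))"
        using K[OF k] by blast
      then have M: "conn (max r (r - \<chi> h)) (t [^] k) (z [^] max L M)" by simp
      have "conn r (t [^] k) (z [^] max L M)" by (rule conn_mono[OF M]) simp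
      also have "conn r (z [^] max L M) (h \<otimes> z [^] max L M)" by (rule L) simp
      also have "conn r (h \<otimes> z [^] max L M) (h \<otimes> t [^] k)"
        by (rule conn_sym[OF conn_mono[OF conn_left_mult[OF M hc]]]) linarith
      finally show ?thesis .
    qed
    then show ?thesis by blast
  qed
  then show "h \<in> up_end t" using hc by (simp add: up_end_def)
qed

text \<open>Up the ray from 1, across to its g-translate and down again: this joins 1 to g above -c,
  with c independent of g. The loss is removed by treating u^-k g u^k in this way and translating by
  u^k.\<close>

lemma connected_if_up_end:
  assumes t: "t \<in> carrier G" "\<chi> t > 0" and full: "up_end t = carrier G"
  shows "\<forall>g\<in>carrier G. \<chi> g \<ge> 0 \<longrightarrow> conn 0 \<one> g"
proof -
  obtain c where c: "\<And>x. x \<in> carrier G \<Longrightarrow> conn (\<chi> x - c) x (x \<otimes> t)"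
    using conn_right_mult[OF t(1)] by blast
  have up: "conn (- c) x (x \<otimes> t [^] k)" if x: "x \<in> carrier G" "\<chi> x \<ge> 0" for x and k :: nat
  proof (induction k)
    case (Suc k)
    have "conn (\<chi> (x \<otimes> t [^] k) - c) (x \<otimes> t [^] k) (x \<otimes> t [^] k \<otimes> t)"
      by (rule c) (use x t in simp)
    then have "conn (- c) (x \<otimes> t [^] k) (x \<otimes> t [^] k \<otimes> t)"
      by (rule conn_mono) (use x t in simp)
    then show ?case using Suc x t by (auto simp: m_assoc intro: conn_trans)
  qed (use x in simp)
  have low: "conn (- c) \<one> g" if g: "g \<in> carrier G" "\<chi> g \<ge> 0" for g
  proof -
    have "g \<in> up_end t" using full g by simp
    then obtain K where K: "\<And>k. k \<ge> K \<Longrightarrow> conn (- c) (t [^] (k::nat)) (g \<otimes> t [^] k)"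
      using up_endD by blast
    have "conn (- c) \<one> (t [^] K)" using up[of \<one> K] t by simp
    also have "conn (- c) (t [^] K) (g \<otimes> t [^] K)" by (rule K) simp
    also have "conn (- c) (g \<otimes> t [^] K) g" by (rule conn_sym[OF up]) (use g in auto)
    finally show ?thesis .
  qed
  have "\<exists>s\<in>S. \<chi> s \<noteq> 0"
  proof (rule ccontr)
    assume *: "\<not> ?thesis"
    have "t \<in> generate G S" using t gens by simp
    then have "\<chi> t = 0"
    proof (induction rule: generate.induct)
      case (inv s)
      then show ?case using * gens(1) by auto
    next
      case (eng g h)
      then show ?case using gens(2) by simp
    qed (use * in auto)
    then show False using t by simp
  qed
  then obtain s where s: "s \<in> S" "\<chi> s \<noteq> 0" by blast
  \<comment> \<open>A generator or the inverse of one, so that multiplication by u is a single edge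
    and the ray x, x u, x u^2, ... never falls below the height of x.\<close>
  define u where "u = (if \<chi> s > 0 then s else inv s)"
  have sc: "s \<in> carrier G" using s gens by auto
  have u: "u \<in> carrier G" "\<chi> u > 0" using sc s by (auto simp: u_def)
  have stepu: "step 0 x (x \<otimes> u)" if "x \<in> carrier G" "\<chi> x \<ge> 0" for x
  proof (cases "\<chi> s > 0")
    case True
    then show ?thesis using that s sc by (auto simp: u_def step_def)
  next
    case False
    then have "x = x \<otimes> u \<otimes> s" using that sc by (simp add: u_def m_assoc)
    then show ?thesis using that s sc u by (auto simp: step_def)
  qed
  have upu: "conn 0 x (x \<otimes> u [^] k)" if x: "x \<in> carrier G" "\<chi> x \<ge> 0" for x and k :: nat
  proof (induction k)
    case (Suc k)
    have "step 0 (x \<otimes> u [^] k) (x \<otimes> u [^] k \<otimes> u)" by (rule stepu) (use x u in auto)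
    then show ?case using Suc x u unfolding conn_def by (simp add: m_assoc)
  qed (use x in simp)
  show ?thesis
  proof (intro ballI impI)
    fix g assume g: "g \<in> carrier G" "\<chi> g \<ge> 0"
    obtain k :: nat where k: "c \<le> real k * \<chi> u" using ex_large_multiple[OF u(2)] by blast
    let ?u = "u [^] k"
    have "conn (- c) \<one> (inv ?u \<otimes> g \<otimes> ?u)" by (rule low) (use g u in auto)
    from conn_left_mult[OF this, of ?u]
    moreover have "?u \<otimes> (inv ?u \<otimes> g \<otimes> ?u) = g \<otimes> ?u"
      using inv_solve_left[of "inv ?u \<otimes> g \<otimes> ?u" ?u "g \<otimes> ?u"] g u by (simp add: m_assoc)
    ultimately have "conn (- c + \<chi> ?u) ?u (g \<otimes> ?u)" using u by simp
    then have "conn 0 ?u (g \<otimes> ?u)" by (rule conn_mono) (use k u in simp)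
    then show "conn 0 \<one> g"
      using upu[of \<one> k] conn_sym[OF upu[OF g, of k]] u by (auto intro: conn_trans)
  qed
qed

text \<open>By \<open>closed\<close>, t generates G if centralizers of elements outside the kernel
  of \<chi> may be adjoined; this is applied to the stabiliser of an end. Only ascending rays are
  considered, so t and z are replaced by their inverses when their values are negative.\<close>

theorem bns_criterion:
  assumes t: "t \<in> carrier G" "\<chi> t \<noteq> 0"
    and closed: "\<And>A. \<lbrakk>subgroup A G; t \<in> A;
      \<And>z h. \<lbrakk>z \<in> A; \<chi> z \<noteq> 0; h \<in> carrier G; h \<otimes> z = z \<otimes> h\<rbrakk> \<Longrightarrow> h \<in> A\<rbrakk> \<Longrightarrow> A = carrier G"
  shows "\<chi> \<in> bns_invariant G S"
proof -
  define u where "u = (if \<chi> t > 0 then t else inv t)"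
  have u: "u \<in> carrier G" "\<chi> u > 0" using t by (auto simp: u_def)
  interpret U: subgroup "up_end u" G by (rule subgroup_up_end[OF u(1)])
  have "up_end u = carrier G"
  proof (rule closed)
    have uu: "u \<in> up_end u" by (rule commuting_in_up_end[OF u u(1)]) simp
    show "t \<in> up_end u"
    proof (cases "\<chi> t > 0")
      case True
      then show ?thesis using uu by (simp add: u_def)
    next
      case False
      then have "u = inv t" by (simp only: u_def if_False)
      then have "inv u = t" using t(1) by (simp only: inv_inv)
      then show ?thesis using U.m_inv_closed[OF uu] by (simp only:)
    qed
  next
    fix z h assume z: "z \<in> up_end u" "\<chi> z \<noteq> 0" and h: "h \<in> carrier G" "h \<otimes> z = z \<otimes> h"
    have zc: "z \<in> carrier G" using z(1) by (rule up_end_carrier)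
    show "h \<in> up_end u"
    proof (cases "\<chi> z > 0")
      case True
      show ?thesis by (rule subsetD[OF up_end_subset[OF u(1) z(1) True]])
        (rule commuting_in_up_end[OF zc True h])
    next
      case False
      have "h \<otimes> inv z = inv z \<otimes> h"
        by (rule commute_inv[OF h(2,1) zc])
      moreover have pos: "\<chi> (inv z) > 0" using False z zc by simp
      ultimately have "h \<in> up_end (inv z)"
        using commuting_in_up_end[OF inv_closed[OF zc] pos h(1)] by (simp only:)
      then show ?thesis
        by (rule subsetD[OF up_end_subset[OF u(1) U.m_inv_closed[OF z(1)] pos]])
    qed
  qed (rule subgroup_up_end[OF u(1)])
  moreover have "\<chi> \<noteq> (\<lambda>x\<in>carrier G. 0)"
  proof
    assume "\<chi> = (\<lambda>x\<in>carrier G. 0)"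
    from fun_cong[OF this, of t] show False using t by simp
  qed
  ultimately show ?thesis
    unfolding bns_invariant_def
    by (intro CollectI conjI DiffI iffD2[OF connected_iff] connected_if_up_end[OF u] char)
      (simp_all only: singleton_iff not_False_eq_True)
qed

end

section \<open>Resonance in terms of characters\<close>

definition char_cochain :: "('a, 'b) monoid_scheme \<Rightarrow> ('a \<Rightarrow> real) \<Rightarrow> 'a list \<Rightarrow> real" where
  "char_cochain G b = (\<lambda>xs\<in>tuples G 1. b (hd xs))"

lemma tuples_1_iff: "[x] \<in> tuples G (Suc 0) \<longleftrightarrow> x \<in> carrier G"
  by (simp add: tuples_def)

lemma char_cochain_apply: "x \<in> carrier G \<Longrightarrow> char_cochain G b [x] = b x"
  by (simp add: char_cochain_def tuples_1_iff)

lemma char_cochain_carrier: "char_cochain G b \<in> carrier (cochains G 1)"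
  by (simp add: char_cochain_def cochains_def)

lemma char_cochain_eq_iff:
  "char_cochain G a = char_cochain G b \<longleftrightarrow> (\<forall>x\<in>carrier G. a x = b x)"
proof
  assume "char_cochain G a = char_cochain G b"
  then show "\<forall>x\<in>carrier G. a x = b x"
    using char_cochain_apply[of _ G a] char_cochain_apply[of _ G b] by metis
next
  assume *: "\<forall>x\<in>carrier G. a x = b x"
  show "char_cochain G a = char_cochain G b"
  proof (rule ext)
    fix xs
    show "char_cochain G a xs = char_cochain G b xs"
    proof (cases "xs \<in> tuples G 1")
      case True
      then obtain x where "x \<in> carrier G" "xs = [x]" unfolding tuples_1 by blast
      then show ?thesis using * by (simp add: char_cochain_apply)
    next
      case False
      then show ?thesis unfolding char_cochain_def restrict_def by (simp only: if_False)
    qed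
  qed
qed

lemma char_class_eq: "char_class G b = {char_cochain G b}"
  unfolding char_class_def char_cochain_def[symmetric] by (rule class_1[OF char_cochain_carrier])

lemma carrier_cohomology_1:
  assumes "group G"
  shows "carrier (cohomology G 1) = (\<lambda>b. {char_cochain G b}) ` characters G"
  using char_class_bij[OF assms] by (simp add: bij_betw_def char_class_eq)

lemma coboundary_1_apply:
  "x \<in> carrier G \<Longrightarrow> y \<in> carrier G \<Longrightarrow> coboundary G 1 f [x, y] = f [x] + f [y] - f [x \<otimes>\<^bsub>G\<^esub> y]"
  by (simp add: coboundary_def tuples_def)

lemma coboundaries_2_iff:
  assumes "group G"
  shows "F \<in> coboundaries G 2 \<longleftrightarrow> F \<in> extensional (tuples G 2) \<and>
    (\<exists>h. \<forall>x\<in>carrier G. \<forall>y\<in>carrier G. F [x, y] = h x + h y - h (x \<otimes>\<^bsub>G\<^esub> y))"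
    (is "_ \<longleftrightarrow> ?R F")
proof
  assume "F \<in> coboundaries G 2"
  then obtain f where f: "F = coboundary G 1 f" by (auto simp: coboundaries_def numeral_2_eq_2)
  have "F \<in> extensional (tuples G 2)" by (simp add: f coboundary_def numeral_2_eq_2)
  moreover have "\<forall>x\<in>carrier G. \<forall>y\<in>carrier G. F [x, y] = f [x] + f [y] - f [x \<otimes>\<^bsub>G\<^esub> y]"
    unfolding f using coboundary_1_apply[of _ G _ f] by blast
  ultimately show "?R F" by (intro conjI exI[of _ "\<lambda>x. f [x]"]) simp_all
next
  interpret group G by fact
  assume "?R F"
  then obtain h where h: "F \<in> extensional (tuples G 2)"
    "\<And>x y. x \<in> carrier G \<Longrightarrow> y \<in> carrier G \<Longrightarrow> F [x, y] = h x + h y - h (x \<otimes>\<^bsub>G\<^esub> y)" by blast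
  have "F = coboundary G 1 (char_cochain G h)"
  proof (rule extensionalityI[OF h(1)])
    show "coboundary G 1 (char_cochain G h) \<in> extensional (tuples G 2)"
      by (simp add: coboundary_def numeral_2_eq_2)
    fix xs assume "xs \<in> tuples G 2"
    then obtain x y where xy: "x \<in> carrier G" "y \<in> carrier G" "xs = [x, y]"
      unfolding tuples_2 by blast
    show "F xs = coboundary G 1 (char_cochain G h) xs"
      unfolding xy(3) coboundary_1_apply[OF xy(1,2)] h(2)[OF xy(1,2)]
      using xy by (simp add: char_cochain_apply)
  qed
  then show "F \<in> coboundaries G 2"
    using char_cochain_carrier[of G h] by (auto simp: coboundaries_def numeral_2_eq_2)
qed

lemma coboundaries_2_coset:
  assumes G: "group G" and F: "F \<in> extensional (tuples G 2)"
  shows "cohomology_class G 2 F = coboundaries G 2 \<longleftrightarrow> F \<in> coboundaries G 2"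
proof -
  let ?B = "coboundaries G 2"
  let ?add = "\<lambda>f g. \<lambda>xs\<in>tuples G 2. f xs + g xs :: real"
  have cls: "cohomology_class G 2 F = (\<lambda>f. ?add f F) ` ?B"
    by (auto simp: cohomology_class_def r_coset_def cochains_def)
  have in2: "[x, y] \<in> tuples G 2" if "x \<in> carrier G" "y \<in> carrier G" for x y
    using that by (simp add: tuples_def)
  \<comment> \<open>The values 1 and -1 of c give the two inclusions between the coset of F and the
    group of coboundaries.\<close>
  have comb: "(\<lambda>xs\<in>tuples G 2. f xs + c * g xs) \<in> ?B" if fg: "f \<in> ?B" "g \<in> ?B" for f g and c :: real
  proof -
    obtain h where h: "\<forall>x\<in>carrier G. \<forall>y\<in>carrier G. f [x, y] = h x + h y - h (x \<otimes>\<^bsub>G\<^esub> y)"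
      using fg(1) unfolding coboundaries_2_iff[OF G] by blast
    obtain k where k: "\<forall>x\<in>carrier G. \<forall>y\<in>carrier G. g [x, y] = k x + k y - k (x \<otimes>\<^bsub>G\<^esub> y)"
      using fg(2) unfolding coboundaries_2_iff[OF G] by blast
    show ?thesis unfolding coboundaries_2_iff[OF G]
    proof (intro conjI exI[of _ "\<lambda>x. h x + c * k x"] ballI)
      fix x y assume xy: "x \<in> carrier G" "y \<in> carrier G"
      have "(\<lambda>xs\<in>tuples G 2. f xs + c * g xs) [x, y]
          = (h x + h y - h (x \<otimes>\<^bsub>G\<^esub> y)) + c * (k x + k y - k (x \<otimes>\<^bsub>G\<^esub> y))"
        using h k xy by (simp add: in2)
      then show "(\<lambda>xs\<in>tuples G 2. f xs + c * g xs) [x, y]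
          = h x + c * k x + (h y + c * k y) - (h (x \<otimes>\<^bsub>G\<^esub> y) + c * k (x \<otimes>\<^bsub>G\<^esub> y))"
        by (simp only: algebra_simps)
    qed simp
  qed
  show ?thesis
  proof
    assume *: "cohomology_class G 2 F = ?B"
    have "(\<lambda>xs\<in>tuples G 2. 0) \<in> ?B" unfolding coboundaries_2_iff[OF G]
      by (intro conjI exI[of _ "\<lambda>x. 0"]) (auto simp: in2)
    then have "?add (\<lambda>xs\<in>tuples G 2. 0) F \<in> ?B" using * unfolding cls by blast
    moreover have "?add (\<lambda>xs\<in>tuples G 2. 0) F = F"
      by (rule extensionalityI[OF _ F]) auto
    ultimately show "F \<in> ?B" by simp
  next
    assume FB: "F \<in> ?B"
    show "cohomology_class G 2 F = ?B" unfolding cls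
    proof (intro equalityI subsetI)
      fix f assume "f \<in> (\<lambda>f. ?add f F) ` ?B"
      then show "f \<in> ?B" using comb[OF _ FB, of _ 1] by auto
    next
      fix f assume f: "f \<in> ?B"
      have "f = ?add (\<lambda>xs\<in>tuples G 2. f xs + (-1) * F xs) F"
        by (rule extensionalityI[of _ "tuples G 2"]) (use f in \<open>auto simp: coboundaries_2_iff[OF G]\<close>)
      then show "f \<in> (\<lambda>f. ?add f F) ` ?B" using comb[OF f FB, of "-1"] by blast
    qed
  qed
qed

lemma cup_char_coboundary:
  assumes "group G"
  shows "cup G 1 1 (char_cochain G a) (char_cochain G b) \<in> coboundaries G 2 \<longleftrightarrow>
    (\<exists>h. \<forall>x\<in>carrier G. \<forall>y\<in>carrier G. a x * b y = h x + h y - h (x \<otimes>\<^bsub>G\<^esub> y))"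
proof -
  let ?F = "cup G 1 1 (char_cochain G a) (char_cochain G b)"
  have "?F \<in> extensional (tuples G 2)" by (simp add: cup_def numeral_2_eq_2)
  moreover have "?F [x, y] = a x * b y" if "x \<in> carrier G" "y \<in> carrier G" for x y
    using that by (simp add: cup_def char_cochain_apply) (simp add: tuples_def)
  ultimately show ?thesis unfolding coboundaries_2_iff[OF assms] by simp
qed

text \<open>With trivial coefficients every 0-cochain is a cocycle, and the only coboundary of
  degree 0 is zero.\<close>

lemma carrier_cohomology_0: "carrier (cohomology G 0) = (\<lambda>c. {\<lambda>xs\<in>tuples G 0. c}) ` UNIV"
proof -
  have t0: "tuples G 0 = {[]}" by (auto simp: tuples_def)
  have "coboundary G 0 f = \<one>\<^bsub>cochains G (Suc 0)\<^esub>" for f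
    by (rule ext) (auto simp: coboundary_def cochains_def restrict_def tuples_1[simplified])
  then have "cocycles G 0 = extensional {[]}"
    by (auto simp: cocycles_def kernel_def cochains_def t0)
  moreover have "cohomology_class G 0 f = {f}" if "f \<in> extensional {[]}" for f
    using extensional_restrict[OF that]
    by (simp add: cohomology_class_def coboundaries_def r_coset_def cochains_def t0 cong: restrict_cong)
  ultimately have "carrier (cohomology G 0) = (\<lambda>f. {f}) ` extensional {[]}"
    by (simp add: carrier_cohomology)
  also have "\<dots> = (\<lambda>c. {\<lambda>xs\<in>{[]}. c}) ` UNIV"
  proof (intro equalityI subsetI)
    fix X :: "('a list \<Rightarrow> real) set" assume "X \<in> (\<lambda>f. {f}) ` extensional {[]}"
    then obtain f :: "'a list \<Rightarrow> real" where f: "f \<in> extensional {[]}" "X = {f}" by blast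
    have "f = (\<lambda>xs\<in>{[]}. f [])" using f(1) by (intro extensionalityI[of _ "{[]}"]) auto
    then show "X \<in> (\<lambda>c. {\<lambda>xs\<in>{[]}. c}) ` UNIV" using f(2) by blast
  qed auto
  finally show ?thesis by (simp add: t0)
qed

text \<open>The cohomology in question is the space of all b with \<chi> \<union> b = 0 modulo the
  multiples of \<chi>, which are the image of H^0; h is a cochain bounding the cup product. As
  \<open>coboundaries G 1\<close> is zero, classes of degree one are singletons and can be handled
  as characters. For \<chi> = 0 the criterion asks for a nonzero character.\<close>

theorem resonance_variety_iff:
  assumes G: "group G" and \<chi>: "\<chi> \<in> characters G"
  shows "char_class G \<chi> \<in> resonance_variety G \<longleftrightarrow>
    (\<exists>b\<in>characters G.
      (\<exists>h. \<forall>x\<in>carrier G. \<forall>y\<in>carrier G. \<chi> x * b y = h x + h y - h (x \<otimes>\<^bsub>G\<^esub> y)) \<and>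
      (\<forall>c. \<exists>x\<in>carrier G. b x \<noteq> c * \<chi> x))"
proof -
  interpret group G by fact
  let ?e = "char_cochain G"
  define cupc where "cupc b \<longleftrightarrow>
    (\<exists>h. \<forall>x\<in>carrier G. \<forall>y\<in>carrier G. \<chi> x * b y = h x + h y - h (x \<otimes>\<^bsub>G\<^esub> y))" for b
  define K where "K = kernel (cohomology G 1) (cohomology G 2) (resonance_diff G {?e \<chi>} 1)"
  define I where "I = resonance_diff G {?e \<chi>} 0 ` carrier (cohomology G 0)"
  have one2: "\<one>\<^bsub>cohomology G 2\<^esub> = coboundaries G 2"
    by (simp add: cohomology_def FactGroup_def)
  have diff1: "resonance_diff G {?e \<chi>} 1 {?e b} = \<one>\<^bsub>cohomology G 2\<^esub> \<longleftrightarrow> cupc b" for b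
  proof -
    have "resonance_diff G {?e \<chi>} 1 {?e b} = cohomology_class G 2 (cup G 1 1 (?e \<chi>) (?e b))"
      by (simp add: resonance_diff_def cup_class_def numeral_2_eq_2)
    moreover have "cup G 1 1 (?e \<chi>) (?e b) \<in> extensional (tuples G 2)"
      by (simp add: cup_def numeral_2_eq_2)
    ultimately show ?thesis
      unfolding one2 cupc_def using coboundaries_2_coset[OF G] cup_char_coboundary[OF G] by metis
  qed
  have K: "K = (\<lambda>b. {?e b}) ` {b \<in> characters G. cupc b}"
    unfolding K_def kernel_def carrier_cohomology_1[OF G] using diff1 by blast
  have diff0: "resonance_diff G {?e \<chi>} 0 {\<lambda>xs\<in>tuples G 0. c} = {?e (\<lambda>x. c * \<chi> x)}" for c
  proof -
    have "cup G 1 0 (?e \<chi>) (\<lambda>xs\<in>tuples G 0. c) = ?e (\<lambda>x. c * \<chi> x)"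
      by (rule extensionalityI[of _ "tuples G 1"])
        (auto simp: cup_def char_cochain_def tuples_def)
    then show ?thesis
      using class_1[OF char_cochain_carrier[of G "\<lambda>x. c * \<chi> x"]]
      by (simp add: resonance_diff_def cup_class_def)
  qed
  have I: "I = (\<lambda>c. {?e (\<lambda>x. c * \<chi> x)}) ` UNIV"
    unfolding I_def carrier_cohomology_0 by (simp add: image_image diff0)
  define H where "H = (cohomology G 1)\<lparr>carrier := K\<rparr>"
  have add: "{?e a} \<otimes>\<^bsub>H\<^esub> {?e b} = {?e (\<lambda>x. a x + b x)}" for a b
  proof -
    have "?e a \<otimes>\<^bsub>cochains G 1\<^esub> ?e b = ?e (\<lambda>x. a x + b x)"
      by (rule extensionalityI[of _ "tuples G 1"]) (auto simp: cochains_def char_cochain_def)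
    then show ?thesis by (simp add: H_def cohomology_def FactGroup_def set_mult_def)
  qed
  have res: "carrier (resonance_cohomology G {?e \<chi>}) = (\<lambda>X. I #>\<^bsub>H\<^esub> X) ` K"
    "\<one>\<^bsub>resonance_cohomology G {?e \<chi>}\<^esub> = I"
    unfolding resonance_cohomology_def K_def[symmetric] I_def[symmetric] H_def[symmetric]
    by (auto simp: FactGroup_def RCOSETS_def) (auto simp: H_def)
  have coset: "I #>\<^bsub>H\<^esub> {?e b} = (\<lambda>c. {?e (\<lambda>x. c * \<chi> x + b x)}) ` UNIV" for b
    unfolding I r_coset_def using add by auto
  have coset_iff: "I #>\<^bsub>H\<^esub> {?e b} = I \<longleftrightarrow> (\<exists>c. \<forall>x\<in>carrier G. b x = c * \<chi> x)" for b
  proof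
    assume *: "I #>\<^bsub>H\<^esub> {?e b} = I"
    have "{?e (\<lambda>x. 0 * \<chi> x + b x)} \<in> I" using * unfolding coset by blast
    then obtain c where "?e (\<lambda>x. 0 * \<chi> x + b x) = ?e (\<lambda>x. c * \<chi> x)" unfolding I by blast
    then show "\<exists>c. \<forall>x\<in>carrier G. b x = c * \<chi> x" unfolding char_cochain_eq_iff by auto
  next
    assume "\<exists>c. \<forall>x\<in>carrier G. b x = c * \<chi> x"
    then obtain c where c: "\<forall>x\<in>carrier G. b x = c * \<chi> x" by blast
    have "?e (\<lambda>x. d * \<chi> x + b x) = ?e (\<lambda>x. (d + c) * \<chi> x)" for d
      unfolding char_cochain_eq_iff using c by (simp add: algebra_simps)
    then have "I #>\<^bsub>H\<^esub> {?e b} = (\<lambda>d. {?e (\<lambda>x. d * \<chi> x)}) ` ((\<lambda>d. d + c) ` UNIV)"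
      unfolding coset image_image by simp
    also have "(\<lambda>d. d + c) ` UNIV = UNIV" by (rule surjI[of _ "\<lambda>d. d - c"]) simp
    finally show "I #>\<^bsub>H\<^esub> {?e b} = I" unfolding I .
  qed
  \<comment> \<open>Thus K is nonempty, so its image differs from {I} exactly if some coset differs
    from I.\<close>
  have zero: "{?e (\<lambda>x\<in>carrier G. 0)} \<in> K" unfolding K
  proof (intro imageI CollectI conjI)
    show "(\<lambda>x\<in>carrier G. 0) \<in> characters G" by (rule restrict_in_characters[OF G]) simp
    show "cupc (\<lambda>x\<in>carrier G. 0)" unfolding cupc_def by (intro exI[of _ "\<lambda>_. 0"]) simp
  qed
  have "{?e \<chi>} \<in> resonance_variety G \<longleftrightarrow> (\<lambda>X. I #>\<^bsub>H\<^esub> X) ` K \<noteq> {I}"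
    unfolding resonance_variety_def using \<chi> res by (simp add: carrier_cohomology_1[OF G, simplified])
  also have "\<dots> \<longleftrightarrow> (\<exists>X\<in>K. I #>\<^bsub>H\<^esub> X \<noteq> I)" using zero by blast
  also have "\<dots> \<longleftrightarrow> (\<exists>b\<in>characters G. cupc b \<and> (\<forall>c. \<exists>x\<in>carrier G. b x \<noteq> c * \<chi> x))"
    unfolding K using coset_iff by auto
  finally show ?thesis unfolding char_class_eq cupc_def .
qed

section \<open>Words in the free group\<close>

lemma free_group_simps:
  "carrier (free_group n) = {w. reduced w \<and> fst ` set w \<subseteq> {1..n}}"
  "u \<otimes>\<^bsub>free_group n\<^esub> v = foldr red_cons u v"
  "\<one>\<^bsub>free_group n\<^esub> = []"
  by (simp_all add: free_group_def)

lemma reduced_append_iff: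
  "reduced (u @ v) \<longleftrightarrow> reduced u \<and> reduced v \<and> (u = [] \<or> v = [] \<or> hd v \<noteq> inv_letter (last u))"
  by (auto simp: reduced_def successively_append_iff)

definition inv_word :: "word \<Rightarrow> word" where
  "inv_word w = rev (map inv_letter w)"

lemma inv_word_simps [simp]:
  "inv_word [] = []" "inv_word (a # w) = inv_word w @ [inv_letter a]"
  "inv_word (u @ v) = inv_word v @ inv_word u" "inv_word (inv_word w) = w"
  "inv_word w = [] \<longleftrightarrow> w = []" "length (inv_word w) = length w"
  "fst ` set (inv_word w) = fst ` set w"
  by (simp_all add: inv_word_def rev_map comp_def image_image)

lemma hd_inv_word: "w \<noteq> [] \<Longrightarrow> hd (inv_word w) = inv_letter (last w)"
  by (simp add: inv_word_def hd_rev last_map)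

lemma last_inv_word: "w \<noteq> [] \<Longrightarrow> last (inv_word w) = inv_letter (hd w)"
  by (simp add: inv_word_def last_rev hd_map)

lemma inv_letter_inject [simp]: "inv_letter a = inv_letter b \<longleftrightarrow> a = b"
  by (metis inv_letter_inv_letter)

lemma reduced_inv_word [simp]: "reduced (inv_word w) \<longleftrightarrow> reduced w"
proof -
  have "reduced (inv_word w)" if "reduced w" for w
    using that
  proof (induction w)
    case (Cons a w)
    then show ?case
      by (cases w) (auto simp: reduced_Cons reduced_append_iff last_inv_word)
  qed simp
  from this[of w] this[of "inv_word w"] show ?thesis by auto
qed

lemma red_cons_reduced: "reduced (a # w) \<Longrightarrow> red_cons a w = a # w"
  by (auto simp: red_cons_def reduced_Cons)

lemma foldr_red_cons_reduced: "reduced (u @ v) \<Longrightarrow> foldr red_cons u v = u @ v"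
proof (induction u)
  case (Cons a u)
  then have "foldr red_cons u v = u @ v" by (simp add: reduced_Cons)
  then show ?case using Cons.prems by (simp add: red_cons_reduced)
qed simp

lemma inv_free_group:
  assumes "w \<in> carrier (free_group n)"
  shows "inv\<^bsub>free_group n\<^esub> w = inv_word w"
proof -
  interpret F: group "free_group n" by (rule group_free_group)
  have "inv_word w \<in> carrier (free_group n)" using assms by (simp add: free_group_simps)
  moreover have "inv_word w \<otimes>\<^bsub>free_group n\<^esub> w = \<one>\<^bsub>free_group n\<^esub>"
    using foldr_red_cons_rev[of "[]" w] assms
    by (simp add: free_group_simps inv_word_def foldr_red_cons_Nil)
  ultimately show ?thesis using F.inv_equality assms by blast
qed

section \<open>Characters of the free group and cochains bounding their cup products\<close>

definition lval :: "(nat \<Rightarrow> real) \<Rightarrow> letter \<Rightarrow> real" where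
  "lval c a = (if snd a then c (fst a) else - c (fst a))"

text \<open>The character of the free group with value \<open>c i\<close> at
  \<open>x\<^sub>i\<close>.\<close>

definition lsum :: "(nat \<Rightarrow> real) \<Rightarrow> word \<Rightarrow> real" where
  "lsum c w = (\<Sum>a\<leftarrow>w. lval c a)"

lemma lval_inv_letter [simp]: "lval c (inv_letter a) = - lval c a"
  by (simp add: lval_def inv_letter_def)

lemma lsum_simps [simp]: "lsum c [] = 0" "lsum c (a # w) = lval c a + lsum c w"
  "lsum c (u @ v) = lsum c u + lsum c v"
  by (simp_all add: lsum_def)

lemma lsum_inv_word [simp]: "lsum c (inv_word w) = - lsum c w"
  by (induction w) simp_all

lemma lsum_red_cons [simp]: "lsum c (red_cons a w) = lval c a + lsum c w"
  by (cases w) (auto simp: red_cons_def)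

lemma lsum_foldr_red_cons [simp]: "lsum c (foldr red_cons u v) = lsum c u + lsum c v"
  by (induction u) simp_all

lemma lsum_replicate [simp]: "lsum c (replicate k a) = real k * lval c a"
  by (induction k) (simp_all add: algebra_simps)

text \<open>
  The third coordinate of the homomorphism to the real Heisenberg group that lifts
  \<open>(lsum c, lsum d)\<close>; the term \<open>lval c a * lval d a / 2\<close> makes it respect free cancellation.
\<close>

primrec heis :: "(nat \<Rightarrow> real) \<Rightarrow> (nat \<Rightarrow> real) \<Rightarrow> word \<Rightarrow> real" where
  "heis c d [] = 0"
| "heis c d (a # w) = heis c d w + lval c a * lval d a / 2 + lval c a * lsum d w"

lemma heis_red_cons:
  "heis c d (red_cons a w) = heis c d w + lval c a * lval d a / 2 + lval c a * lsum d w"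
  by (cases w) (auto simp: red_cons_def algebra_simps)

text \<open>Thus \<open>- heis c d\<close> bounds the cup product of \<open>lsum c\<close> and
  \<open>lsum d\<close>; in this form the vanishing of H^2 of a free group enters.\<close>

lemma heis_foldr_red_cons:
  "heis c d (foldr red_cons u v) = heis c d u + heis c d v + lsum c u * lsum d v"
  by (induction u) (simp_all add: heis_red_cons algebra_simps)

text \<open>In the tree, the geodesic from 1 to w v lies in the union of the geodesic from 1 to w
  and the w-translate of the geodesic from 1 to v. Of a vertex w u' on the latter only the height is
  kept.\<close>

lemma prefix_foldr_red_cons:
  assumes "prefix u (foldr red_cons w v)" "reduced w"
  shows "prefix u w \<or> (\<exists>u'. prefix u' v \<and> lsum c u = lsum c w + lsum c u')"
  using assms
proof (induction w arbitrary: u)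
  case (Cons a w)
  define M where "M = foldr red_cons w v"
  have w: "reduced w" using Cons.prems(2) by (simp add: reduced_Cons)
  show ?case
  proof (cases "M \<noteq> [] \<and> hd M = inv_letter a")
    case True
    then have M: "M = inv_letter a # tl M" by (cases M) auto
    have "foldr red_cons (a # w) v = red_cons a M" by (simp add: M_def)
    also have "\<dots> = tl M" using True by (simp add: red_cons_def)
    finally have "prefix u (tl M)" using Cons.prems(1) by simp
    \<comment> \<open>The cancelled letter is put back, so that the induction hypothesis applies to
      M; w itself cannot begin with it, since \<open>a # w\<close> is reduced.\<close>
    then have "prefix (inv_letter a # u) M" using M by (metis Cons_prefix_Cons)
    from Cons.IH[OF this[unfolded M_def] w] show ?thesis
    proof
      assume "prefix (inv_letter a # u) w"
      then have "w \<noteq> [] \<and> hd w = inv_letter a" by (auto simp: prefix_def)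
      then show ?thesis using Cons.prems(2) by (auto simp: reduced_Cons)
    qed (auto simp: algebra_simps)
  next
    case False
    have "foldr red_cons (a # w) v = red_cons a M" by (simp add: M_def)
    also have "\<dots> = a # M" using False by (auto simp: red_cons_def)
    finally have "prefix u (a # M)" using Cons.prems(1) by simp
    then consider "u = []" | u0 where "u = a # u0" "prefix u0 M" by (cases u) auto
    then show ?thesis
    proof cases
      case 2
      from Cons.IH[OF 2(2)[unfolded M_def] w] show ?thesis using 2(1) by auto
    qed simp
  qed
qed auto

section \<open>Characters factoring through a free group\<close>

text \<open>P and Q make the image of f nonabelian.\<close>

locale free_quotient = group_character G \<chi> S for G (structure) and \<chi> and S :: "'a set" +
  fixes n :: nat and f :: "'a \<Rightarrow> word" and c :: "nat \<Rightarrow> real" and p q :: nat and P Q :: 'a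
  assumes f_hom: "f \<in> hom G (free_group n)"
    and chi_f: "\<And>x. x \<in> carrier G \<Longrightarrow> \<chi> x = lsum c (f x)"
    and pq: "p \<noteq> q" "p \<in> {1..n}" "q \<in> {1..n}" "P \<in> carrier G" "Q \<in> carrier G" "f P = gen p" "f Q = gen q"
begin

lemma f_mult: "x \<in> carrier G \<Longrightarrow> y \<in> carrier G \<Longrightarrow> f (x \<otimes> y) = foldr red_cons (f x) (f y)"
  using f_hom by (simp add: hom_def free_group_simps)

lemma f_carrier: "x \<in> carrier G \<Longrightarrow> f x \<in> carrier (free_group n)"
  using f_hom by (auto simp: hom_def)

lemma f_reduced [simp]: "x \<in> carrier G \<Longrightarrow> reduced (f x)"
  using f_carrier by (simp add: free_group_simps)

lemma f_mult_reduced: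
  "x \<in> carrier G \<Longrightarrow> y \<in> carrier G \<Longrightarrow> reduced (f x @ f y) \<Longrightarrow> f (x \<otimes> y) = f x @ f y"
  by (simp only: f_mult foldr_red_cons_reduced)

lemma f_one: "f \<one> = []"
  using hom_one[OF f_hom is_group group_free_group] by (simp add: free_group_simps)

lemma f_inv: "x \<in> carrier G \<Longrightarrow> f (inv x) = inv_word (f x)"
proof -
  assume x: "x \<in> carrier G"
  interpret h: group_hom G "free_group n" f
    by (simp add: group_hom_def group_hom_axioms_def is_group group_free_group f_hom)
  show ?thesis using x by (simp add: inv_free_group f_carrier)
qed

text \<open>Every character obtained by composing some \<open>lsum d\<close> with f has zero cup
  product with \<chi>, by \<open>heis c d\<close>; it remains to choose d so that this character is
  no multiple of \<chi>, which P and Q detect.\<close>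

lemma resonant: "char_class G \<chi> \<in> resonance_variety G"
proof -
  \<comment> \<open>On the coordinates p, q this is (c p, c q) rotated by a right angle, hence no
    real multiple of it; the first branch covers the zero vector.\<close>
  define d where "d = (\<lambda>i. if c p = 0 \<and> c q = 0 then (if i = p then 1 else 0) else
    if i = p then - c q else if i = q then c p else 0)"
  define b where "b = (\<lambda>x\<in>carrier G. lsum d (f x))"
  have "b \<in> characters G" unfolding b_def
    by (rule restrict_in_characters[OF is_group]) (simp add: f_mult)
  moreover have "\<chi> x * b y = - heis c d (f x) + - heis c d (f y) - - heis c d (f (x \<otimes> y))"
    if "x \<in> carrier G" "y \<in> carrier G" for x y
    using that by (simp add: b_def chi_f f_mult heis_foldr_red_cons)
  moreover have "\<exists>x\<in>carrier G. b x \<noteq> e * \<chi> x" for e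
  proof (rule ccontr)
    assume "\<not> ?thesis"
    then have "b P = e * \<chi> P" "b Q = e * \<chi> Q" using pq by auto
    then have *: "d p = e * c p" "d q = e * c q" using pq by (simp_all add: b_def chi_f gen_def lval_def)
    show False
    proof (cases "c p = 0 \<and> c q = 0")
      case True
      then show False using * by (simp add: d_def)
    next
      case False
      then have 1: "- c q = e * c p" "c p = e * c q" using * pq(1) by (auto simp: d_def)
      have "c p * (1 + e * e) = c p + e * (e * c p)" by (simp add: algebra_simps)
      also have "\<dots> = 0" unfolding 1(1)[symmetric] using 1(2) by simp
      finally have "c p * (1 + e * e) = 0" .
      moreover have "1 + e * e > 0" by (simp add: add_pos_nonneg)
      ultimately have "c p = 0" by simp
      then show False using 1 False by simp
    qed
  qed
  ultimately show ?thesis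
    unfolding resonance_variety_iff[OF is_group char]
    by (intro bexI[of _ b] conjI exI[of _ "\<lambda>x. - heis c d (f x)"] ballI allI) (simp_all only:)
qed

text \<open>The Cayley graph of a free group is a tree, so a path to \<open>g\<close> must pass near every prefix of \<open>f g\<close>.\<close>

lemma prefix_bound:
  assumes conn: "conn 0 \<one> g"
    and C: "\<And>s u. s \<in> S \<Longrightarrow> prefix u (f s) \<or> prefix u (inv_word (f s)) \<Longrightarrow> - C \<le> lsum c u" "0 \<le> C"
    and u: "prefix u (f g)"
  shows "- C \<le> lsum c u"
  using conn u unfolding conn_def
proof (induction arbitrary: u rule: rtranclp_induct)
  case base
  then show ?case using C(2) by (simp add: f_one)
next
  case (step y z)
  from step(2) obtain s where s: "s \<in> S" "z = y \<otimes> s \<or> y = z \<otimes> s"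
    and yz: "y \<in> carrier G" "z \<in> carrier G" "0 \<le> \<chi> y"
    unfolding step_def by blast
  have sc: "s \<in> carrier G" using s gens(1) by blast
  define v where "v = (if z = y \<otimes> s then f s else inv_word (f s))"
  have "f z = foldr red_cons (f y) v"
  proof (cases "z = y \<otimes> s")
    case True
    have "f z = foldr red_cons (f y) (f s)" unfolding True by (rule f_mult[OF yz(1) sc])
    then show ?thesis using True by (simp only: v_def if_True simp_thms)
  next
    case False
    then have y: "y = z \<otimes> s" using s(2) by blast
    have "z = y \<otimes> inv s" unfolding y using yz sc by (simp add: m_assoc)
    then have "f z = foldr red_cons (f y) (f (inv s))"
      using f_mult[OF yz(1) inv_closed[OF sc]] by (simp only:)
    then show ?thesis using False sc by (simp only: v_def if_False f_inv)
  qed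
  then have "prefix u (foldr red_cons (f y) v)" using step.prems by simp
  from prefix_foldr_red_cons[OF this, of c]
  \<comment> \<open>A prefix that is not already one of \<open>f y\<close> ends within the last
    edge, which starts at the nonnegative height \<chi> y and loses at most C.\<close>
  have "prefix u (f y) \<or> (\<exists>u'. prefix u' v \<and> lsum c u = lsum c (f y) + lsum c u')"
    using yz by simp
  then show ?case
  proof
    assume "prefix u (f y)"
    then show ?thesis by (rule step.IH)
  next
    assume "\<exists>u'. prefix u' v \<and> lsum c u = lsum c (f y) + lsum c u'"
    then obtain u' where u': "prefix u' v" "lsum c u = lsum c (f y) + lsum c u'" by blast
    have "- C \<le> lsum c u'" by (rule C(1)[OF s(1)]) (use u'(1) in \<open>auto simp: v_def split: if_splits\<close>)
    then show ?thesis using u'(2) yz chi_f[of y] by simp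
  qed
qed

text \<open>Let a, b be letters with indices p, q and values |c p|, |c q|. An element over a^-k b
  a^k has height |c q| \<ge> 0, but every path to it from 1 passes near a^-k, whose height -k |c p|
  lies below any bound for large k.\<close>

lemma not_in_bns:
  assumes fin: "finite S" and cp: "c p \<noteq> 0"
  shows "\<chi> \<notin> bns_invariant G S"
proof
  assume "\<chi> \<in> bns_invariant G S"
  then have "\<forall>g\<in>carrier G. 0 \<le> \<chi> g \<longrightarrow> conn 0 \<one> g"
    unfolding bns_invariant_def by (intro iffD1[OF connected_iff]) (simp only: mem_Collect_eq)
  then have conn: "\<And>g. g \<in> carrier G \<Longrightarrow> 0 \<le> \<chi> g \<Longrightarrow> conn 0 \<one> g" by (simp only:)
  \<comment> \<open>All heights, up to sign, along the words that a single edge of the Cayley graph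
    can contribute. The entry 0 provides a maximum for empty S and makes it nonnegative.\<close>
  define X where "X = insert 0 (\<Union>s\<in>S. (\<lambda>u. \<bar>lsum c u\<bar>) ` (set (prefixes (f s)) \<union> set (prefixes (inv_word (f s)))))"
  define C where "C = Max X"
  have X: "finite X" using fin by (simp add: X_def)
  have C: "- C \<le> lsum c u" if "s \<in> S" "prefix u (f s) \<or> prefix u (inv_word (f s))" for s u
  proof -
    have "u \<in> set (prefixes (f s)) \<union> set (prefixes (inv_word (f s)))"
      using that(2) by simp
    then have "\<bar>lsum c u\<bar> \<in> X" unfolding X_def using that(1) by blast
    then have "\<bar>lsum c u\<bar> \<le> C" unfolding C_def using X by simp
    then show ?thesis by simp
  qed
  have C0: "0 \<le> C" unfolding C_def using X by (simp add: X_def)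
  have letter: "\<exists>T\<in>carrier G. \<exists>a. f T = [a] \<and> fst a = r \<and> lval c a = \<bar>c r\<bar>"
    if "R \<in> carrier G" "f R = gen r" for R r
  proof (cases "c r \<ge> 0")
    case True
    then show ?thesis using that by (intro bexI[of _ R] exI[of _ "(r, True)"]) (simp_all add: gen_def lval_def)
  next
    case False
    then show ?thesis using that
      by (intro bexI[of _ "inv R"] exI[of _ "(r, False)"])
        (simp_all add: gen_def lval_def f_inv inv_word_def inv_letter_def)
  qed
  obtain T a where T: "T \<in> carrier G" "f T = [a]" "fst a = p" "lval c a = \<bar>c p\<bar>"
    using letter[of P p] pq by blast
  obtain Y b where Y: "Y \<in> carrier G" "f Y = [b]" "fst b = q" "lval c b = \<bar>c q\<bar>"
    using letter[of Q q] pq by blast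
  have red: "reduced (replicate k x)" for k and x :: letter
    by (induction k) (auto simp: reduced_Cons)
  have pow: "f (x [^] k) = replicate k y" if "x \<in> carrier G" "f x = [y]" for x y and k :: nat
  proof (induction k)
    case (Suc k)
    have "reduced (replicate k y @ [y])"
      using red[of "Suc k" y] by (simp add: replicate_append_same)
    then show ?case
      using f_mult_reduced[of "x [^] k" x] Suc that by (simp add: replicate_append_same)
  qed (simp add: f_one)
  obtain k :: nat where k: "C + 1 \<le> real k * \<bar>c p\<bar>"
    using ex_large_multiple[of "\<bar>c p\<bar>" "C + 1"] cp by auto
  define g where "g = inv T [^] k \<otimes> (Y \<otimes> T [^] k)"
  have fT: "f (T [^] k) = replicate k a" "f (inv T [^] k) = replicate k (inv_letter a)"
    using T by (simp_all add: pow f_inv)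
  have r: "reduced (replicate k (inv_letter a) @ [b] @ replicate k a)"
  proof (cases "k = 0")
    case False
    have "b \<noteq> a" "a \<noteq> inv_letter b" using T Y pq by auto
    then show ?thesis
      using red[of k a] red[of k "inv_letter a"] False
      by (auto simp: reduced_append_iff reduced_Cons)
  qed (simp add: reduced_Cons)
  have fY: "f (Y \<otimes> T [^] k) = [b] @ replicate k a"
    using f_mult_reduced[of Y "T [^] k"] r T Y fT by (simp add: reduced_append_iff)
  have fg: "f g = replicate k (inv_letter a) @ [b] @ replicate k a"
    unfolding g_def using f_mult_reduced[of "inv T [^] k" "Y \<otimes> T [^] k"] r T Y fT fY by simp
  have "\<chi> g \<ge> 0" "g \<in> carrier G" using T Y chi_f[of Y] by (simp_all add: g_def)
  then have "- C \<le> lsum c (replicate k (inv_letter a))"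
    by (intro prefix_bound[OF conn C C0, of g]) (auto simp: fg)
  then show False using T(4) k by simp
qed

end

section \<open>Partial conjugations\<close>

lemma free_group_hom_eq:
  assumes "group H" "g \<in> hom (free_group n) H" "h \<in> hom (free_group n) H"
    and "\<And>i. i \<in> {1..n} \<Longrightarrow> g (gen i) = h (gen i)" and w: "w \<in> carrier (free_group n)"
  shows "g w = h w"
proof -
  let ?C = "carrier (free_group n)"
  interpret F: group "free_group n" by (rule group_free_group)
  have gen: "g (gen i) \<in> carrier H" if "i \<in> {1..n}" for i
    using assms(2) gen_in_free_group[OF that] by (auto simp: hom_def)
  have r: "restrict k ?C \<in> hom (free_group n) H \<inter> extensional ?C"
    if "k \<in> hom (free_group n) H" for k
    using that by (auto simp: hom_def)
  have "restrict g ?C = restrict h ?C"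
    using free_group_universal[of H n "\<lambda>i. g (gen i)", OF assms(1) gen] r[OF assms(2)] r[OF assms(3)] assms(4)
      gen_in_free_group[of _ n]
    by (metis (no_types, lifting) restrict_apply')
  then show ?thesis using w by (metis restrict_apply')
qed

definition free_lift :: "nat \<Rightarrow> ('a, 'b) monoid_scheme \<Rightarrow> (nat \<Rightarrow> 'a) \<Rightarrow> word \<Rightarrow> 'a" where
  "free_lift n H f = (THE h. h \<in> hom (free_group n) H \<inter> extensional (carrier (free_group n)) \<and>
    (\<forall>i\<in>{1..n}. h (gen i) = f i))"

lemma free_lift:
  assumes "group H" "\<And>i. i \<in> {1..n} \<Longrightarrow> f i \<in> carrier H"
  shows "free_lift n H f \<in> hom (free_group n) H"
    and "free_lift n H f \<in> extensional (carrier (free_group n))"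
    and "\<And>i. i \<in> {1..n} \<Longrightarrow> free_lift n H f (gen i) = f i"
  using theI'[OF free_group_universal[of H n f, OF assms]] unfolding free_lift_def by auto

locale psigma =
  fixes n :: nat
begin

abbreviation F :: "word monoid" where "F \<equiv> free_group n"
abbreviation G :: "(word \<Rightarrow> word) monoid" where "G \<equiv> PSigma n"

sublocale F: group F by (rule group_free_group)
sublocale G: group G by (rule group_PSigma)

lemma letter_in_F: "fst a \<in> {1..n} \<Longrightarrow> [a] \<in> carrier F"
  by (simp add: free_group_simps reduced_Cons)

lemma inv_letter_F: "fst a \<in> {1..n} \<Longrightarrow> inv\<^bsub>F\<^esub> [a] = [inv_letter a]"
  by (simp add: inv_free_group letter_in_F)

lemma gen_F: "i \<in> {1..n} \<Longrightarrow> gen i \<in> carrier F"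
  by (rule gen_in_free_group)

lemma letter_cases:
  obtains "[a] = gen (fst a)" | "fst a \<in> {1..n} \<Longrightarrow> [a] = inv\<^bsub>F\<^esub> gen (fst a)"
proof (cases "snd a")
  case True
  then show thesis using that(1) by (simp add: gen_def prod_eq_iff)
next
  case False
  have "[a] = inv\<^bsub>F\<^esub> gen (fst a)" if "fst a \<in> {1..n}"
    using inv_letter_F[of "(fst a, True)"] that False
    by (simp add: gen_def inv_letter_def prod_eq_iff)
  then show thesis using that(2) by blast
qed

lemma hom_F_mult:
  "h \<in> hom F F \<Longrightarrow> u \<in> carrier F \<Longrightarrow> v \<in> carrier F \<Longrightarrow> h (u \<otimes>\<^bsub>F\<^esub> v) = h u \<otimes>\<^bsub>F\<^esub> h v"
  by (rule hom_mult)

lemma hom_F_closed: "h \<in> hom F F \<Longrightarrow> u \<in> carrier F \<Longrightarrow> h u \<in> carrier F"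
  by (auto simp: hom_def)

lemma hom_F_inv:
  assumes "h \<in> hom F F" "u \<in> carrier F"
  shows "h (inv\<^bsub>F\<^esub> u) = inv\<^bsub>F\<^esub> h u"
proof -
  interpret h: group_hom F F h
    by (simp add: group_hom_def group_hom_axioms_def F.is_group assms)
  show ?thesis using assms by simp
qed

lemmas hom_F = hom_F_mult hom_F_closed hom_F_inv

lemma carrier_G:
  "\<phi> \<in> carrier G \<longleftrightarrow> \<phi> \<in> hom F F \<and> \<phi> \<in> Bij (carrier F) \<and> (\<forall>i\<in>{1..n}. \<exists>w\<in>carrier F.
    \<phi> (gen i) = inv\<^bsub>F\<^esub> w \<otimes>\<^bsub>F\<^esub> gen i \<otimes>\<^bsub>F\<^esub> w)"
  by (auto simp: PSigma_def basis_conjugating_def AutoGroup_def auto_def)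

lemma G_hom: "\<phi> \<in> carrier G \<Longrightarrow> \<phi> \<in> hom F F"
  by (simp add: carrier_G)

lemmas G_app = hom_F_mult[OF G_hom] hom_F_closed[OF G_hom] hom_F_inv[OF G_hom]

lemma mult_G: "\<phi> \<in> carrier G \<Longrightarrow> \<psi> \<in> carrier G \<Longrightarrow> \<phi> \<otimes>\<^bsub>G\<^esub> \<psi> = compose (carrier F) \<phi> \<psi>"
  by (simp add: carrier_G) (simp add: PSigma_def AutoGroup_def BijGroup_def)

lemma mult_G_apply:
  "\<phi> \<in> carrier G \<Longrightarrow> \<psi> \<in> carrier G \<Longrightarrow> x \<in> carrier F \<Longrightarrow> (\<phi> \<otimes>\<^bsub>G\<^esub> \<psi>) x = \<phi> (\<psi> x)"
  by (simp add: mult_G compose_def)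

lemma one_G_apply: "x \<in> carrier F \<Longrightarrow> \<one>\<^bsub>G\<^esub> x = x"
  by (simp add: PSigma_def AutoGroup_def BijGroup_def)

lemma inv_G_apply:
  assumes "\<phi> \<in> carrier G" "x \<in> carrier F"
  shows "\<phi> ((inv\<^bsub>G\<^esub> \<phi>) x) = x" "(inv\<^bsub>G\<^esub> \<phi>) (\<phi> x) = x"
  using mult_G_apply[of \<phi> "inv\<^bsub>G\<^esub> \<phi>" x] mult_G_apply[of "inv\<^bsub>G\<^esub> \<phi>" \<phi> x] assms
  by (simp_all add: one_G_apply)

lemma G_eqI:
  assumes "\<phi> \<in> carrier G" "\<psi> \<in> carrier G" "\<And>i. i \<in> {1..n} \<Longrightarrow> \<phi> (gen i) = \<psi> (gen i)"
  shows "\<phi> = \<psi>"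
proof (rule extensionalityI[of _ "carrier F"])
  show "\<phi> \<in> extensional (carrier F)" "\<psi> \<in> extensional (carrier F)"
    using assms by (auto simp: carrier_G Bij_def)
  show "\<phi> w = \<psi> w" if "w \<in> carrier F" for w
    by (rule free_group_hom_eq[OF F.is_group G_hom[OF assms(1)] G_hom[OF assms(2)] assms(3) that])
qed

text \<open>If the index j of a lies outside I, this is the product of the commuting \<beta> i j, i
  in I, or of their inverses; for I the set of all other indices it is an inner automorphism. Moving
  a whole set at once puts the commutation relations into one uniform shape.\<close>

definition pconj :: "nat set \<Rightarrow> letter \<Rightarrow> word \<Rightarrow> word" where
  "pconj I a = free_lift n F
    (\<lambda>i. if i \<in> I then inv\<^bsub>F\<^esub> [a] \<otimes>\<^bsub>F\<^esub> gen i \<otimes>\<^bsub>F\<^esub> [a] else gen i)"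

abbreviation \<beta> :: "nat \<Rightarrow> nat \<Rightarrow> word \<Rightarrow> word" where
  "\<beta> i j \<equiv> pconj {i} (j, True)"

lemma pconj_lift:
  assumes "fst a \<in> {1..n}"
  shows pconj_hom: "pconj I a \<in> hom F F"
    and pconj_ext: "pconj I a \<in> extensional (carrier F)"
    and pconj_gen: "i \<in> {1..n} \<Longrightarrow> pconj I a (gen i) =
      (if i \<in> I then inv\<^bsub>F\<^esub> [a] \<otimes>\<^bsub>F\<^esub> gen i \<otimes>\<^bsub>F\<^esub> [a] else gen i)"
proof -
  note l = free_lift[OF F.is_group, of n "\<lambda>i. if i \<in> I then inv\<^bsub>F\<^esub> [a] \<otimes>\<^bsub>F\<^esub> gen i \<otimes>\<^bsub>F\<^esub> [a] else gen i",
      folded pconj_def]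
  show "pconj I a \<in> hom F F" "pconj I a \<in> extensional (carrier F)"
    using l(1,2) letter_in_F[OF assms] gen_F by auto
  show "i \<in> {1..n} \<Longrightarrow> pconj I a (gen i) =
      (if i \<in> I then inv\<^bsub>F\<^esub> [a] \<otimes>\<^bsub>F\<^esub> gen i \<otimes>\<^bsub>F\<^esub> [a] else gen i)"
    using l(3) letter_in_F[OF assms] gen_F by auto
qed

lemma pconj_letter:
  assumes a: "fst a \<in> {1..n}" and b: "fst b \<in> {1..n}"
  shows "pconj I a [b] = (if fst b \<in> I then inv\<^bsub>F\<^esub> [a] \<otimes>\<^bsub>F\<^esub> [b] \<otimes>\<^bsub>F\<^esub> [a] else [b])"
proof -
  note g = gen_F[OF b] and l = letter_in_F[OF a]
  show ?thesis
  proof (cases rule: letter_cases[of b])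
    case 1
    then show ?thesis using pconj_gen[OF a b, of I] by simp
  next
    case 2
    have "pconj I a [b] = inv\<^bsub>F\<^esub> pconj I a (gen (fst b))"
      unfolding 2[OF b] by (rule hom_F_inv[OF pconj_hom[OF a] g])
    then show ?thesis using pconj_gen[OF a b, of I] g l
      by (simp add: 2[OF b] F.inv_mult_group F.m_assoc)
  qed
qed

text \<open>As the index of a lies outside I, both maps fix the letter a, and the two conjugations
  cancel.\<close>

lemma pconj_inv_letter:
  assumes a: "fst a \<in> {1..n}" "fst a \<notin> I" and w: "w \<in> carrier F"
  shows "pconj I a (pconj I (inv_letter a) w) = w"
proof -
  let ?p = "pconj I a" and ?q = "pconj I (inv_letter a)"
  note l = letter_in_F[OF a(1)]
  have p: "?p \<in> hom F F" and q: "?q \<in> hom F F" using pconj_hom a by auto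
  have "?p \<circ> ?q \<in> hom F F" by (rule hom_compose[OF q p])
  moreover have "(\<lambda>x. x) \<in> hom F F" by (auto simp: hom_def)
  moreover have "(?p \<circ> ?q) (gen i) = gen i" if i: "i \<in> {1..n}" for i
  proof (cases "i \<in> I")
    case True
    note g = gen_F[OF i]
    have "?q (gen i) = [a] \<otimes>\<^bsub>F\<^esub> gen i \<otimes>\<^bsub>F\<^esub> inv\<^bsub>F\<^esub> [a]"
      using True pconj_gen[of "inv_letter a" i I] a i l by (simp flip: inv_letter_F)
    moreover have "?p [a] = [a]" using pconj_letter[OF a(1) a(1)] a(2) by simp
    moreover have "?p (gen i) = inv\<^bsub>F\<^esub> [a] \<otimes>\<^bsub>F\<^esub> gen i \<otimes>\<^bsub>F\<^esub> [a]"
      using True pconj_gen[OF a(1) i] by simp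
    moreover have "[a] \<otimes>\<^bsub>F\<^esub> (inv\<^bsub>F\<^esub> [a] \<otimes>\<^bsub>F\<^esub> gen i \<otimes>\<^bsub>F\<^esub> [a]) \<otimes>\<^bsub>F\<^esub> inv\<^bsub>F\<^esub> [a] = gen i"
      using l g by (simp add: F.m_assoc) (simp add: F.m_assoc[symmetric])
    ultimately show ?thesis using l g p by (simp add: hom_F)
  next
    case False
    then show ?thesis using pconj_gen[of a i I] pconj_gen[of "inv_letter a" i I] a i by simp
  qed
  ultimately show ?thesis using free_group_hom_eq[OF F.is_group, of "?p \<circ> ?q" n "\<lambda>x. x" w] w by simp
qed

lemma pconj_in_G:
  assumes a: "fst a \<in> {1..n}" "fst a \<notin> I"
  shows "pconj I a \<in> carrier G"
proof -
  note l = letter_in_F[OF a(1)]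
  have "bij_betw (pconj I a) (carrier F) (carrier F)"
  proof (rule bij_betw_byWitness[where f' = "pconj I (inv_letter a)"])
    show "\<forall>w\<in>carrier F. pconj I (inv_letter a) (pconj I a w) = w"
      using pconj_inv_letter[of "inv_letter a" I] a by simp
    show "\<forall>w\<in>carrier F. pconj I a (pconj I (inv_letter a) w) = w"
      using pconj_inv_letter[of a I] a by simp
    show "pconj I a ` carrier F \<subseteq> carrier F" "pconj I (inv_letter a) ` carrier F \<subseteq> carrier F"
      by (intro image_subsetI hom_F_closed[OF pconj_hom]; use a in simp)+
  qed
  moreover have "\<exists>w\<in>carrier F. pconj I a (gen i) = inv\<^bsub>F\<^esub> w \<otimes>\<^bsub>F\<^esub> gen i \<otimes>\<^bsub>F\<^esub> w" if i: "i \<in> {1..n}" for i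
  proof (cases "i \<in> I")
    case True
    then show ?thesis using pconj_gen[OF a(1) i] l by auto
  next
    case False
    then show ?thesis using pconj_gen[OF a(1) i] gen_F[OF i] by (intro bexI[of _ "\<one>\<^bsub>F\<^esub>"]) auto
  qed
  ultimately show ?thesis using pconj_hom[OF a(1)] pconj_ext[OF a(1)] by (simp add: carrier_G Bij_def)
qed

lemma inv_pconj:
  assumes a: "fst a \<in> {1..n}" "fst a \<notin> I"
  shows "inv\<^bsub>G\<^esub> pconj I a = pconj I (inv_letter a)"
proof (rule G.inv_equality)
  show p: "pconj I a \<in> carrier G" "pconj I (inv_letter a) \<in> carrier G" using pconj_in_G a by auto
  show "pconj I (inv_letter a) \<otimes>\<^bsub>G\<^esub> pconj I a = \<one>\<^bsub>G\<^esub>"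
    using p pconj_inv_letter[of "inv_letter a" I] a
    by (intro G_eqI) (auto simp: mult_G_apply one_G_apply gen_F)
qed

lemma pconj_insert:
  assumes a: "fst a \<in> {1..n}" "fst a \<notin> I" and i: "i \<noteq> fst a" "i \<notin> I"
  shows "pconj (insert i I) a = pconj I a \<otimes>\<^bsub>G\<^esub> pconj {i} a"
proof (rule G_eqI)
  have p: "pconj I a \<in> carrier G" "pconj {i} a \<in> carrier G" using pconj_in_G a i by auto
  then show "pconj I a \<otimes>\<^bsub>G\<^esub> pconj {i} a \<in> carrier G" by simp
  show "pconj (insert i I) a \<in> carrier G" using pconj_in_G a i by simp
  fix j assume j: "j \<in> {1..n}"
  note l = letter_in_F[OF a(1)] and g = gen_F[OF j]
  have "pconj I a [a] = [a]" using pconj_letter[OF a(1) a(1)] a(2) by simp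
  then have "pconj I a (inv\<^bsub>F\<^esub> [a] \<otimes>\<^bsub>F\<^esub> gen j \<otimes>\<^bsub>F\<^esub> [a]) = inv\<^bsub>F\<^esub> [a] \<otimes>\<^bsub>F\<^esub> pconj I a (gen j) \<otimes>\<^bsub>F\<^esub> [a]"
    using l g p by (simp add: G_app)
  then show "pconj (insert i I) a (gen j) = (pconj I a \<otimes>\<^bsub>G\<^esub> pconj {i} a) (gen j)"
    using p g i j a by (auto simp: mult_G_apply pconj_gen)
qed

lemma pconj_empty:
  assumes a: "fst a \<in> {1..n}"
  shows "pconj {} a = \<one>\<^bsub>G\<^esub>"
  by (rule G_eqI) (use a pconj_in_G pconj_gen in \<open>auto simp: one_G_apply gen_F\<close>)

text \<open>These include all of McCool's relations.\<close>
lemma pconj_commute: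
  assumes k: "k \<in> {1..n}" "k \<notin> I" and l: "l \<in> {1..n}" "l \<notin> J"
    and IJ: "k = l \<or> k \<notin> J \<and> (l \<notin> I \<and> I \<inter> J = {} \<or> l \<in> I \<and> J \<subseteq> I)"
  shows "pconj I (k, True) \<otimes>\<^bsub>G\<^esub> pconj J (l, True) = pconj J (l, True) \<otimes>\<^bsub>G\<^esub> pconj I (k, True)"
proof (rule G_eqI)
  let ?a = "[(k, True)]" and ?b = "[(l, True)]"
  let ?p = "pconj I (k, True)" and ?q = "pconj J (l, True)"
  have p: "?p \<in> carrier G" "?q \<in> carrier G" using pconj_in_G k l by auto
  then show "?p \<otimes>\<^bsub>G\<^esub> ?q \<in> carrier G" "?q \<otimes>\<^bsub>G\<^esub> ?p \<in> carrier G" by auto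
  fix i assume i: "i \<in> {1..n}"
  have ab: "?a \<in> carrier F" "?b \<in> carrier F" "gen i \<in> carrier F"
    using letter_in_F[of "(k, True)"] letter_in_F[of "(l, True)"] k l gen_F[OF i] by auto
  have pa: "?p ?a = ?a" and qb: "?q ?b = ?b"
    using pconj_letter[of "(k, True)" "(k, True)" I] pconj_letter[of "(l, True)" "(l, True)" J] k l by auto
  have pb: "?p ?b = (if l \<in> I then inv\<^bsub>F\<^esub> ?a \<otimes>\<^bsub>F\<^esub> ?b \<otimes>\<^bsub>F\<^esub> ?a else ?b)"
    and qa: "?q ?a = (if k \<in> J then inv\<^bsub>F\<^esub> ?b \<otimes>\<^bsub>F\<^esub> ?a \<otimes>\<^bsub>F\<^esub> ?b else ?a)"
    using pconj_letter[of "(k, True)" "(l, True)" I] pconj_letter[of "(l, True)" "(k, True)" J] k l by auto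
  have pg: "?p (gen i) = (if i \<in> I then inv\<^bsub>F\<^esub> ?a \<otimes>\<^bsub>F\<^esub> gen i \<otimes>\<^bsub>F\<^esub> ?a else gen i)"
    and qg: "?q (gen i) = (if i \<in> J then inv\<^bsub>F\<^esub> ?b \<otimes>\<^bsub>F\<^esub> gen i \<otimes>\<^bsub>F\<^esub> ?b else gen i)"
    using pconj_gen[of "(k, True)" i I] pconj_gen[of "(l, True)" i J] k l i by auto
  have cancel: "x \<otimes>\<^bsub>F\<^esub> (inv\<^bsub>F\<^esub> x \<otimes>\<^bsub>F\<^esub> y) = y" if "x \<in> carrier F" "y \<in> carrier F" for x y
    using that by (simp add: F.m_assoc[symmetric])
  have "?p (?q (gen i)) = ?q (?p (gen i))"
    using IJ
  proof (elim disjE conjE)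
    assume "k = l"
    then show ?thesis using ab pa qb p pg qg by (auto simp: G_app)
  next
    assume "k \<notin> J" "l \<notin> I" "I \<inter> J = {}"
    then show ?thesis using ab pa qb pb qa p by (auto simp: pg qg G_app)
  next
    \<comment> \<open>Here \<open>?p\<close> conjugates \<open>x\<^sub>l\<close> and every generator
      moved by \<open>?q\<close> by the same letter \<open>x\<^sub>k\<close>, which
      \<open>?q\<close> fixes.\<close>
    assume "k \<notin> J" "l \<in> I" "J \<subseteq> I"
    then show ?thesis using ab pa qb pb qa p
      by (auto simp: pg qg G_app F.m_assoc F.inv_mult_group cancel)
  qed
  then show "(?p \<otimes>\<^bsub>G\<^esub> ?q) (gen i) = (?q \<otimes>\<^bsub>G\<^esub> ?p) (gen i)"
    using p ab by (simp add: mult_G_apply)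
qed

section \<open>Generation by partial conjugations\<close>

text \<open>Leading letters of w with index i commute with \<open>x\<^sub>i\<close> and drop out; as
  soon as the first letter has another index, nothing cancels.\<close>

lemma conj_normal_form:
  assumes "w \<in> carrier F" "i \<in> {1..n}"
  obtains v where "v \<in> carrier F" "inv\<^bsub>F\<^esub> w \<otimes>\<^bsub>F\<^esub> gen i \<otimes>\<^bsub>F\<^esub> w = inv_word v @ (i, True) # v"
    "reduced (inv_word v @ (i, True) # v)"
proof -
  have "\<exists>v\<in>carrier F. inv\<^bsub>F\<^esub> w \<otimes>\<^bsub>F\<^esub> gen i \<otimes>\<^bsub>F\<^esub> w = inv_word v @ (i, True) # v \<and>
    reduced (inv_word v @ (i, True) # v)"
    using assms(1)
  proof (induction w)
    case Nil
    have "inv\<^bsub>F\<^esub> \<one>\<^bsub>F\<^esub> \<otimes>\<^bsub>F\<^esub> gen i \<otimes>\<^bsub>F\<^esub> \<one>\<^bsub>F\<^esub> = gen i"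
      using gen_F[OF assms(2)] by simp
    then show ?case using Nil unfolding free_group_simps(3)
      by (intro bexI[of _ "[]"]) (auto simp: gen_def reduced_Cons)
  next
    case (Cons a w)
    have a: "fst a \<in> {1..n}" and w: "w \<in> carrier F" and aw: "reduced (a # w)"
      using Cons.prems by (auto simp: free_group_simps reduced_Cons)
    note g = gen_F[OF assms(2)] and l = letter_in_F[OF a]
    show ?case
    proof (cases "fst a = i")
      case True
      have eq: "a # w = [a] \<otimes>\<^bsub>F\<^esub> w" using red_cons_reduced[OF aw] by (simp add: free_group_simps)
      have comm: "gen i \<otimes>\<^bsub>F\<^esub> [a] = [a] \<otimes>\<^bsub>F\<^esub> gen i"
      proof (cases rule: letter_cases[of a])
        case 1
        then show ?thesis using True by simp
      next
        case 2
        then have "[a] = inv\<^bsub>F\<^esub> gen i" using True a by blast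
        then show ?thesis using g by simp
      qed
      have "inv\<^bsub>F\<^esub> (a # w) \<otimes>\<^bsub>F\<^esub> gen i \<otimes>\<^bsub>F\<^esub> (a # w)
          = inv\<^bsub>F\<^esub> w \<otimes>\<^bsub>F\<^esub> (inv\<^bsub>F\<^esub> [a] \<otimes>\<^bsub>F\<^esub> (gen i \<otimes>\<^bsub>F\<^esub> [a])) \<otimes>\<^bsub>F\<^esub> w"
        unfolding eq using w l g by (simp add: F.inv_mult_group F.m_assoc)
      also have "inv\<^bsub>F\<^esub> [a] \<otimes>\<^bsub>F\<^esub> (gen i \<otimes>\<^bsub>F\<^esub> [a]) = gen i"
        unfolding comm using l g by (simp add: F.m_assoc[symmetric])
      finally show ?thesis using Cons.IH[OF w] by simp
    next
      case False
      let ?v = "inv_word (a # w) @ (i, True) # a # w"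
      have red: "reduced ?v"
        using aw False unfolding reduced_append_iff[of "inv_word (a # w)"] reduced_inv_word
        by (auto simp: reduced_Cons inv_letter_def prod_eq_iff)
      have "inv\<^bsub>F\<^esub> (a # w) \<otimes>\<^bsub>F\<^esub> gen i \<otimes>\<^bsub>F\<^esub> (a # w) = inv_word (a # w) \<otimes>\<^bsub>F\<^esub> (gen i \<otimes>\<^bsub>F\<^esub> (a # w))"
        unfolding inv_free_group[OF Cons.prems, symmetric]
        by (rule F.m_assoc[OF F.inv_closed[OF Cons.prems] g Cons.prems])
      also have "gen i \<otimes>\<^bsub>F\<^esub> (a # w) = (i, True) # a # w"
        using red red_cons_reduced[of "(i, True)" "a # w"]
        by (simp add: free_group_simps gen_def reduced_append_iff del: inv_word_simps)
      also have "inv_word (a # w) \<otimes>\<^bsub>F\<^esub> \<dots> = ?v"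
        unfolding free_group_simps by (rule foldr_red_cons_reduced[OF red])
      finally show ?thesis using red Cons.prems by blast
    qed
  qed
  then show thesis using that by blast
qed

lemma max_common_suffix:
  obtains p q s where "u = p @ s" "v = q @ s" "p = [] \<or> q = [] \<or> last p \<noteq> last q"
proof -
  have "\<exists>p q s. u = p @ s \<and> v = q @ s \<and> (p = [] \<or> q = [] \<or> last p \<noteq> last q)"
  proof (induction u arbitrary: v rule: rev_induct)
    case (snoc a u)
    show ?case
    proof (cases "v \<noteq> [] \<and> last v = a")
      case True
      then obtain v' where v: "v = v' @ [a]" by (metis append_butlast_last_id)
      obtain p q s where "u = p @ s" "v' = q @ s" "p = [] \<or> q = [] \<or> last p \<noteq> last q"
        using snoc.IH by blast
      then show ?thesis unfolding v by (metis append_assoc)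
    next
      case False
      then show ?thesis by (intro exI[of _ "u @ [a]"] exI[of _ v] exI[of _ "[]"]) auto
    qed
  qed auto
  then show thesis using that by blast
qed

lemma foldr_red_cons_cancel:
  assumes "reduced v"
  shows "foldr red_cons (u @ w) (foldr red_cons (inv_word w @ x) v) = foldr red_cons (u @ x) v"
  using foldr_red_cons_rev[of "foldr red_cons x v" "inv_word w"] assms
  by (simp add: inv_word_def rev_map comp_def)

text \<open>
  Nielsen's argument: if no conjugator \<open>W i\<close> swallows a letter \<open>x\<^sub>j\<close> together with \<open>W j\<close>, then
  the central letters of the conjugates \<open>\<phi> x\<^sub>i\<close> survive in all reduced products.
\<close>
lemma nielsen_length:
  assumes \<phi>: "\<phi> \<in> hom F F"
    and W: "\<And>i. i \<in> {1..n} \<Longrightarrow> \<phi> (gen i) = inv_word (W i) @ (i, True) # W i"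
    and red: "\<And>i. i \<in> {1..n} \<Longrightarrow> reduced (inv_word (W i) @ (i, True) # W i)"
    and nosuf: "\<And>i b. i \<in> {1..n} \<Longrightarrow> fst b \<in> {1..n} \<Longrightarrow> fst b \<noteq> i \<Longrightarrow>
      \<not> suffix (b # W (fst b)) (W i)"
    and v: "a # v \<in> carrier F"
  shows "\<exists>z. \<phi> (a # v) = inv_word (W (fst a)) @ a # z \<and> length v \<le> length z"
  using v
proof (induction v arbitrary: a)
  have letter: "\<phi> [a] = inv_word (W (fst a)) @ a # W (fst a)"
    "reduced (inv_word (W (fst a)) @ a # W (fst a))" if a: "fst a \<in> {1..n}" for a
  proof -
    let ?w = "W (fst a)"
    have "\<phi> [a] = inv_word ?w @ a # ?w \<and> reduced (inv_word ?w @ a # ?w)"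
    proof (cases "snd a")
      case True
      then have "gen (fst a) = [a]" "(fst a, True) = a" by (auto simp: gen_def prod_eq_iff)
      then show ?thesis using W[OF a] red[OF a] by simp
    next
      case False
      then have eq: "inv_letter (fst a, True) = a" by (auto simp: inv_letter_def prod_eq_iff)
      have "[a] = inv\<^bsub>F\<^esub> gen (fst a)"
        unfolding inv_free_group[OF gen_F[OF a]] by (simp add: gen_def eq)
      then have "\<phi> [a] = inv_word (\<phi> (gen (fst a)))"
        using hom_F_inv[OF \<phi> gen_F[OF a]] inv_free_group[OF hom_F_closed[OF \<phi> gen_F[OF a]]] by simp
      then have "\<phi> [a] = inv_word ?w @ a # ?w" using W[OF a] by (simp add: eq)
      moreover have "reduced (inv_word (inv_word ?w @ (fst a, True) # ?w))"
        unfolding reduced_inv_word by (rule red[OF a])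
      ultimately show ?thesis by (simp add: eq)
    qed
    then show "\<phi> [a] = inv_word ?w @ a # ?w" "reduced (inv_word ?w @ a # ?w)" by auto
  qed
  {
    case Nil
    then have "fst a \<in> {1..n}" by (simp add: free_group_simps)
    then show ?case using letter by auto
  next
    case (Cons b v)
    have ab: "fst a \<in> {1..n}" "fst b \<in> {1..n}" "b # v \<in> carrier F" "b \<noteq> inv_letter a"
      "reduced (a # b # v)"
      using Cons.prems by (auto simp: free_group_simps reduced_Cons)
    let ?i = "fst a" and ?j = "fst b"
    obtain z where z: "\<phi> (b # v) = inv_word (W ?j) @ b # z" "length v \<le> length z"
      using Cons.IH[OF ab(3)] by blast
    have redz: "reduced (inv_word (W ?j) @ b # z)"
      using hom_F_closed[OF \<phi> ab(3)] z(1) by (simp add: free_group_simps)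
    have "a # b # v = [a] \<otimes>\<^bsub>F\<^esub> (b # v)"
      using red_cons_reduced[OF ab(5)] by (simp add: free_group_simps)
    then have "\<phi> (a # b # v) = \<phi> [a] \<otimes>\<^bsub>F\<^esub> \<phi> (b # v)"
      using hom_F_mult[OF \<phi> letter_in_F[OF ab(1)] ab(3)] by simp
    also have "\<dots> = foldr red_cons ((inv_word (W ?i) @ [a]) @ W ?i) (inv_word (W ?j) @ b # z)"
      by (simp add: letter(1)[OF ab(1)] z(1) free_group_simps)
    also have "inv_word (W ?j) @ b # z = foldr red_cons (inv_word (W ?j)) (b # z)"
      using foldr_red_cons_reduced[OF redz] by simp
    finally have eq: "\<phi> (a # b # v) =
      foldr red_cons ((inv_word (W ?i) @ [a]) @ W ?i) (foldr red_cons (inv_word (W ?j)) (b # z))" .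
    have bz: "reduced (b # z)" using redz by (simp add: reduced_append_iff)
    \<comment> \<open>The suffix s is what cancels between \<open>W ?i\<close> and
      \<open>inv_word (W ?j)\<close>; the central letters a and b are in danger only if p or q is
      empty.\<close>
    obtain p q s where pqs: "W ?i = p @ s" "W ?j = q @ s" "p = [] \<or> q = [] \<or> last p \<noteq> last q"
      by (rule max_common_suffix)
    have "\<phi> (a # b # v) = foldr red_cons (((inv_word (W ?i) @ [a]) @ p) @ inv_word q) (b # z)"
      using foldr_red_cons_cancel[OF bz, of "(inv_word (W ?i) @ [a]) @ p" s "inv_word q"]
      unfolding eq by (simp add: pqs)
    also have "\<dots> = foldr red_cons (inv_word (W ?i) @ [a] @ p) (inv_word q @ b # z)"
      using redz foldr_red_cons_reduced[of "inv_word q" "b # z"]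
      by (simp add: pqs reduced_append_iff)
    also have "\<dots> = (inv_word (W ?i) @ [a] @ p) @ (inv_word q @ b # z)"
    proof (rule foldr_red_cons_reduced)
      have A: "reduced (inv_word (W ?i) @ [a] @ p)"
        using letter(2)[OF ab(1)]
        unfolding pqs(1) by (metis append.assoc append_Cons append_Nil reduced_append_iff)
      have B: "reduced (inv_word q @ b # z)"
        using redz unfolding pqs(2) by (simp add: reduced_append_iff)
      \<comment> \<open>If just one of p, q is empty, a further cancellation would make one
        conjugator, preceded by a letter of its own index, a suffix of the other. This is excluded
        by \<open>nosuf\<close>, and by length if the indices agree.\<close>
      have "hd (inv_word q @ b # z) \<noteq> inv_letter (last (inv_word (W ?i) @ [a] @ p))"
      proof (cases "p = []"; cases "q = []")
        assume "p = []" "q = []"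
        then show ?thesis using ab(4) by simp
      next
        assume p: "p = []" and q: "q \<noteq> []"
        show ?thesis
        proof
          assume "hd (inv_word q @ b # z) = inv_letter (last (inv_word (W ?i) @ [a] @ p))"
          then have "last q = a" using p q by (simp add: hd_inv_word)
          then have "W ?j = butlast q @ a # W ?i"
            using pqs p q by (metis append.assoc append_Cons append_Nil append_butlast_last_id)
          then have suf: "suffix (a # W ?i) (W ?j)" by (auto simp: suffix_def)
          show False
          proof (cases "?i = ?j")
            case True
            then show False using suffix_length_le[OF suf] by simp
          next
            case False
            then show False using nosuf[OF ab(2) ab(1)] suf by simp
          qed
        qed
      next
        assume p: "p \<noteq> []" and q: "q = []"
        show ?thesis
        proof
          assume "hd (inv_word q @ b # z) = inv_letter (last (inv_word (W ?i) @ [a] @ p))"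
          then have "last p = inv_letter b" using p q by simp
          then have "W ?i = butlast p @ inv_letter b # W ?j"
            using pqs p q by (metis append.assoc append_Cons append_Nil append_butlast_last_id)
          then have suf: "suffix (inv_letter b # W ?j) (W ?i)" by (auto simp: suffix_def)
          show False
          proof (cases "?i = ?j")
            case True
            then show False using suffix_length_le[OF suf] by simp
          next
            case False
            then show False using nosuf[of ?i "inv_letter b"] ab suf by simp
          qed
        qed
      next
        assume "p \<noteq> []" "q \<noteq> []"
        then show ?thesis using pqs(3) by (simp add: hd_inv_word)
      qed
      then show "reduced ((inv_word (W ?i) @ [a] @ p) @ (inv_word q @ b # z))"
        unfolding reduced_append_iff[of "inv_word (W ?i) @ [a] @ p"] using A B by blast
    qed
    finally have "\<phi> (a # b # v) = inv_word (W ?i) @ a # (p @ inv_word q @ b # z)" by simp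
    then show ?case using z(2) by (intro exI conjI) auto
  }
qed

lemma length_foldr_red_cons: "length (foldr red_cons u v) \<le> length u + length v"
proof (induction u)
  case (Cons a u)
  have "length (red_cons a w) \<le> Suc (length w)" for w
    by (cases w) (auto simp: red_cons_def)
  from this[of "foldr red_cons u v"] Cons show ?case by simp
qed simp

text \<open>Induction on the total length of the images of the basis. If a conjugator
  \<open>W i\<close> swallows a letter b together with the conjugator belonging to b, composing with
  a partial conjugation of \<open>x\<^sub>i\<close> shortens the image of \<open>x\<^sub>i\<close>
  and leaves the others alone. If none does, \<phi> is the identity by
  \<open>nielsen_length\<close>.\<close>

theorem PSigma_generated:
  assumes A: "subgroup A G"
    and gens: "\<And>i j. i \<in> {1..n} \<Longrightarrow> j \<in> {1..n} \<Longrightarrow> i \<noteq> j \<Longrightarrow> \<beta> i j \<in> A"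
  shows "A = carrier G"
proof
  interpret A: subgroup A G by (rule A)
  show "A \<subseteq> carrier G" by (rule A.subset)
  have gens': "pconj {i} b \<in> A" if "i \<in> {1..n}" "fst b \<in> {1..n}" "fst b \<noteq> i" for i b
  proof -
    have \<beta>: "\<beta> i (fst b) \<in> A" using gens[of i "fst b"] that by simp
    show ?thesis
    proof (cases "snd b")
      case True
      then have "(fst b, True) = b" by (simp add: prod_eq_iff)
      then show ?thesis using \<beta> by simp
    next
      case False
      then have "inv_letter (fst b, True) = b" by (auto simp: inv_letter_def prod_eq_iff)
      then show ?thesis using A.m_inv_closed[OF \<beta>] inv_pconj[of "(fst b, True)" "{i}"] that by simp
    qed
  qed
  show "carrier G \<subseteq> A"
  proof
    fix \<phi> assume "\<phi> \<in> carrier G"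
    then show "\<phi> \<in> A"
    proof (induction "\<Sum>i\<in>{1..n}. length (\<phi> (gen i))" arbitrary: \<phi> rule: less_induct)
      case less
      note \<phi> = less.prems
      have "\<exists>v. \<phi> (gen i) = inv_word v @ (i, True) # v \<and> v \<in> carrier F \<and>
          reduced (inv_word v @ (i, True) # v)" if i: "i \<in> {1..n}" for i
      proof -
        obtain w where w: "w \<in> carrier F" "\<phi> (gen i) = inv\<^bsub>F\<^esub> w \<otimes>\<^bsub>F\<^esub> gen i \<otimes>\<^bsub>F\<^esub> w"
          using \<phi> i unfolding carrier_G by blast
        show ?thesis using conj_normal_form[OF w(1) i] w(2) by metis
      qed
      then obtain W where W: "\<And>i. i \<in> {1..n} \<Longrightarrow> \<phi> (gen i) = inv_word (W i) @ (i, True) # W i"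
        "\<And>i. i \<in> {1..n} \<Longrightarrow> W i \<in> carrier F"
        "\<And>i. i \<in> {1..n} \<Longrightarrow> reduced (inv_word (W i) @ (i, True) # W i)"
        by metis
      show ?case
      proof (cases "\<exists>i b. i \<in> {1..n} \<and> fst b \<in> {1..n} \<and> fst b \<noteq> i \<and> suffix (b # W (fst b)) (W i)")
        case True
        then obtain i b u where i: "i \<in> {1..n}" and b: "fst b \<in> {1..n}" "fst b \<noteq> i"
          and u: "W i = u @ b # W (fst b)"
          by (auto simp: suffix_def)
        define w where "w = W (fst b)"
        \<comment> \<open>Sends \<open>x\<^sub>i\<close> to b \<open>x\<^sub>i\<close> b^-1. As
          \<phi> b = w^-1 b w, composing \<phi> with p turns the conjugator u b w of
          \<open>x\<^sub>i\<close> into u w.\<close>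
        define p where "p = pconj {i} (inv_letter b)"
        have p: "p \<in> carrier G" using pconj_in_G[of "inv_letter b" "{i}"] b by (simp add: p_def)
        define \<psi> where "\<psi> = \<phi> \<otimes>\<^bsub>G\<^esub> p"
        have \<psi>: "\<psi> \<in> carrier G" using \<phi> p by (simp add: \<psi>_def)
        have uF: "u \<in> carrier F" and wF: "w \<in> carrier F" and Wi: "reduced (W i)"
          using W(2)[OF i] W(2)[OF b(1)] unfolding u
          by (auto simp: free_group_simps reduced_append_iff u w_def)
        note l = letter_in_F[OF b(1)] and g = gen_F[OF i]
        have bw: "b # w = [b] \<otimes>\<^bsub>F\<^esub> w"
          using Wi red_cons_reduced[of b w] by (simp add: u w_def reduced_append_iff free_group_simps)
        have Weq: "W i = u \<otimes>\<^bsub>F\<^esub> ([b] \<otimes>\<^bsub>F\<^esub> w)"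
          using Wi foldr_red_cons_reduced[of u "b # w"] unfolding bw[symmetric]
          by (simp add: u w_def free_group_simps)
        have conj: "inv_word v @ (j, True) # v = inv\<^bsub>F\<^esub> v \<otimes>\<^bsub>F\<^esub> gen j \<otimes>\<^bsub>F\<^esub> v"
          if "reduced (inv_word v @ (j, True) # v)" "v \<in> carrier F" "j \<in> {1..n}" for v j
        proof -
          have "inv_word v @ (j, True) # v = inv\<^bsub>F\<^esub> v \<otimes>\<^bsub>F\<^esub> (gen j \<otimes>\<^bsub>F\<^esub> v)"
            using that(1) foldr_red_cons_reduced[OF that(1)] red_cons_reduced[of "(j, True)" v]
            unfolding inv_free_group[OF that(2)]
            by (simp add: free_group_simps gen_def reduced_append_iff)
          then show ?thesis using that gen_F[OF that(3)] by (simp add: F.m_assoc)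
        qed
        have \<phi>i: "\<phi> (gen i) = inv\<^bsub>F\<^esub> W i \<otimes>\<^bsub>F\<^esub> gen i \<otimes>\<^bsub>F\<^esub> W i"
          using conj[OF W(3)[OF i] W(2)[OF i] i] W(1)[OF i] by simp
        have \<phi>b: "\<phi> [b] = inv\<^bsub>F\<^esub> w \<otimes>\<^bsub>F\<^esub> [b] \<otimes>\<^bsub>F\<^esub> w"
        proof -
          have *: "\<phi> (gen (fst b)) = inv\<^bsub>F\<^esub> w \<otimes>\<^bsub>F\<^esub> gen (fst b) \<otimes>\<^bsub>F\<^esub> w"
            using conj[OF W(3)[OF b(1)] W(2)[OF b(1)] b(1)] W(1)[OF b(1)] by (simp add: w_def)
          show ?thesis
          proof (cases rule: letter_cases[of b])
            case 1
            then show ?thesis using * by simp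
          next
            case 2
            show ?thesis unfolding 2[OF b(1)] G_app(3)[OF \<phi> gen_F[OF b(1)]] *
              using wF gen_F[OF b(1)] by (simp add: F.inv_mult_group F.m_assoc)
          qed
        qed
        have cancel: "x \<otimes>\<^bsub>F\<^esub> (inv\<^bsub>F\<^esub> x \<otimes>\<^bsub>F\<^esub> y) = y" "inv\<^bsub>F\<^esub> x \<otimes>\<^bsub>F\<^esub> (x \<otimes>\<^bsub>F\<^esub> y) = y"
          if "x \<in> carrier F" "y \<in> carrier F" for x y
          using that by (simp_all add: F.m_assoc[symmetric])
        have pi: "p (gen i) = [b] \<otimes>\<^bsub>F\<^esub> gen i \<otimes>\<^bsub>F\<^esub> inv\<^bsub>F\<^esub> [b]"
          using pconj_gen[of "inv_letter b" i "{i}"] b i l by (simp add: p_def flip: inv_letter_F)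
        have "\<psi> (gen i) = \<phi> [b] \<otimes>\<^bsub>F\<^esub> \<phi> (gen i) \<otimes>\<^bsub>F\<^esub> inv\<^bsub>F\<^esub> \<phi> [b]"
          using \<phi> p l g by (simp add: \<psi>_def mult_G_apply pi G_app)
        also have "\<dots> = inv\<^bsub>F\<^esub> (u \<otimes>\<^bsub>F\<^esub> w) \<otimes>\<^bsub>F\<^esub> gen i \<otimes>\<^bsub>F\<^esub> (u \<otimes>\<^bsub>F\<^esub> w)"
          unfolding \<phi>b \<phi>i Weq using uF wF l g by (simp add: F.inv_mult_group F.m_assoc cancel)
        finally have \<psi>i: "\<psi> (gen i) = inv\<^bsub>F\<^esub> (u \<otimes>\<^bsub>F\<^esub> w) \<otimes>\<^bsub>F\<^esub> gen i \<otimes>\<^bsub>F\<^esub> (u \<otimes>\<^bsub>F\<^esub> w)" .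
        have uw: "length (u \<otimes>\<^bsub>F\<^esub> w) \<le> length u + length w"
          using length_foldr_red_cons by (simp add: free_group_simps)
        have "length (\<psi> (gen i)) \<le> length (inv\<^bsub>F\<^esub> (u \<otimes>\<^bsub>F\<^esub> w) \<otimes>\<^bsub>F\<^esub> gen i) + length (u \<otimes>\<^bsub>F\<^esub> w)"
          unfolding \<psi>i using length_foldr_red_cons by (simp add: free_group_simps(2))
        moreover have "length (inv\<^bsub>F\<^esub> (u \<otimes>\<^bsub>F\<^esub> w) \<otimes>\<^bsub>F\<^esub> gen i) \<le> length (u \<otimes>\<^bsub>F\<^esub> w) + 1"
          using length_foldr_red_cons[of "inv_word (u \<otimes>\<^bsub>F\<^esub> w)" "gen i"]
            inv_free_group[OF F.m_closed[OF uF wF]]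
          by (simp add: free_group_simps(2) gen_def)
        moreover have "x \<le> 2 * m + 1" if "x \<le> y + l" "y \<le> l + 1" "l \<le> m" for x y l m :: nat
          using that by linarith
        ultimately have "length (\<psi> (gen i)) \<le> 2 * (length u + length w) + 1" using uw by blast
        moreover have "length (\<phi> (gen i)) = 2 * (length u + length w) + 3"
          using W(1)[OF i] by (simp add: u w_def)
        ultimately have lt: "length (\<psi> (gen i)) < length (\<phi> (gen i))" by simp
        have le: "length (\<psi> (gen j)) \<le> length (\<phi> (gen j))" if j: "j \<in> {1..n}" for j
        proof (cases "j = i")
          case False
          then have "p (gen j) = gen j" using pconj_gen[of "inv_letter b" j "{i}"] b j by (simp add: p_def)
          then have "\<psi> (gen j) = \<phi> (gen j)"
            using \<phi> p gen_F[OF j] by (simp add: \<psi>_def mult_G_apply)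
          then show ?thesis by simp
        qed (use lt in simp)
        have "(\<Sum>i\<in>{1..n}. length (\<psi> (gen i))) < (\<Sum>i\<in>{1..n}. length (\<phi> (gen i)))"
          using le lt i by (intro sum_strict_mono_ex1) auto
        then have "\<psi> \<in> A" using less.hyps \<psi> by blast
        moreover have "p \<in> A" unfolding p_def by (rule gens') (use b i in auto)
        moreover have "\<phi> = \<psi> \<otimes>\<^bsub>G\<^esub> inv\<^bsub>G\<^esub> p" using \<phi> p by (simp add: \<psi>_def G.m_assoc)
        ultimately show ?thesis by simp
      next
        case False
        \<comment> \<open>By surjectivity \<open>x\<^sub>k\<close> is the image of a nonempty word;
          this image contains the conjugator and first letter intact, so having length one it forces
          \<open>W k\<close> to be empty.\<close>
        have "\<phi> (gen k) = gen k" if k: "k \<in> {1..n}" for k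
        proof -
          have "gen k \<in> \<phi> ` carrier F"
            using \<phi> gen_F[OF k] by (auto simp: carrier_G Bij_def bij_betw_def)
          then obtain v where v: "v \<in> carrier F" "\<phi> v = gen k" by auto
          have "\<phi> [] = []" using \<phi> hom_one[OF G_hom[OF \<phi>] F.is_group F.is_group] by (simp add: free_group_simps)
          then obtain a v' where av: "v = a # v'" using v by (cases v) (auto simp: gen_def)
          obtain z where "\<phi> v = inv_word (W (fst a)) @ a # z"
            using nielsen_length[of \<phi> W a v'] G_hom[OF \<phi>] W False v av by blast
          then have "inv_word (W (fst a)) @ a # z = [(k, True)]" using v(2) by (simp add: gen_def)
          then have "inv_word (W (fst a)) = [] \<and> a = (k, True)"
            by (cases "inv_word (W (fst a))") auto
          then have "W k = []" by auto
          then show ?thesis using W(1)[OF k] by (simp add: gen_def)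
        qed
        then have "\<phi> = \<one>\<^bsub>G\<^esub>" by (intro G_eqI[OF \<phi>]) (auto simp: one_G_apply gen_F)
        then show ?thesis by simp
      qed
    qed
  qed
qed

end

section \<open>Subgroups closed under commutants\<close>

locale psigma_char = psigma +
  fixes \<chi> :: "(word \<Rightarrow> word) \<Rightarrow> real"
  assumes char: "\<chi> \<in> characters (PSigma n)"
begin

abbreviation x :: "nat \<Rightarrow> nat \<Rightarrow> real" where
  "x i j \<equiv> \<chi> (\<beta> i j)"

abbreviation inner :: "nat \<Rightarrow> word \<Rightarrow> word" where
  "inner k \<equiv> pconj ({1..n} - {k}) (k, True)"

definition supported_on_pair :: "nat \<Rightarrow> nat \<Rightarrow> bool" where
  "supported_on_pair i j \<longleftrightarrow>
    (\<forall>p\<in>{1..n}. \<forall>q\<in>{1..n}. p \<noteq> q \<longrightarrow> (p, q) \<noteq> (i, j) \<longrightarrow> (p, q) \<noteq> (j, i) \<longrightarrow> x p q = 0)"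

text \<open>For distinct i, j, k in range, six coordinates and three equations leave a space of
  dimension three, the pullback of H^1 of the free quotient of rank three.\<close>

definition supported_on_triple :: "nat \<Rightarrow> nat \<Rightarrow> nat \<Rightarrow> bool" where
  "supported_on_triple i j k \<longleftrightarrow>
    (\<forall>p\<in>{1..n}. \<forall>q\<in>{1..n}. p \<noteq> q \<longrightarrow> p \<notin> {i, j, k} \<or> q \<notin> {i, j, k} \<longrightarrow> x p q = 0) \<and>
    x j i + x k i = 0 \<and> x i j + x k j = 0 \<and> x i k + x j k = 0"

definition commutant_closed :: "(word \<Rightarrow> word) set \<Rightarrow> bool" where
  "commutant_closed A \<longleftrightarrow> subgroup A G \<and>
    (\<forall>z\<in>A. \<forall>h\<in>carrier G. \<chi> z \<noteq> 0 \<longrightarrow> h \<otimes>\<^bsub>G\<^esub> z = z \<otimes>\<^bsub>G\<^esub> h \<longrightarrow> h \<in> A)"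

text \<open>Unfolded, interval membership makes linear arithmetic split on all disequations of indices.\<close>
declare atLeastAtMost_iff [simp del]

lemma pconj_in_G': "k \<in> {1..n} \<Longrightarrow> k \<notin> I \<Longrightarrow> pconj I (k, True) \<in> carrier G"
  by (rule pconj_in_G) simp_all

lemma chi_pconj:
  assumes "finite I" "k \<in> {1..n}" "k \<notin> I"
  shows "\<chi> (pconj I (k, True)) = (\<Sum>i\<in>I. x i k)"
  using assms(1,3)
proof (induction I)
  case empty
  have "\<chi> \<one>\<^bsub>G\<^esub> = \<chi> \<one>\<^bsub>G\<^esub> + \<chi> \<one>\<^bsub>G\<^esub>"
    using character_mult[OF char, of "\<one>\<^bsub>G\<^esub>" "\<one>\<^bsub>G\<^esub>"] by simp
  then show ?case using assms(2) by (simp add: pconj_empty)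
next
  case (insert i I)
  then show ?case
    using pconj_insert[of "(k, True)" I i] assms(2) pconj_in_G' character_mult[OF char]
    by (simp add: add.commute)
qed

context
  fixes A
  assumes A: "commutant_closed A"
begin

lemma A_subgroup: "subgroup A G"
  using A by (simp add: commutant_closed_def)

lemma A_commute:
  assumes "pconj I (k, True) \<in> A" "\<chi> (pconj I (k, True)) \<noteq> 0" "l \<in> {1..n}" "l \<notin> J"
    and "pconj J (l, True) \<otimes>\<^bsub>G\<^esub> pconj I (k, True) = pconj I (k, True) \<otimes>\<^bsub>G\<^esub> pconj J (l, True)"
  shows "pconj J (l, True) \<in> A"
  using A assms pconj_in_G'[of l J] unfolding commutant_closed_def by blast

text \<open>The four cases of \<open>pconj_commute\<close> follow: equal letters, disjoint supports
  with neither letter moved, and nested supports, where membership passes to the smaller or to the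
  larger one.\<close>

lemma A_column:
  assumes "pconj I (k, True) \<in> A" "\<chi> (pconj I (k, True)) \<noteq> 0" "k \<in> {1..n}" "k \<notin> I" "k \<notin> J"
  shows "pconj J (k, True) \<in> A"
  by (rule A_commute[OF assms(1,2,3,5) pconj_commute]) (use assms in simp_all)

lemma A_disjoint:
  assumes "pconj I (k, True) \<in> A" "\<chi> (pconj I (k, True)) \<noteq> 0" "k \<in> {1..n}" "l \<in> {1..n}"
    and "k \<notin> I" "l \<notin> J" "k \<notin> J" "l \<notin> I" "I \<inter> J = {}"
  shows "pconj J (l, True) \<in> A"
  by (rule A_commute[OF assms(1,2,4,6) pconj_commute[symmetric]]) (use assms in simp_all)

lemma A_smaller:
  assumes "pconj I (k, True) \<in> A" "\<chi> (pconj I (k, True)) \<noteq> 0" "k \<in> {1..n}" "l \<in> {1..n}"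
    and "k \<notin> I" "l \<notin> J" "k \<notin> J" "l \<in> I" "J \<subseteq> I"
  shows "pconj J (l, True) \<in> A"
  by (rule A_commute[OF assms(1,2,4,6) pconj_commute[symmetric]]) (use assms in simp_all)

lemma A_larger:
  assumes "pconj I (k, True) \<in> A" "\<chi> (pconj I (k, True)) \<noteq> 0" "k \<in> {1..n}" "l \<in> {1..n}"
    and "k \<notin> I" "l \<notin> J" "k \<in> J" "l \<notin> I" "I \<subseteq> J"
  shows "pconj J (l, True) \<in> A"
  by (rule A_commute[OF assms(1,2,4,6) pconj_commute]) (use assms in simp_all)

lemma A_pconj:
  assumes "finite I" "k \<in> {1..n}" "k \<notin> I" "\<And>i. i \<in> I \<Longrightarrow> \<beta> i k \<in> A"
  shows "pconj I (k, True) \<in> A"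
  using assms(1,3,4)
proof (induction I)
  case empty
  then show ?case using subgroup.one_closed[OF A_subgroup] assms(2) by (simp add: pconj_empty)
next
  case (insert i I)
  then show ?case
    using pconj_insert[of "(k, True)" I i] assms(2) subgroup.m_closed[OF A_subgroup] by simp
qed

lemma A_pconj_insert:
  assumes "finite I" "k \<in> {1..n}" "k \<notin> insert i I" "i \<notin> I" "\<And>j. j \<in> I \<Longrightarrow> \<beta> j k \<in> A"
    and "pconj (insert i I) (k, True) \<in> A"
  shows "\<beta> i k \<in> A"
proof -
  interpret A: subgroup A G by (rule A_subgroup)
  have I: "pconj I (k, True) \<in> A" by (rule A_pconj) (use assms in auto)
  have "pconj (insert i I) (k, True) = pconj I (k, True) \<otimes>\<^bsub>G\<^esub> \<beta> i k"
    using pconj_insert[of "(k, True)" I i] assms by simp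
  then have "\<beta> i k = inv\<^bsub>G\<^esub> pconj I (k, True) \<otimes>\<^bsub>G\<^esub> pconj (insert i I) (k, True)"
    using pconj_in_G'[of k I] pconj_in_G'[of k "{i}"] assms by (simp add: G.m_assoc[symmetric])
  then show ?thesis using I assms(6) by simp
qed

lemma A_inner:
  assumes "k \<in> {1..n}" "m \<in> {1..n}" "m \<noteq> k" "inner k \<in> A"
    and "\<And>i. i \<in> {1..n} \<Longrightarrow> i \<noteq> k \<Longrightarrow> i \<noteq> m \<Longrightarrow> \<beta> i k \<in> A"
  shows "\<beta> m k \<in> A"
proof (rule A_pconj_insert)
  have "insert m ({1..n} - {k} - {m}) = {1..n} - {k}" using assms by auto
  then show "pconj (insert m ({1..n} - {k} - {m})) (k, True) \<in> A" using assms by simp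
qed (use assms in auto)

text \<open>All \<beta> i l with i \<noteq> c commute with \<open>inner c\<close>. Only the \<beta>
  c j remain, and \<beta> c j lies in A as soon as \<open>inner j\<close> does. If one of them is
  missing, the values of \<chi> off the pair c, j are forced to vanish one after the other, against
  \<open>npair\<close>.\<close>

lemma closed_contains_inner:
  assumes c: "c \<in> {1..n}" "inner c \<in> A" "\<chi> (inner c) \<noteq> 0"
    and npair: "\<And>i j. i \<in> {1..n} \<Longrightarrow> j \<in> {1..n} \<Longrightarrow> i \<noteq> j \<Longrightarrow> \<not> supported_on_pair i j"
    and pq: "p \<in> {1..n}" "q \<in> {1..n}" "p \<noteq> q"
  shows "\<beta> p q \<in> A"
proof -
  have row: "\<beta> i l \<in> A" if "i \<in> {1..n}" "l \<in> {1..n}" "i \<noteq> l" "i \<noteq> c" for i l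
  proof (cases "l = c")
    case True
    show ?thesis unfolding True by (rule A_column[OF c(2,3)]) (use that c in simp_all)
  next
    case False
    show ?thesis by (rule A_smaller[OF c(2,3)]) (use that c False in simp_all)
  qed
  have inner: "\<beta> c j \<in> A" if "j \<in> {1..n}" "j \<noteq> c" "inner j \<in> A" for j
    by (rule A_inner) (use that c row in auto)
  \<comment> \<open>For i \<noteq> j the automorphism \<beta> i l commutes with
    \<open>inner j\<close>, so a nonzero value would bring \<open>inner j\<close>, and with it
    \<beta> c j, into A.\<close>
  have M0: "x i l = 0"
    if "\<beta> c j \<notin> A" "\<beta> i l \<in> A" "j \<in> {1..n}" "j \<noteq> c" "i \<in> {1..n}" "l \<in> {1..n}" "i \<noteq> j" "i \<noteq> l" for i j l
  proof (rule ccontr)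
    assume "x i l \<noteq> 0"
    note A_col = A_column[OF that(2) this] and A_lrg = A_larger[OF that(2) this]
    have "inner j \<in> A"
    proof (cases "l = j")
      case True
      show ?thesis using A_col[of "{1..n} - {j}"] that True by simp
    next
      case False
      show ?thesis by (rule A_lrg) (use that False in simp_all)
    qed
    then show False using inner that by blast
  qed
  have M1: "x i l = 0"
    if "\<beta> c j \<notin> A" "j \<in> {1..n}" "j \<noteq> c" "i \<in> {1..n}" "l \<in> {1..n}" "i \<notin> {c, j}" "i \<noteq> l" for i j l
    by (rule M0[of j]) (use that row in auto)
  have "\<beta> c j \<in> A" if j: "j \<in> {1..n}" "j \<noteq> c" for j
  proof (rule ccontr)
    assume nj: "\<beta> c j \<notin> A"
    \<comment> \<open>If \<beta> c m were missing too, \<open>M1\<close> for j and for m together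
      would annihilate column c and hence \<chi> (inner c).\<close>
    have M2: "\<beta> c m \<in> A" if m: "m \<in> {1..n}" "m \<notin> {c, j}" for m
    proof (rule ccontr)
      assume nm: "\<beta> c m \<notin> A"
      have "x i c = 0" if "i \<in> {1..n} - {c}" for i
      proof (cases "i = j")
        case True
        then show ?thesis using M1[OF nm, of i c] that m c j by simp
      next
        case False
        then show ?thesis using M1[OF nj, of i c] that c j by simp
      qed
      then have "\<chi> (inner c) = 0" using chi_pconj[of "{1..n} - {c}" c] c by simp
      then show False using c by simp
    qed
    have M3: "x c m = 0" if m: "m \<in> {1..n}" "m \<notin> {c, j}" for m
      by (rule M0[OF nj M2]) (use m c j in auto)
    \<comment> \<open>The product of \<beta> c l and \<beta> j l has the value x j l by
      \<open>M3\<close> and, in contrast to \<beta> j l, commutes with \<beta> c j.\<close>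
    have M4: "x j l = 0" if l: "l \<in> {1..n}" "l \<notin> {c, j}" for l
    proof (rule ccontr)
      assume nz: "x j l \<noteq> 0"
      have mem: "pconj {c, j} (l, True) \<in> A"
        by (rule A_pconj) (use l j c row[of j l] M2[of l] in auto)
      have "\<chi> (pconj {c, j} (l, True)) = x j l" using chi_pconj[of "{c, j}" l] l c j M3[OF l] by simp
      then have "\<chi> (pconj {c, j} (l, True)) \<noteq> 0" using nz by simp
      then have "\<beta> c j \<in> A" by (rule A_smaller[OF mem]) (use l c j in simp_all)
      then show False using nj by simp
    qed
    have "supported_on_pair c j" unfolding supported_on_pair_def
    proof (intro ballI impI)
      fix p q assume "p \<in> {1..n}" "q \<in> {1..n}" "p \<noteq> q" "(p, q) \<noteq> (c, j)" "(p, q) \<noteq> (j, c)"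
      then show "x p q = 0"
        using M1[OF nj j, of p q] M3[of q] M4[of q] by (cases "p = c"; cases "p = j") auto
    qed
    then show False using npair c j by metis
  qed
  then show ?thesis using row pq by (cases "p = c") auto
qed

text \<open>Elements commuting with \<beta> a c or \<beta> b c yield everything but \<beta> c a,
  \<beta> b a, \<beta> c b, \<beta> a b. In column a and in column b the product of the two missing
  entries is available, so one entry of each suffices (\<open>fin\<close>). They are supplied by a
  nonzero value outside the triple, which exists because \<open>sums\<close> would otherwise make
  \<chi> supported on the triple.\<close>

lemma closed_contains_zero_sums:
  assumes oab: "c \<in> {1..n}" "a \<in> {1..n}" "b \<in> {1..n}" "c \<noteq> a" "c \<noteq> b" "a \<noteq> b"
    and nz: "x a c \<noteq> 0" "x b c \<noteq> 0" and mem: "\<beta> a c \<in> A"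
    and sums: "\<And>k. k \<in> {1..n} \<Longrightarrow> (\<Sum>i\<in>{1..n} - {k}. x i k) = 0"
    and ntriple: "\<not> supported_on_triple c a b"
    and pq: "p \<in> {1..n}" "q \<in> {1..n}" "p \<noteq> q"
  shows "\<beta> p q \<in> A"
proof -
  have F1: "\<beta> i c \<in> A" if "i \<in> {1..n}" "i \<noteq> c" for i
    by (rule A_column[OF mem nz(1)]) (use that oab in simp_all)
  have F2: "\<beta> k l \<in> A" if "k \<in> {1..n}" "l \<in> {1..n}" "k \<noteq> l" "k \<noteq> c" "l \<noteq> c"
    "(k, l) \<noteq> (a, b)" "(k, l) \<noteq> (b, a)" for k l
  proof (cases "k \<noteq> a \<and> l \<noteq> a")
    case True
    show ?thesis by (rule A_disjoint[OF mem nz(1)]) (use that oab True in simp_all)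
  next
    case False
    show ?thesis by (rule A_disjoint[OF F1[of b] nz(2)]) (use that oab False in auto)
  qed
  have F3a: "pconj {a, c} (l, True) \<in> A" if "l \<in> {1..n}" "l \<notin> {a, c}" for l
    by (rule A_larger[OF mem nz(1)]) (use that oab in simp_all)
  have F3b: "pconj {b, c} (l, True) \<in> A" if "l \<in> {1..n}" "l \<notin> {b, c}" for l
    by (rule A_larger[OF F1[of b] nz(2)]) (use that oab in simp_all)
  have swap: "\<beta> j l \<in> A" if "pconj {i, j} (l, True) \<in> A" "\<beta> i l \<in> A" "i \<noteq> j" "l \<in> {1..n}" "l \<notin> {i, j}" for i j l
    by (rule A_pconj_insert[of "{i}"]) (use that in \<open>auto simp: insert_commute\<close>)
  have swap': "\<beta> i l \<in> A" if "pconj {i, j} (l, True) \<in> A" "\<beta> j l \<in> A" "i \<noteq> j" "l \<in> {1..n}" "l \<notin> {i, j}" for i j l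
    by (rule A_pconj_insert[of "{j}"]) (use that in auto)
  have F4: "\<beta> c l \<in> A" if "l \<in> {1..n}" "l \<notin> {c, a, b}" for l
    by (rule swap[OF F3a F2]) (use that oab in auto)
  have fin: "\<beta> p q \<in> A" if a': "\<beta> c a \<in> A \<or> \<beta> b a \<in> A" and b': "\<beta> c b \<in> A \<or> \<beta> a b \<in> A"
  proof -
    have 1: "\<beta> c a \<in> A" "\<beta> b a \<in> A"
      using a' swap[OF F3b[of a]] swap'[OF F3b[of a]] oab by auto
    have 2: "\<beta> c b \<in> A" "\<beta> a b \<in> A"
      using b' swap[OF F3a[of b]] swap'[OF F3a[of b]] oab by auto
    consider "q = c" | "p = c" "q = a" | "p = c" "q = b" | "p = c" "q \<notin> {c, a, b}" | "p = a" "q = b"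
      | "p = b" "q = a" | "p \<noteq> c" "q \<noteq> c" "(p, q) \<noteq> (a, b)" "(p, q) \<noteq> (b, a)"
      by blast
    then show ?thesis
      by cases (use pq 1 2 F1[of p] F4[of q] F2[of p q] in simp_all)
  qed
  show ?thesis
  proof (cases "\<exists>k\<in>{1..n}. \<exists>l\<in>{1..n}. k \<notin> {c, a, b} \<and> k \<noteq> l \<and> x k l \<noteq> 0")
    case True
    then obtain k l where kl: "k \<in> {1..n}" "l \<in> {1..n}" "k \<notin> {c, a, b}" "k \<noteq> l" "x k l \<noteq> 0" by blast
    show ?thesis
    proof (cases "l = c")
      case True
      have m: "\<beta> k c \<in> A" "x k c \<noteq> 0" using F1[of k] kl True by simp_all
      have "\<beta> b a \<in> A" by (rule A_disjoint[OF m]) (use kl oab in simp_all)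
      moreover have "\<beta> a b \<in> A" by (rule A_disjoint[OF m]) (use kl oab in simp_all)
      ultimately show ?thesis using fin by blast
    next
      case False
      have m: "\<beta> k l \<in> A" by (rule F2) (use kl False in simp_all)
      have *: "\<beta> c j \<in> A" if "j \<in> {a, b}" for j
      proof (cases "l = j")
        case True
        then show ?thesis using A_column[OF m kl(5), of "{c}"] kl oab False that by auto
      next
        case neq: False
        show ?thesis by (rule A_disjoint[OF m kl(5)]) (use kl oab False neq that in auto)
      qed
      have "\<beta> c a \<in> A" "\<beta> c b \<in> A" by (rule *; simp)+
      then show ?thesis using fin by blast
    qed
  next
    case rows: False
    \<comment> \<open>All rows outside the triple vanish, so each column sum reduces to the rows of
      the triple.\<close>
    have sum3: "x i l + x j l = 0" if l: "{l, i, j} = {c, a, b}" "i \<noteq> j" "l \<noteq> i" "l \<noteq> j" for i j l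
    proof -
      have "{l, i, j} \<subseteq> {1..n}" unfolding l(1) using oab by simp
      then have ijl: "i \<in> {1..n}" "j \<in> {1..n}" "l \<in> {1..n}" by blast+
      have "x k l = 0" if "k \<in> {1..n} - {l} - {i, j}" for k
      proof -
        have "k \<notin> {l, i, j}" using that by blast
        then have "k \<notin> {c, a, b}" "k \<noteq> l" unfolding l(1)[symmetric] by blast+
        then show ?thesis using rows ijl that by blast
      qed
      then have "(\<Sum>i\<in>{1..n} - {l}. x i l) = (\<Sum>i\<in>{i, j}. x i l)"
        by (intro sum.mono_neutral_right) (use ijl l in auto)
      then show ?thesis using sums[OF ijl(3)] l(2) by simp
    qed
    have tri: "x a c + x b c = 0" "x c a + x b a = 0" "x c b + x a b = 0"
      using sum3[of c a b] sum3[of a c b] sum3[of b c a] oab by (simp_all add: insert_commute)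
    have "\<exists>l\<in>{1..n} - {c, a, b}. x c l \<noteq> 0 \<or> x a l \<noteq> 0 \<or> x b l \<noteq> 0"
    proof (rule ccontr)
      assume cols: "\<not> ?thesis"
      have "x p q = 0"
        if "p \<in> {1..n}" "q \<in> {1..n}" "p \<noteq> q" "p \<notin> {c, a, b} \<or> q \<notin> {c, a, b}" for p q
      proof (cases "p \<in> {c, a, b}")
        case True
        then have "q \<in> {1..n} - {c, a, b}" using that by blast
        then show ?thesis using cols True by blast
      next
        case False
        then show ?thesis using rows that by blast
      qed
      then have "supported_on_triple c a b" unfolding supported_on_triple_def using tri by blast
      then show False using ntriple by simp
    qed
    then obtain l where l: "l \<in> {1..n}" "l \<notin> {c, a, b}" "x c l \<noteq> 0 \<or> x a l \<noteq> 0 \<or> x b l \<noteq> 0" by blast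
    have "(\<Sum>i\<in>{1..n} - {l}. x i l) = (\<Sum>i\<in>{c, a, b}. x i l)"
      by (rule sum.mono_neutral_right) (use l oab rows in auto)
    then have sum: "x c l + x a l + x b l = 0" using sums[of l] l oab by simp
    show ?thesis
    proof (cases "x c l = 0")
      case False
      have m: "\<beta> c l \<in> A" using F4 l by simp
      have "\<beta> b a \<in> A" by (rule A_disjoint[OF m False]) (use l oab in simp_all)
      moreover have "\<beta> a b \<in> A" by (rule A_disjoint[OF m False]) (use l oab in simp_all)
      ultimately show ?thesis using fin by blast
    next
      case True
      then have nz': "x a l \<noteq> 0" "x b l \<noteq> 0" using sum l(3) by auto
      have m: "\<beta> a l \<in> A" "\<beta> b l \<in> A" using F2[of a l] F2[of b l] l oab by simp_all
      have "\<beta> c b \<in> A" by (rule A_disjoint[OF m(1) nz'(1)]) (use l oab in simp_all)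
      moreover have "\<beta> c a \<in> A" by (rule A_disjoint[OF m(2) nz'(2)]) (use l oab in simp_all)
      ultimately show ?thesis using fin by blast
    qed
  qed
qed

end

text \<open>For t an inner automorphism of nonzero value is taken if there is one. Otherwise all
  column sums vanish, and t is some \<beta> a c of nonzero value; the sum over column c then
  supplies a second nonzero entry in row b.\<close>

theorem commutant_closed_full:
  assumes n: "n \<ge> 2"
    and npair: "\<And>i j. i \<in> {1..n} \<Longrightarrow> j \<in> {1..n} \<Longrightarrow> i \<noteq> j \<Longrightarrow> \<not> supported_on_pair i j"
    and ntriple: "\<And>i j k. i \<in> {1..n} \<Longrightarrow> j \<in> {1..n} \<Longrightarrow> k \<in> {1..n} \<Longrightarrow> i \<noteq> j \<Longrightarrow> i \<noteq> k \<Longrightarrow> j \<noteq> k \<Longrightarrow>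
      \<not> supported_on_triple i j k"
  obtains t where "t \<in> carrier G" "\<chi> t \<noteq> 0"
    "\<And>A. commutant_closed A \<Longrightarrow> t \<in> A \<Longrightarrow> A = carrier G"
proof (cases "\<exists>k\<in>{1..n}. \<chi> (inner k) \<noteq> 0")
  case True
  then obtain k where k: "k \<in> {1..n}" "\<chi> (inner k) \<noteq> 0" by blast
  have "A = carrier G" if "commutant_closed A" "inner k \<in> A" for A
    by (rule PSigma_generated[OF A_subgroup[OF that(1)]])
      (rule closed_contains_inner[OF that(1) k(1) that(2) k(2) npair])
  then show thesis using that k pconj_in_G'[of k "{1..n} - {k}"] by blast
next
  case False
  then have sums: "(\<Sum>i\<in>{1..n} - {k}. x i k) = 0" if "k \<in> {1..n}" for k
    using that chi_pconj[of "{1..n} - {k}" k] by simp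
  have "\<not> supported_on_pair 1 2" using npair[of 1 2] n by (simp add: atLeastAtMost_iff)
  then obtain a c where ao: "a \<in> {1..n}" "c \<in> {1..n}" "a \<noteq> c" "x a c \<noteq> 0"
    unfolding supported_on_pair_def by blast
  have "\<exists>b\<in>{1..n} - {c} - {a}. x b c \<noteq> 0"
  proof (rule ccontr)
    assume "\<not> ?thesis"
    then have "(\<Sum>i\<in>{1..n} - {c} - {a}. x i c) = 0" by simp
    then have "(\<Sum>i\<in>{1..n} - {c}. x i c) = x a c"
      using sum.remove[of "{1..n} - {c}" a "\<lambda>i. x i c"] ao by simp
    then show False using sums ao by simp
  qed
  then obtain b where b: "b \<in> {1..n}" "b \<noteq> c" "b \<noteq> a" "x b c \<noteq> 0" by blast
  have "A = carrier G" if "commutant_closed A" "\<beta> a c \<in> A" for A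
  proof (rule PSigma_generated[OF A_subgroup[OF that(1)]])
    fix i j assume "i \<in> {1..n}" "j \<in> {1..n}" "i \<noteq> j"
    then show "\<beta> i j \<in> A"
      using closed_contains_zero_sums[OF that(1), of c a b i j] ao b sums that(2) ntriple[of c a b]
      by blast
  qed
  then show thesis using that ao pconj_in_G'[of c "{a}"] by blast
qed

end

section \<open>Free quotients\<close>

text \<open>G is the semidirect product of N and the isomorphic image of H, and f is the projection
  to H. Since the products of N and \<psi>(H) form a subgroup, it is enough that N and \<psi>(H)
  generate G.\<close>

lemma quotient_hom:
  fixes G (structure) and F (structure)
  assumes G: "group G" and F: "group F" and N: "N \<lhd> G" and H: "subgroup H F"
    and \<psi>: "\<psi> \<in> hom F G"
    and inj: "\<And>w. w \<in> H \<Longrightarrow> \<psi> w \<in> N \<Longrightarrow> w = \<one>\<^bsub>F\<^esub>"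
    and cover: "\<And>A. subgroup A G \<Longrightarrow> N \<subseteq> A \<Longrightarrow> \<psi> ` H \<subseteq> A \<Longrightarrow> A = carrier G"
  obtains f where "f \<in> hom G F" "\<And>w. w \<in> H \<Longrightarrow> f (\<psi> w) = w" "\<And>\<nu>. \<nu> \<in> N \<Longrightarrow> f \<nu> = \<one>\<^bsub>F\<^esub>"
proof -
  interpret G: group G by fact
  interpret F: group F by fact
  interpret N: normal N G by fact
  interpret H: subgroup H F by fact
  interpret \<psi>: group_hom F G \<psi>
    by (simp add: group_hom_def group_hom_axioms_def G F \<psi>)
  define r where "r g w \<longleftrightarrow> w \<in> H \<and> g \<otimes>\<^bsub>G\<^esub> inv\<^bsub>G\<^esub> \<psi> w \<in> N" for g w
  have \<psi>H: "\<psi> w \<in> carrier G" if "w \<in> H" for w using that H.mem_carrier by simp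
  have r_mult: "r (g \<otimes>\<^bsub>G\<^esub> h) (u \<otimes>\<^bsub>F\<^esub> v)" if "r g u" "r h v" "g \<in> carrier G" "h \<in> carrier G" for g h u v
  proof -
    have uv: "u \<in> H" "v \<in> H" "g \<otimes>\<^bsub>G\<^esub> inv\<^bsub>G\<^esub> \<psi> u \<in> N" "h \<otimes>\<^bsub>G\<^esub> inv\<^bsub>G\<^esub> \<psi> v \<in> N"
      using that by (auto simp: r_def)
    have "g \<otimes>\<^bsub>G\<^esub> (h \<otimes>\<^bsub>G\<^esub> inv\<^bsub>G\<^esub> \<psi> v) \<otimes>\<^bsub>G\<^esub> inv\<^bsub>G\<^esub> g \<otimes>\<^bsub>G\<^esub> (g \<otimes>\<^bsub>G\<^esub> inv\<^bsub>G\<^esub> \<psi> u) \<in> N"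
      using N.inv_op_closed2[OF that(3) uv(4)] uv(3) by simp
    moreover have "inv\<^bsub>G\<^esub> g \<otimes>\<^bsub>G\<^esub> (g \<otimes>\<^bsub>G\<^esub> inv\<^bsub>G\<^esub> \<psi> u) = inv\<^bsub>G\<^esub> \<psi> u"
      using that \<psi>H[OF uv(1)] by (simp add: G.m_assoc[symmetric])
    ultimately have "g \<otimes>\<^bsub>G\<^esub> h \<otimes>\<^bsub>G\<^esub> inv\<^bsub>G\<^esub> \<psi> (u \<otimes>\<^bsub>F\<^esub> v) \<in> N"
      using that uv \<psi>H[OF uv(1)] \<psi>H[OF uv(2)] H.mem_carrier
      by (simp add: G.m_assoc G.inv_mult_group)
    then show ?thesis using uv by (simp add: r_def)
  qed
  have r_inv: "r (inv\<^bsub>G\<^esub> g) (inv\<^bsub>F\<^esub> u)" if "r g u" "g \<in> carrier G" for g u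
  proof -
    have u: "u \<in> H" "g \<otimes>\<^bsub>G\<^esub> inv\<^bsub>G\<^esub> \<psi> u \<in> N" using that by (auto simp: r_def)
    have "inv\<^bsub>G\<^esub> g \<otimes>\<^bsub>G\<^esub> (inv\<^bsub>G\<^esub> (g \<otimes>\<^bsub>G\<^esub> inv\<^bsub>G\<^esub> \<psi> u)) \<otimes>\<^bsub>G\<^esub> g \<in> N"
      using N.inv_op_closed1[OF that(2) N.m_inv_closed[OF u(2)]] .
    then have "inv\<^bsub>G\<^esub> g \<otimes>\<^bsub>G\<^esub> \<psi> u \<in> N"
      using that \<psi>H[OF u(1)] by (simp add: G.m_assoc G.inv_mult_group)
    then show ?thesis using u H.mem_carrier[OF u(1)] \<psi>H[OF u(1)] by (simp add: r_def)
  qed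
  have r_unique: "u = v" if "r g u" "r g v" "g \<in> carrier G" for g u v
  proof -
    have uv: "u \<in> H" "v \<in> H" using that by (auto simp: r_def)
    have "r \<one>\<^bsub>G\<^esub> (inv\<^bsub>F\<^esub> u \<otimes>\<^bsub>F\<^esub> v)"
      using r_mult[OF r_inv[OF that(1,3)] that(2) G.inv_closed[OF that(3)] that(3)] that(3) by simp
    then have *: "inv\<^bsub>F\<^esub> u \<otimes>\<^bsub>F\<^esub> v \<in> H" "\<one>\<^bsub>G\<^esub> \<otimes>\<^bsub>G\<^esub> inv\<^bsub>G\<^esub> \<psi> (inv\<^bsub>F\<^esub> u \<otimes>\<^bsub>F\<^esub> v) \<in> N"
      unfolding r_def by auto
    then have "\<psi> (inv\<^bsub>F\<^esub> u \<otimes>\<^bsub>F\<^esub> v) \<in> N"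
      using N.m_inv_closed[OF *(2)] \<psi>H[OF *(1)] by simp
    then have "inv\<^bsub>F\<^esub> u \<otimes>\<^bsub>F\<^esub> v = \<one>\<^bsub>F\<^esub>" using inj *(1) by blast
    then have "inv\<^bsub>F\<^esub> (inv\<^bsub>F\<^esub> u) = v"
      using F.inv_equality[of "inv\<^bsub>F\<^esub> u" v] uv H.mem_carrier by (metis F.inv_closed F.inv_equality F.inv_inv)
    then show ?thesis using uv H.mem_carrier by simp
  qed
  have r_N: "r \<nu> \<one>\<^bsub>F\<^esub>" if "\<nu> \<in> N" for \<nu> using that by (simp add: r_def)
  have r_\<psi>: "r (\<psi> w) w" if "w \<in> H" for w using that \<psi>H[OF that] by (simp add: r_def)
  have "{g \<in> carrier G. \<exists>w. r g w} = carrier G"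
  proof (rule cover)
    show "subgroup {g \<in> carrier G. \<exists>w. r g w} G"
    proof (rule G.subgroupI)
      show "{g \<in> carrier G. \<exists>w. r g w} \<noteq> {}" using r_N[OF N.one_closed] by blast
    qed (use r_mult r_inv in blast)+
    show "N \<subseteq> {g \<in> carrier G. \<exists>w. r g w}" using r_N N.subset by blast
    show "\<psi> ` H \<subseteq> {g \<in> carrier G. \<exists>w. r g w}" using r_\<psi> \<psi>H by blast
  qed
  then have ex: "\<exists>w. r g w" if "g \<in> carrier G" for g using that by blast
  define f where "f g = (THE w. r g w)" for g
  have f_eq: "f g = w" if "r g w" "g \<in> carrier G" for g w
    unfolding f_def using that r_unique by blast
  have f: "r g (f g)" if "g \<in> carrier G" for g
    using ex[OF that] f_eq[OF _ that] by blast
  show thesis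
  proof
    show "f \<in> hom G F"
    proof (rule homI)
      show "f g \<in> carrier F" if "g \<in> carrier G" for g
        using f[OF that] H.mem_carrier by (auto simp: r_def)
      show "f (g \<otimes>\<^bsub>G\<^esub> h) = f g \<otimes>\<^bsub>F\<^esub> f h" if "g \<in> carrier G" "h \<in> carrier G" for g h
        by (rule f_eq[OF r_mult[OF f f]]) (use that in auto)
    qed
    show "f (\<psi> w) = w" if "w \<in> H" for w by (rule f_eq[OF r_\<psi>[OF that] \<psi>H[OF that]])
    show "f \<nu> = \<one>\<^bsub>F\<^esub>" if "\<nu> \<in> N" for \<nu> using f_eq[OF r_N[OF that]] that N.subset by blast
  qed
qed

section \<open>Directions at the vertices of the Bass--Serre tree\<close>

lemma takeWhile_append_stop:
  "ys = [] \<or> \<not> P (hd ys) \<Longrightarrow> takeWhile P (xs @ ys) = takeWhile P xs"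
  by (induction xs) (cases ys; auto)+

text \<open>For reduced w, the exponent of the power of \<open>x\<^sub>k\<close> with which w
  begins; left multiplication by \<open>x\<^sub>k\<close> shifts it by one.\<close>

definition lex :: "nat \<Rightarrow> word \<Rightarrow> real" where
  "lex k w = lsum (\<lambda>_. 1) (takeWhile (\<lambda>a. fst a = k) w)"

lemma lex_red_cons: "fst a = k \<Longrightarrow> lex k (red_cons a w) = lval (\<lambda>_. 1) a + lex k w"
  by (cases w) (auto simp: lex_def red_cons_def)

lemma reduced_takeWhile: "reduced w \<Longrightarrow> reduced (takeWhile P w)"
  by (metis reduced_append_iff takeWhile_dropWhile_id)

lemma reduced_dropWhile: "reduced w \<Longrightarrow> reduced (dropWhile P w)"
  by (metis reduced_append_iff takeWhile_dropWhile_id)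

text \<open>
  Let \<open>v\<^sub>l\<close> be the vertex \<open>g\<^sub>l\<langle>x\<^sub>l\<rangle>\<close> of the Bass--Serre tree of \<open>\<langle>x\<^sub>1\<rangle> * \<dots> * \<langle>x\<^sub>n\<rangle>\<close>. The direction at
  \<open>v\<^sub>k\<close> towards \<open>v\<^sub>l\<close> is recorded by \<open>lex k (g\<^sub>k\<^sup>-\<^sup>1 g\<^sub>l)\<close>. With \<open>U = g\<^sub>k\<^sup>-\<^sup>1 g\<^sub>i\<close> and \<open>V = g\<^sub>k\<^sup>-\<^sup>1 g\<^sub>j\<close> the
  lemma says: if \<open>v\<^sub>k\<close> separates \<open>v\<^sub>i\<close> from \<open>v\<^sub>j\<close>, then \<open>v\<^sub>j\<close> and \<open>v\<^sub>k\<close> lie in the same direction from \<open>v\<^sub>i\<close>.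
\<close>
lemma lex_separated:
  assumes "reduced U" "reduced V" "lex k U \<noteq> lex k V" "i \<noteq> k"
  shows "lex i (foldr red_cons (inv_word U) V) = lex i (inv_word U)"
proof -
  let ?P = "\<lambda>a :: letter. fst a = k"
  define X U' Y V' where "X = takeWhile ?P U" "U' = dropWhile ?P U" "Y = takeWhile ?P V" "V' = dropWhile ?P V"
  note defs = this
  have U: "U = X @ U'" and V: "V = Y @ V'" by (simp_all add: defs)
  have red: "reduced X" "reduced U'" "reduced Y" "reduced V'"
    using assms by (simp_all add: defs reduced_takeWhile reduced_dropWhile)
  have kX: "fst a = k" if "a \<in> set X" for a using that by (auto simp: defs dest: set_takeWhileD)
  have kY: "fst a = k" if "a \<in> set Y" for a using that by (auto simp: defs dest: set_takeWhileD)
  have hU: "fst (hd U') \<noteq> k" if "U' \<noteq> []" using that hd_dropWhile[of ?P U] by (simp add: defs)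
  have hV: "fst (hd V') \<noteq> k" if "V' \<noteq> []" using that hd_dropWhile[of ?P V] by (simp add: defs)
  \<comment> \<open>The power of \<open>x\<^sub>k\<close> left between \<open>inv_word U'\<close>
    and V' in the product. It is nonempty because the exponents differ, and it stops all further
    cancellation; so the product begins like \<open>inv_word U'\<close>, as does
    \<open>inv_word U\<close>.\<close>
  define Z where "Z = foldr red_cons (inv_word X) Y"
  have redZ: "reduced Z" using red by (simp add: Z_def)
  have kZ: "fst a = k" if "a \<in> set Z" for a
  proof -
    have "a \<in> set (inv_word X) \<union> set Y" using that set_foldr_red_cons unfolding Z_def by blast
    moreover have "fst ` set (inv_word X) \<subseteq> {k}" using kX by auto
    ultimately show ?thesis using kY by blast
  qed
  have "lsum (\<lambda>_. 1) Z = lex k V - lex k U" by (simp add: Z_def lex_def defs)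
  then have Z: "Z \<noteq> []" using assms(3) by auto
  have "foldr red_cons (inv_word U) V = foldr red_cons (inv_word U') (foldr red_cons (inv_word X) (foldr red_cons Y V'))"
    using foldr_red_cons_reduced[of Y V'] assms(2) by (simp add: U V)
  also have "\<dots> = foldr red_cons (inv_word U') (foldr red_cons Z V')"
    unfolding Z_def using red by (simp add: foldr_red_cons_assoc)
  also have "foldr red_cons Z V' = Z @ V'"
  proof (rule foldr_red_cons_reduced)
    have "hd V' \<noteq> inv_letter (last Z)" if "V' \<noteq> []"
      using hV[OF that] kZ[of "last Z"] Z by auto
    then show "reduced (Z @ V')" using redZ red by (auto simp: reduced_append_iff)
  qed
  also have "foldr red_cons (inv_word U') (Z @ V') = inv_word U' @ Z @ V'"
  proof (rule foldr_red_cons_reduced)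
    have "hd V' \<noteq> inv_letter (last Z)" if "V' \<noteq> []"
      using hV[OF that] kZ[of "last Z"] Z by auto
    moreover have "hd Z \<noteq> inv_letter (last (inv_word U'))" if "U' \<noteq> []"
      using hU[OF that] kZ[of "hd Z"] Z that by (auto simp: last_inv_word)
    ultimately show "reduced (inv_word U' @ Z @ V')"
      using redZ red Z by (auto simp: reduced_append_iff)
  qed
  finally have eq: "foldr red_cons (inv_word U) V = inv_word U' @ (Z @ V')" .
  have "takeWhile (\<lambda>a. fst a = i) (inv_word U' @ (Z @ V')) = takeWhile (\<lambda>a. fst a = i) (inv_word U')"
    by (rule takeWhile_append_stop) (use Z kZ[of "hd Z"] assms(4) in auto)
  moreover have "takeWhile (\<lambda>a. fst a = i) (inv_word U' @ inv_word X) = takeWhile (\<lambda>a. fst a = i) (inv_word U')"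
  proof (rule takeWhile_append_stop)
    show "inv_word X = [] \<or> fst (hd (inv_word X)) \<noteq> i"
      using kX[of "last X"] assms(4) by (cases "X = []") (auto simp: hd_inv_word)
  qed
  moreover have "inv_word U = inv_word U' @ inv_word X" by (simp add: U)
  ultimately show ?thesis unfolding lex_def eq by (simp only:)
qed

section \<open>The action of P\<Sigma>_n on the free group on a part of the basis\<close>

context psigma
begin

lemma Cons_mult: "a # w \<in> carrier F \<Longrightarrow> a # w = [a] \<otimes>\<^bsub>F\<^esub> w"
  using red_cons_reduced[of a w] by (simp add: free_group_simps)

lemma snoc_mult: "w @ [a] \<in> carrier F \<Longrightarrow> w @ [a] = w \<otimes>\<^bsub>F\<^esub> [a]"
  using foldr_red_cons_reduced[of w "[a]"] by (simp add: free_group_simps)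

text \<open>If the last letter of w had another index than a, then w a w^-1 would be reduced as it
  stands and too long to equal a. So the last letter commutes with a and can be removed.\<close>

lemma commute_letter:
  assumes "w \<in> carrier F" "fst a \<in> {1..n}" "w \<otimes>\<^bsub>F\<^esub> [a] = [a] \<otimes>\<^bsub>F\<^esub> w"
  shows "fst ` set w \<subseteq> {fst a}"
  using assms(1,3)
proof (induction w rule: rev_induct)
  case (snoc b w)
  let ?w = "w @ [b]"
  have w: "w \<in> carrier F" and b: "fst b \<in> {1..n}" and red: "reduced ?w"
    using snoc.prems(1) by (auto simp: free_group_simps reduced_append_iff)
  note l = letter_in_F[OF assms(2)] letter_in_F[OF b]
  have ba: "fst b = fst a"
  proof (rule ccontr)
    assume ne: "fst b \<noteq> fst a"
    have r1: "reduced (?w @ a # inv_word ?w)"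
      unfolding reduced_append_iff[of ?w] reduced_Cons[of a] reduced_inv_word
      using red ne by auto
    then have r2: "reduced (a # inv_word ?w)" unfolding reduced_append_iff[of ?w] by blast
    have "?w \<otimes>\<^bsub>F\<^esub> ([a] \<otimes>\<^bsub>F\<^esub> inv\<^bsub>F\<^esub> ?w) = ?w @ a # inv_word ?w"
      unfolding inv_free_group[OF snoc.prems(1)] free_group_simps
      using foldr_red_cons_reduced[OF r1] red_cons_reduced[OF r2]
      by (simp only: foldr.simps o_apply id_apply)
    moreover have "?w \<otimes>\<^bsub>F\<^esub> ([a] \<otimes>\<^bsub>F\<^esub> inv\<^bsub>F\<^esub> ?w) = ?w \<otimes>\<^bsub>F\<^esub> [a] \<otimes>\<^bsub>F\<^esub> inv\<^bsub>F\<^esub> ?w"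
      by (rule F.m_assoc[symmetric, OF snoc.prems(1) l(1) F.inv_closed[OF snoc.prems(1)]])
    moreover have "?w \<otimes>\<^bsub>F\<^esub> [a] \<otimes>\<^bsub>F\<^esub> inv\<^bsub>F\<^esub> ?w = [a]"
      unfolding snoc.prems(2) using snoc.prems(1) l(1) by (simp add: F.m_assoc)
    ultimately have "[a] = ?w @ a # inv_word ?w" by simp
    then have "length [a] = length (?w @ a # inv_word ?w)" by (rule arg_cong)
    then show False by simp
  qed
  then have comm: "[b] \<otimes>\<^bsub>F\<^esub> [a] = [a] \<otimes>\<^bsub>F\<^esub> [b]"
    by (auto simp: free_group_simps red_cons_def inv_letter_def prod_eq_iff)
  have eq: "?w = w \<otimes>\<^bsub>F\<^esub> [b]" by (rule snoc_mult[OF snoc.prems(1)])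
  have "w \<otimes>\<^bsub>F\<^esub> [a] \<otimes>\<^bsub>F\<^esub> [b] = [a] \<otimes>\<^bsub>F\<^esub> w \<otimes>\<^bsub>F\<^esub> [b]"
    using snoc.prems(2) w l unfolding eq by (simp add: F.m_assoc comm)
  then have "w \<otimes>\<^bsub>F\<^esub> [a] = [a] \<otimes>\<^bsub>F\<^esub> w" using w l by simp
  then show ?case using snoc.IH[OF w] ba by auto
qed simp

text \<open>For I within {1..n}, the retraction of F onto the free factor
  \<open>words_on I\<close>.\<close>

definition proj :: "nat set \<Rightarrow> word \<Rightarrow> word" where
  "proj I = free_lift n F (\<lambda>i. if i \<in> I then gen i else \<one>\<^bsub>F\<^esub>)"

definition words_on :: "nat set \<Rightarrow> word set" where
  "words_on I = {w \<in> carrier F. fst ` set w \<subseteq> I}"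

text \<open>The kernel of the action on this free factor, modulo conjugation by elements of D: the
  trivial group for pairs, all of F for triples.\<close>

definition trivial_on :: "nat set \<Rightarrow> word set \<Rightarrow> (word \<Rightarrow> word) set" where
  "trivial_on I D = {\<phi> \<in> carrier G. \<exists>g\<in>D. \<forall>w\<in>carrier F.
    proj I (\<phi> w) = g \<otimes>\<^bsub>F\<^esub> proj I w \<otimes>\<^bsub>F\<^esub> inv\<^bsub>F\<^esub> g}"

lemma proj_hom: "proj I \<in> hom F F"
  and proj_gen: "i \<in> {1..n} \<Longrightarrow> proj I (gen i) = (if i \<in> I then gen i else \<one>\<^bsub>F\<^esub>)"
  unfolding proj_def
  using free_lift[OF F.is_group, of n "\<lambda>i. if i \<in> I then gen i else \<one>\<^bsub>F\<^esub>"] gen_F by auto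

lemmas proj_app = hom_F[OF proj_hom]

lemma proj_letter:
  assumes "fst a \<in> {1..n}"
  shows "proj I [a] = (if fst a \<in> I then [a] else \<one>\<^bsub>F\<^esub>)"
proof (cases rule: letter_cases[of a])
  case 1
  then show ?thesis using proj_gen[OF assms] by simp
next
  case 2
  show ?thesis using proj_gen[OF assms, of I] proj_app(3)[OF gen_F[OF assms], of I] 2[OF assms] by simp
qed

lemma words_on_subgroup: "subgroup (words_on I) F"
proof (rule F.subgroupI)
  show "words_on I \<noteq> {}" by (auto simp: words_on_def free_group_simps intro: exI[of _ "[]"])
  show "inv\<^bsub>F\<^esub> w \<in> words_on I" if "w \<in> words_on I" for w
    using that F.inv_closed[of w] by (auto simp: words_on_def inv_free_group)
  show "u \<otimes>\<^bsub>F\<^esub> v \<in> words_on I" if "u \<in> words_on I" "v \<in> words_on I" for u v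
  proof -
    have "set (u \<otimes>\<^bsub>F\<^esub> v) \<subseteq> set u \<union> set v"
      unfolding free_group_simps by (rule set_foldr_red_cons)
    then have "fst ` set (u \<otimes>\<^bsub>F\<^esub> v) \<subseteq> fst ` (set u \<union> set v)" by (rule image_mono)
    also have "\<dots> \<subseteq> I" using that by (simp add: words_on_def image_Un)
    finally show ?thesis using that by (simp add: words_on_def)
  qed
qed (auto simp: words_on_def)

lemma words_on_carrier: "w \<in> words_on I \<Longrightarrow> w \<in> carrier F"
  by (simp add: words_on_def)

lemma proj_words_on: "w \<in> words_on I \<Longrightarrow> proj I w = w"
proof (induction w)
  case Nil
  show ?case using hom_one[OF proj_hom F.is_group F.is_group] by (simp add: free_group_simps)
next
  case (Cons a w)
  then have a: "fst a \<in> I" "fst a \<in> {1..n}" and w: "w \<in> words_on I" and aw: "a # w \<in> carrier F"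
    by (auto simp: words_on_def free_group_simps reduced_Cons)
  show ?case
    unfolding Cons_mult[OF aw] using proj_app(1)[OF letter_in_F[OF a(2)] words_on_carrier[OF w]]
      proj_letter[OF a(2)] a(1) Cons.IH[OF w] by simp
qed

lemma gen_words_on: "i \<in> I \<Longrightarrow> i \<in> {1..n} \<Longrightarrow> gen i \<in> words_on I"
  using gen_F[of i] by (simp add: words_on_def gen_def)

lemma letter_words_on: "fst a \<in> I \<Longrightarrow> fst a \<in> {1..n} \<Longrightarrow> [a] \<in> words_on I"
  using letter_in_F[of a] by (simp add: words_on_def)

text \<open>A generator killed by \<open>proj I\<close> goes under \<phi> to a conjugate of itself,
  which is killed as well; hence \<phi> acts on the free factor.\<close>

lemma proj_G_proj:
  assumes "\<phi> \<in> carrier G" "w \<in> carrier F"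
  shows "proj I (\<phi> (proj I w)) = proj I (\<phi> w)"
proof -
  have \<phi>: "\<phi> \<in> hom F F" by (rule G_hom[OF assms(1)])
  have "(proj I \<circ> (\<phi> \<circ> proj I)) w = (proj I \<circ> \<phi>) w"
  proof (rule free_group_hom_eq[OF F.is_group _ _ _ assms(2)])
    show "proj I \<circ> (\<phi> \<circ> proj I) \<in> hom F F" "proj I \<circ> \<phi> \<in> hom F F"
      using hom_compose[OF hom_compose[OF proj_hom \<phi>] proj_hom] hom_compose[OF \<phi> proj_hom] by auto
    fix i assume i: "i \<in> {1..n}"
    show "(proj I \<circ> (\<phi> \<circ> proj I)) (gen i) = (proj I \<circ> \<phi>) (gen i)"
    proof (cases "i \<in> I")
      case True
      then show ?thesis using proj_gen[OF i] by simp
    next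
      case False
      obtain u where u: "u \<in> carrier F" "\<phi> (gen i) = inv\<^bsub>F\<^esub> u \<otimes>\<^bsub>F\<^esub> gen i \<otimes>\<^bsub>F\<^esub> u"
        using assms(1) i unfolding carrier_G by blast
      have "proj I (\<phi> (gen i)) = \<one>\<^bsub>F\<^esub>"
        using False u gen_F[OF i] proj_gen[OF i, of I] by (simp add: proj_app)
      moreover have "proj I (\<phi> \<one>\<^bsub>F\<^esub>) = \<one>\<^bsub>F\<^esub>"
        using hom_one[OF \<phi> F.is_group F.is_group] hom_one[OF proj_hom F.is_group F.is_group] by simp
      ultimately show ?thesis using proj_gen[OF i, of I] False by simp
    qed
  qed
  then show ?thesis by simp
qed

text \<open>If \<phi> acts as conjugation by g, its conjugate by \<theta> acts as conjugation by
  \<open>proj I (\<theta> g)\<close>.\<close>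

lemma trivial_on_normal:
  assumes D: "subgroup D F" and stable: "\<And>\<theta> g. \<theta> \<in> carrier G \<Longrightarrow> g \<in> D \<Longrightarrow> proj I (\<theta> g) \<in> D"
  shows "trivial_on I D \<lhd> G"
proof -
  interpret D: subgroup D F by fact
  have "subgroup (trivial_on I D) G"
  proof (rule G.subgroupI)
    show "trivial_on I D \<subseteq> carrier G" by (auto simp: trivial_on_def)
    have "\<one>\<^bsub>G\<^esub> \<in> trivial_on I D" unfolding trivial_on_def
      using D.one_closed by (auto simp: one_G_apply proj_app intro!: bexI[of _ "\<one>\<^bsub>F\<^esub>"])
    then show "trivial_on I D \<noteq> {}" by blast
  next
    fix \<phi> assume "\<phi> \<in> trivial_on I D"
    then obtain g where \<phi>: "\<phi> \<in> carrier G" "g \<in> D"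
      "\<And>w. w \<in> carrier F \<Longrightarrow> proj I (\<phi> w) = g \<otimes>\<^bsub>F\<^esub> proj I w \<otimes>\<^bsub>F\<^esub> inv\<^bsub>F\<^esub> g"
      unfolding trivial_on_def by blast
    have g: "g \<in> carrier F" using \<phi>(2) by (rule D.mem_carrier)
    have "proj I ((inv\<^bsub>G\<^esub> \<phi>) w) = inv\<^bsub>F\<^esub> g \<otimes>\<^bsub>F\<^esub> proj I w \<otimes>\<^bsub>F\<^esub> inv\<^bsub>F\<^esub> (inv\<^bsub>F\<^esub> g)"
      if w: "w \<in> carrier F" for w
    proof -
      let ?u = "(inv\<^bsub>G\<^esub> \<phi>) w"
      have u: "?u \<in> carrier F" using w \<phi>(1) by (simp add: G_app)
      have "proj I w = g \<otimes>\<^bsub>F\<^esub> proj I ?u \<otimes>\<^bsub>F\<^esub> inv\<^bsub>F\<^esub> g"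
        using \<phi>(3)[OF u] inv_G_apply(1)[OF \<phi>(1) w] by simp
      then show ?thesis using g proj_app(2)[OF u]
        by (simp add: F.m_assoc) (simp add: F.m_assoc[symmetric])
    qed
    then show "inv\<^bsub>G\<^esub> \<phi> \<in> trivial_on I D"
      unfolding trivial_on_def using \<phi>(1) D.m_inv_closed[OF \<phi>(2)] by blast
  next
    fix \<phi> \<psi> assume "\<phi> \<in> trivial_on I D" "\<psi> \<in> trivial_on I D"
    then obtain g h where \<phi>: "\<phi> \<in> carrier G" "g \<in> D"
      "\<And>w. w \<in> carrier F \<Longrightarrow> proj I (\<phi> w) = g \<otimes>\<^bsub>F\<^esub> proj I w \<otimes>\<^bsub>F\<^esub> inv\<^bsub>F\<^esub> g"
      and \<psi>: "\<psi> \<in> carrier G" "h \<in> D"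
      "\<And>w. w \<in> carrier F \<Longrightarrow> proj I (\<psi> w) = h \<otimes>\<^bsub>F\<^esub> proj I w \<otimes>\<^bsub>F\<^esub> inv\<^bsub>F\<^esub> h"
      unfolding trivial_on_def by blast
    have gh: "g \<in> carrier F" "h \<in> carrier F" using \<phi>(2) \<psi>(2) D.mem_carrier by auto
    have "proj I ((\<phi> \<otimes>\<^bsub>G\<^esub> \<psi>) w) = (g \<otimes>\<^bsub>F\<^esub> h) \<otimes>\<^bsub>F\<^esub> proj I w \<otimes>\<^bsub>F\<^esub> inv\<^bsub>F\<^esub> (g \<otimes>\<^bsub>F\<^esub> h)"
      if w: "w \<in> carrier F" for w
      using \<phi>(3)[OF G_app(2)[OF \<psi>(1) w]] \<psi>(3)[OF w] gh proj_app(2)[OF w]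
      by (simp add: mult_G_apply[OF \<phi>(1) \<psi>(1) w] F.m_assoc F.inv_mult_group)
    then show "\<phi> \<otimes>\<^bsub>G\<^esub> \<psi> \<in> trivial_on I D"
      unfolding trivial_on_def using \<phi>(1) \<psi>(1) D.m_closed[OF \<phi>(2) \<psi>(2)] by blast
  qed
  moreover have "\<theta> \<otimes>\<^bsub>G\<^esub> \<phi> \<otimes>\<^bsub>G\<^esub> inv\<^bsub>G\<^esub> \<theta> \<in> trivial_on I D"
    if \<theta>: "\<theta> \<in> carrier G" and "\<phi> \<in> trivial_on I D" for \<theta> \<phi>
  proof -
    obtain g where \<phi>: "\<phi> \<in> carrier G" "g \<in> D"
      "\<And>w. w \<in> carrier F \<Longrightarrow> proj I (\<phi> w) = g \<otimes>\<^bsub>F\<^esub> proj I w \<otimes>\<^bsub>F\<^esub> inv\<^bsub>F\<^esub> g"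
      using \<open>\<phi> \<in> trivial_on I D\<close> unfolding trivial_on_def by blast
    have g: "g \<in> carrier F" using \<phi>(2) by (rule D.mem_carrier)
    let ?h = "proj I (\<theta> g)"
    have "proj I ((\<theta> \<otimes>\<^bsub>G\<^esub> \<phi> \<otimes>\<^bsub>G\<^esub> inv\<^bsub>G\<^esub> \<theta>) w) = ?h \<otimes>\<^bsub>F\<^esub> proj I w \<otimes>\<^bsub>F\<^esub> inv\<^bsub>F\<^esub> ?h"
      if w: "w \<in> carrier F" for w
    proof -
      let ?u = "(inv\<^bsub>G\<^esub> \<theta>) w"
      have u: "?u \<in> carrier F" using w \<theta> by (simp add: G_app)
      have pu: "proj I ?u \<in> carrier F" using proj_app(2)[OF u] .
      have "(\<theta> \<otimes>\<^bsub>G\<^esub> \<phi> \<otimes>\<^bsub>G\<^esub> inv\<^bsub>G\<^esub> \<theta>) w = \<theta> (\<phi> ?u)"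
        using w \<theta> \<phi>(1) u by (simp add: mult_G_apply)
      then have "proj I ((\<theta> \<otimes>\<^bsub>G\<^esub> \<phi> \<otimes>\<^bsub>G\<^esub> inv\<^bsub>G\<^esub> \<theta>) w) = proj I (\<theta> (proj I (\<phi> ?u)))"
        using proj_G_proj[OF \<theta> G_app(2)[OF \<phi>(1) u]] by simp
      also have "\<dots> = ?h \<otimes>\<^bsub>F\<^esub> proj I (\<theta> (proj I ?u)) \<otimes>\<^bsub>F\<^esub> inv\<^bsub>F\<^esub> ?h"
        unfolding \<phi>(3)[OF u] using g pu \<theta> by (simp add: G_app proj_app)
      also have "proj I (\<theta> (proj I ?u)) = proj I w"
        using proj_G_proj[OF \<theta> u] inv_G_apply(1)[OF \<theta> w] by simp
      finally show ?thesis .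
    qed
    then show ?thesis
      unfolding trivial_on_def using \<theta> \<phi>(1) stable[OF \<theta> \<phi>(2)] by blast
  qed
  ultimately show ?thesis by (simp add: G.normal_inv_iff)
qed

text \<open>Either the conjugating letter or every generator that is moved is killed by
  \<open>proj I\<close>.\<close>

lemma pconj_trivial_on:
  assumes q: "q \<in> {1..n}" "q \<notin> J" and "q \<notin> I \<or> I \<inter> J = {}" and D: "subgroup D F"
  shows "pconj J (q, True) \<in> trivial_on I D"
proof -
  interpret D: subgroup D F by fact
  let ?b = "[(q, True)]"
  have p: "pconj J (q, True) \<in> carrier G" using pconj_in_G q by auto
  have b: "?b \<in> carrier F" using letter_in_F[of "(q, True)"] q by simp
  have "(proj I \<circ> pconj J (q, True)) w = proj I w" if w: "w \<in> carrier F" for w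
  proof (rule free_group_hom_eq[OF F.is_group _ proj_hom _ w])
    show "proj I \<circ> pconj J (q, True) \<in> hom F F" by (rule hom_compose[OF G_hom[OF p] proj_hom])
    fix i assume i: "i \<in> {1..n}"
    show "(proj I \<circ> pconj J (q, True)) (gen i) = proj I (gen i)"
      using pconj_gen[of "(q, True)" i J] proj_letter[of "(q, True)" I] proj_gen[OF i, of I] q i b gen_F[OF i] assms(3)
      by (auto simp: proj_app)
  qed
  then show ?thesis unfolding trivial_on_def
    using p D.one_closed by (auto simp: proj_app intro!: bexI[of _ "\<one>\<^bsub>F\<^esub>"])
qed

text \<open>Conjugation by b fixes the generator with the index of b anyway, so on J together with
  this index the partial conjugation is a full one.\<close>

lemma pconj_inner_on:
  assumes b: "fst b \<in> {1..n}" "fst b \<notin> J" and w: "w \<in> carrier F"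
  shows "proj (insert (fst b) J) (pconj J b w) =
    inv\<^bsub>F\<^esub> [b] \<otimes>\<^bsub>F\<^esub> proj (insert (fst b) J) w \<otimes>\<^bsub>F\<^esub> [b]"
proof -
  let ?I = "insert (fst b) J"
  let ?h = "\<lambda>w. inv\<^bsub>F\<^esub> [b] \<otimes>\<^bsub>F\<^esub> proj ?I w \<otimes>\<^bsub>F\<^esub> [b]"
  note l = letter_in_F[OF b(1)]
  have cancel: "[b] \<otimes>\<^bsub>F\<^esub> (inv\<^bsub>F\<^esub> [b] \<otimes>\<^bsub>F\<^esub> y) = y" if "y \<in> carrier F" for y
    using that l by (simp add: F.m_assoc[symmetric])
  have "(proj ?I \<circ> pconj J b) w = ?h w"
  proof (rule free_group_hom_eq[OF F.is_group _ _ _ w])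
    show "proj ?I \<circ> pconj J b \<in> hom F F" by (rule hom_compose[OF pconj_hom[OF b(1)] proj_hom])
    show "?h \<in> hom F F" using l by (intro homI) (simp_all add: proj_app F.m_assoc cancel)
    fix i assume i: "i \<in> {1..n}"
    have pb: "proj ?I [b] = [b]" using proj_letter[OF b(1), of ?I] by simp
    consider "i = fst b" | "i \<in> J" | "i \<notin> ?I" by blast
    then show "(proj ?I \<circ> pconj J b) (gen i) = ?h (gen i)"
    proof cases
      case 1
      then have "i \<notin> J" using b by simp
      have comm: "gen i \<otimes>\<^bsub>F\<^esub> [b] = [b] \<otimes>\<^bsub>F\<^esub> gen i"
      proof (cases rule: letter_cases[of b])
        case 1
        then show ?thesis using \<open>i = fst b\<close> by simp
      next
        case 2
        then have "[b] = inv\<^bsub>F\<^esub> gen i" using \<open>i = fst b\<close> b by blast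
        then show ?thesis using gen_F[OF i] by simp
      qed
      have "?h (gen i) = inv\<^bsub>F\<^esub> [b] \<otimes>\<^bsub>F\<^esub> (gen i \<otimes>\<^bsub>F\<^esub> [b])"
        using l gen_F[OF i] proj_gen[OF i, of ?I] 1 by (simp add: F.m_assoc)
      also have "\<dots> = gen i"
        unfolding comm using l gen_F[OF i] by (simp add: F.m_assoc[symmetric])
      finally have "?h (gen i) = gen i" .
      then show ?thesis using pconj_gen[OF b(1) i, of J] proj_gen[OF i, of ?I] 1 \<open>i \<notin> J\<close> by simp
    next
      case 2
      then show ?thesis
        using pconj_gen[OF b(1) i, of J] proj_gen[OF i, of ?I] l gen_F[OF i] pb by (simp add: proj_app)
    next
      case 3
      then show ?thesis
        using pconj_gen[OF b(1) i, of J] proj_gen[OF i, of ?I] l by simp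
    qed
  qed
  then show ?thesis by simp
qed

lemma F_cancel:
  "x \<in> carrier F \<Longrightarrow> y \<in> carrier F \<Longrightarrow> x \<otimes>\<^bsub>F\<^esub> (inv\<^bsub>F\<^esub> x \<otimes>\<^bsub>F\<^esub> y) = y"
  "x \<in> carrier F \<Longrightarrow> y \<in> carrier F \<Longrightarrow> inv\<^bsub>F\<^esub> x \<otimes>\<^bsub>F\<^esub> (x \<otimes>\<^bsub>F\<^esub> y) = y"
  by (simp_all add: F.m_assoc[symmetric])

text \<open>The future section of the free quotient; s selects one row in each column of I.\<close>

definition psi :: "(nat \<Rightarrow> nat) \<Rightarrow> nat set \<Rightarrow> word \<Rightarrow> word \<Rightarrow> word" where
  "psi s I = free_lift n G (\<lambda>l. if l \<in> I then \<beta> (s l) l else \<one>\<^bsub>G\<^esub>)"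

text \<open>With \<open>g l\<close> representing the vertex number l, and l, m different from k,
  this is nonzero exactly if vertex k separates vertices l and m.\<close>

definition gap :: "nat \<Rightarrow> nat \<Rightarrow> nat \<Rightarrow> (nat \<Rightarrow> word) \<Rightarrow> real" where
  "gap k l m g = lex k (inv\<^bsub>F\<^esub> g k \<otimes>\<^bsub>F\<^esub> g l) - lex k (inv\<^bsub>F\<^esub> g k \<otimes>\<^bsub>F\<^esub> g m)"

context
  fixes s :: "nat \<Rightarrow> nat" and I :: "nat set"
  assumes I: "I \<subseteq> {1..n}" and s: "\<And>l. l \<in> I \<Longrightarrow> s l \<in> I" "\<And>l. l \<in> I \<Longrightarrow> s l \<noteq> l"
begin

lemma psi_lift:
  shows psi_hom: "psi s I \<in> hom F G"
    and psi_gen: "l \<in> I \<Longrightarrow> psi s I (gen l) = \<beta> (s l) l"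
proof -
  have "(if l \<in> I then \<beta> (s l) l else \<one>\<^bsub>G\<^esub>) \<in> carrier G" if "l \<in> {1..n}" for l
    using that s[of l] by (auto intro: pconj_in_G)
  note l = free_lift[of G n "\<lambda>l. if l \<in> I then \<beta> (s l) l else \<one>\<^bsub>G\<^esub>", folded psi_def, OF G.is_group this]
  show "psi s I \<in> hom F G" by (rule l(1))
  show "l \<in> I \<Longrightarrow> psi s I (gen l) = \<beta> (s l) l" using l(3)[of l] I by auto
qed

lemma psi_letter:
  assumes a: "fst a \<in> I"
  shows "psi s I [a] = pconj {s (fst a)} a"
proof -
  interpret \<psi>: group_hom F G "psi s I"
    by (simp add: group_hom_def group_hom_axioms_def F.is_group G.is_group psi_hom)
  have n: "fst a \<in> {1..n}" using a I by blast
  show ?thesis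
  proof (cases "snd a")
    case True
    then have "(fst a, True) = a" "gen (fst a) = [a]" by (auto simp: gen_def prod_eq_iff)
    then show ?thesis using psi_gen[OF a] by simp
  next
    case False
    then have eq: "inv_letter (fst a, True) = a" by (auto simp: inv_letter_def prod_eq_iff)
    have "[a] = inv\<^bsub>F\<^esub> gen (fst a)"
      unfolding inv_free_group[OF gen_F[OF n]] by (simp add: gen_def eq)
    then have "psi s I [a] = inv\<^bsub>G\<^esub> \<beta> (s (fst a)) (fst a)"
      using \<psi>.hom_inv[OF gen_F[OF n]] psi_gen[OF a] by simp
    then show ?thesis using inv_pconj[of "(fst a, True)" "{s (fst a)}"] n s(2)[OF a] eq by simp
  qed
qed

text \<open>By \<open>third\<close> the product of \<beta> p q and \<beta> (s q) q dies in the
  quotient, so each column q in I contributes one free generator, and \<beta> p q goes to its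
  inverse.\<close>

lemma free_quotient_hom:
  assumes D: "subgroup D F" and stable: "\<And>\<theta> g. \<theta> \<in> carrier G \<Longrightarrow> g \<in> D \<Longrightarrow> proj I (\<theta> g) \<in> D"
    and third: "\<And>p q. p \<in> I \<Longrightarrow> q \<in> I \<Longrightarrow> p \<noteq> q \<Longrightarrow> p \<noteq> s q \<Longrightarrow> pconj {p, s q} (q, True) \<in> trivial_on I D"
    and inj: "\<And>w. w \<in> words_on I \<Longrightarrow> psi s I w \<in> trivial_on I D \<Longrightarrow> w = []"
  obtains f where "f \<in> hom G F" "\<And>q. q \<in> I \<Longrightarrow> f (\<beta> (s q) q) = gen q"
    "\<And>p q. p \<in> {1..n} \<Longrightarrow> q \<in> {1..n} \<Longrightarrow> p \<noteq> q \<Longrightarrow> p \<notin> I \<or> q \<notin> I \<Longrightarrow> f (\<beta> p q) = []"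
    "\<And>p q. p \<in> I \<Longrightarrow> q \<in> I \<Longrightarrow> p \<noteq> q \<Longrightarrow> p \<noteq> s q \<Longrightarrow> f (\<beta> p q) = inv\<^bsub>F\<^esub> gen q"
proof -
  let ?N = "trivial_on I D"
  have N: "?N \<lhd> G" by (rule trivial_on_normal[OF D]) (rule stable)
  have outer: "\<beta> p q \<in> ?N"
    if "p \<in> {1..n}" "q \<in> {1..n}" "p \<noteq> q" "p \<notin> I \<or> q \<notin> I" for p q
    by (rule pconj_trivial_on[OF _ _ _ D]) (use that in auto)
  have prod: "pconj {p, s q} (q, True) = \<beta> (s q) q \<otimes>\<^bsub>G\<^esub> \<beta> p q"
    if "p \<in> I" "q \<in> I" "p \<noteq> q" "p \<noteq> s q" for p q
    using pconj_insert[of "(q, True)" "{s q}" p] that I s(2)[OF that(2)] by auto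
  have \<beta>_G: "\<beta> p q \<in> carrier G" if "p \<noteq> q" "q \<in> I" for p q
    using pconj_in_G[of "(q, True)" "{p}"] that I by auto
  obtain f where f: "f \<in> hom G F" "\<And>w. w \<in> words_on I \<Longrightarrow> f (psi s I w) = w"
    "\<And>\<nu>. \<nu> \<in> ?N \<Longrightarrow> f \<nu> = \<one>\<^bsub>F\<^esub>"
  proof (rule quotient_hom[OF G.is_group F.is_group N words_on_subgroup[of I] psi_hom])
    show "w = \<one>\<^bsub>F\<^esub>" if "w \<in> words_on I" "psi s I w \<in> ?N" for w
      using inj[OF that] by (simp add: free_group_simps)
    fix A assume A: "subgroup A G" "?N \<subseteq> A" "psi s I ` words_on I \<subseteq> A"
    interpret A: subgroup A G by (rule A)
    show "A = carrier G"
    proof (rule PSigma_generated[OF A(1)])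
      fix p q assume pq: "p \<in> {1..n}" "q \<in> {1..n}" "p \<noteq> q"
      have ps: "\<beta> (s q) q \<in> A" if "q \<in> I"
      proof -
        have "gen q \<in> words_on I" using gen_words_on that pq by blast
        then show ?thesis using A(3) psi_gen[OF that] by (metis image_subset_iff)
      qed
      consider "p \<notin> I \<or> q \<notin> I" | "q \<in> I" "p = s q" | "p \<in> I" "q \<in> I" "p \<noteq> s q" by blast
      then show "\<beta> p q \<in> A"
      proof cases
        case 1
        then show ?thesis using outer[OF pq] A(2) by blast
      next
        case 2
        then show ?thesis using ps by simp
      next
        case 3
        note G = \<beta>_G[OF pq(3) 3(2)] \<beta>_G[OF s(2)[OF 3(2)] 3(2)]
        have "\<beta> p q = inv\<^bsub>G\<^esub> \<beta> (s q) q \<otimes>\<^bsub>G\<^esub> pconj {p, s q} (q, True)"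
          unfolding prod[OF 3(1,2) pq(3) 3(3)] using G by (simp add: G.m_assoc[symmetric])
        moreover have "pconj {p, s q} (q, True) \<in> A" using third[OF 3(1,2) pq(3) 3(3)] A(2) by blast
        ultimately show ?thesis using ps[OF 3(2)] A.m_closed A.m_inv_closed by metis
      qed
    qed
  qed (rule that)
  have 1: "f (\<beta> (s q) q) = gen q" if "q \<in> I" for q
    using f(2)[OF gen_words_on[OF that]] psi_gen[OF that] that I by auto
  show thesis
  proof
    show "f \<in> hom G F" by (rule f(1))
    show "f (\<beta> (s q) q) = gen q" if "q \<in> I" for q by (rule 1[OF that])
    show "f (\<beta> p q) = []" if "p \<in> {1..n}" "q \<in> {1..n}" "p \<noteq> q" "p \<notin> I \<or> q \<notin> I" for p q
      using f(3)[OF outer[OF that]] by (simp add: free_group_simps)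
    show "f (\<beta> p q) = inv\<^bsub>F\<^esub> gen q" if pq: "p \<in> I" "q \<in> I" "p \<noteq> q" "p \<noteq> s q" for p q
    proof -
      have c: "\<beta> p q \<in> carrier G" "\<beta> (s q) q \<in> carrier G" using \<beta>_G pq s(2) by auto
      have "gen q \<otimes>\<^bsub>F\<^esub> f (\<beta> p q) = \<one>\<^bsub>F\<^esub>"
        using f(3)[OF third[OF pq]] hom_mult[OF f(1) c(2,1)] prod[OF pq] 1[OF pq(2)] by simp
      moreover have "gen q \<in> carrier F" "f (\<beta> p q) \<in> carrier F"
        using gen_F pq I f(1) c by (auto simp: hom_def)
      ultimately show ?thesis by (metis F.inv_equality F.inv_inv F.inv_closed)
    qed
  qed
qed

text \<open>
  Ping-pong on triples of vertices of the Bass--Serre tree: \<open>g l\<close> moves the vertex fixed by \<open>x\<^sub>l\<close> to the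
  one fixed by \<open>psi s I w x\<^sub>l\<close>. After a letter with index \<open>k\<close> the vertex number \<open>k\<close> separates the
  other two, and any admissible next letter preserves this.
\<close>
lemma ping_pong:
  assumes card: "card I = 3" and "w \<in> words_on I"
  shows "\<exists>g. (\<forall>l\<in>I. g l \<in> words_on I \<and> psi s I w (gen l) = g l \<otimes>\<^bsub>F\<^esub> gen l \<otimes>\<^bsub>F\<^esub> inv\<^bsub>F\<^esub> g l) \<and>
    (w = [] \<longrightarrow> g = (\<lambda>_. [])) \<and>
    (w \<noteq> [] \<longrightarrow> (\<forall>m\<in>I. m \<noteq> fst (last w) \<longrightarrow> m \<noteq> s (fst (last w)) \<longrightarrow>
      lval (\<lambda>_. 1) (last w) * gap (fst (last w)) (s (fst (last w))) m g < 0))"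
  using assms(2)
proof (induction w rule: rev_induct)
  case Nil
  have "psi s I [] (gen l) = gen l" if "l \<in> I" for l
    using hom_one[OF psi_hom F.is_group G.is_group] that I gen_F[of l]
    by (auto simp: free_group_simps one_G_apply)
  moreover have "[] \<otimes>\<^bsub>F\<^esub> gen l \<otimes>\<^bsub>F\<^esub> inv\<^bsub>F\<^esub> [] = gen l" if "l \<in> I" for l
  proof -
    have "\<one>\<^bsub>F\<^esub> \<otimes>\<^bsub>F\<^esub> gen l \<otimes>\<^bsub>F\<^esub> inv\<^bsub>F\<^esub> \<one>\<^bsub>F\<^esub> = gen l" using that I gen_F[of l] by auto
    then show ?thesis by (simp only: free_group_simps(3))
  qed
  moreover have "[] \<in> words_on I"
    using subgroup.one_closed[OF words_on_subgroup[of I]] by (simp add: free_group_simps)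
  ultimately show ?case by (intro exI[of _ "\<lambda>_. []"]) simp
next
  case (snoc a w)
  define k where "k = fst a"
  interpret W: subgroup "words_on I" F by (rule words_on_subgroup)
  have aI: "fst a \<in> I" and w: "w \<in> words_on I" and red: "reduced (w @ [a])" and wa: "w @ [a] \<in> carrier F"
    using snoc.prems by (auto simp: words_on_def free_group_simps reduced_append_iff)
  have a: "fst a \<in> {1..n}" and k: "k \<in> I" using aI I by (auto simp: k_def)
  note l = letter_in_F[OF a]
  from snoc.IH[OF w] obtain g where G:
    "(\<forall>l\<in>I. g l \<in> words_on I \<and> psi s I w (gen l) = g l \<otimes>\<^bsub>F\<^esub> gen l \<otimes>\<^bsub>F\<^esub> inv\<^bsub>F\<^esub> g l) \<and>
      (w = [] \<longrightarrow> g = (\<lambda>_. [])) \<and>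
      (w \<noteq> [] \<longrightarrow> (\<forall>m\<in>I. m \<noteq> fst (last w) \<longrightarrow> m \<noteq> s (fst (last w)) \<longrightarrow>
        lval (\<lambda>_. 1) (last w) * gap (fst (last w)) (s (fst (last w))) m g < 0))" ..
  note g0 = conjunct1[OF G] conjunct1[OF conjunct2[OF G]] conjunct2[OF conjunct2[OF G]]
  have g: "g l \<in> words_on I" "psi s I w (gen l) = g l \<otimes>\<^bsub>F\<^esub> gen l \<otimes>\<^bsub>F\<^esub> inv\<^bsub>F\<^esub> g l" if "l \<in> I" for l
    using bspec[OF g0(1) that] by simp_all
  have g_gap: "lval (\<lambda>_. 1) (last w) * gap (fst (last w)) (s (fst (last w))) m g < 0"
    if "w \<noteq> []" "m \<in> I" "m \<noteq> fst (last w)" "m \<noteq> s (fst (last w))" for m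
    using g0(3) that by simp
  have gF: "g l \<in> carrier F" if "l \<in> I" for l using g(1)[OF that] by (rule words_on_carrier)
  have genF: "gen l \<in> carrier F" if "l \<in> I" for l using gen_F I that by blast
  have \<psi>w: "psi s I w \<in> carrier G" using psi_hom w words_on_carrier by (auto simp: hom_def)
  have \<psi>a: "psi s I [a] \<in> carrier G" using psi_hom l by (auto simp: hom_def)
  \<comment> \<open>The image of the letter a under \<open>psi s I w\<close>. Appending a to w
    conjugates the image of the generator number \<open>s k\<close> by B and leaves the other images
    alone.\<close>
  define B where "B = g k \<otimes>\<^bsub>F\<^esub> [a] \<otimes>\<^bsub>F\<^esub> inv\<^bsub>F\<^esub> g k"
  have B: "psi s I w [a] = B"
  proof (cases rule: letter_cases[of a])
    case 1
    then show ?thesis using g(2)[OF aI] by (simp add: B_def k_def)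
  next
    case 2
    show ?thesis
      using g(2)[OF aI] G_app(3)[OF \<psi>w genF[OF aI]] gF[OF aI] genF[OF aI]
      unfolding B_def k_def 2[OF a] by (simp add: F.inv_mult_group F.m_assoc)
  qed
  have BW: "B \<in> words_on I" unfolding B_def
    using g(1)[OF k] letter_words_on[OF aI a] by simp
  have BF: "B \<in> carrier F" by (rule words_on_carrier[OF BW])
  define g' where "g' = g(s k := inv\<^bsub>F\<^esub> B \<otimes>\<^bsub>F\<^esub> g (s k))"
  have g'k: "g' k = g k" using s(2)[OF k] by (simp add: g'_def)
  have \<psi>wa: "psi s I (w @ [a]) u = psi s I w (psi s I [a] u)" if "u \<in> carrier F" for u
    unfolding snoc_mult[OF wa] using hom_mult[OF psi_hom words_on_carrier[OF w] l] mult_G_apply[OF \<psi>w \<psi>a that] by simp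
  have main: "g' l \<in> words_on I \<and> psi s I (w @ [a]) (gen l) = g' l \<otimes>\<^bsub>F\<^esub> gen l \<otimes>\<^bsub>F\<^esub> inv\<^bsub>F\<^esub> g' l"
    if "l \<in> I" for l
  proof (cases "l = s k")
    case True
    have "psi s I [a] (gen l) = inv\<^bsub>F\<^esub> [a] \<otimes>\<^bsub>F\<^esub> gen l \<otimes>\<^bsub>F\<^esub> [a]"
      using psi_letter[OF aI] pconj_gen[OF a, of l "{s (fst a)}"] True that I by (auto simp: k_def)
    then have "psi s I (w @ [a]) (gen l) = inv\<^bsub>F\<^esub> B \<otimes>\<^bsub>F\<^esub> (g l \<otimes>\<^bsub>F\<^esub> gen l \<otimes>\<^bsub>F\<^esub> inv\<^bsub>F\<^esub> g l) \<otimes>\<^bsub>F\<^esub> B"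
      using \<psi>wa[OF genF[OF that]] \<psi>w genF[OF that] \<open>[a] \<in> carrier F\<close> B g(2)[OF that] by (simp add: G_app)
    also have "\<dots> = g' l \<otimes>\<^bsub>F\<^esub> gen l \<otimes>\<^bsub>F\<^esub> inv\<^bsub>F\<^esub> g' l"
      using BF gF[OF that] genF[OF that] True by (simp add: g'_def F.m_assoc F.inv_mult_group)
    finally show ?thesis using BW g(1)[OF that] True by (simp add: g'_def)
  next
    case False
    have "psi s I [a] (gen l) = gen l"
      using psi_letter[OF aI] pconj_gen[OF a, of l "{s (fst a)}"] False that I by (auto simp: k_def)
    then show ?thesis using \<psi>wa[OF genF[OF that]] g(1,2)[OF that] False by (simp add: g'_def)
  qed
  have sep: "lval (\<lambda>_. 1) a * gap k (s k) m g' < 0" if m: "m \<in> I" "m \<noteq> k" "m \<noteq> s k" for m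
  proof -
    let ?U = "inv\<^bsub>F\<^esub> g k \<otimes>\<^bsub>F\<^esub> g (s k)" and ?V = "inv\<^bsub>F\<^esub> g k \<otimes>\<^bsub>F\<^esub> g m"
    have "inv\<^bsub>F\<^esub> g' k \<otimes>\<^bsub>F\<^esub> g' (s k) = inv\<^bsub>F\<^esub> g k \<otimes>\<^bsub>F\<^esub> (inv\<^bsub>F\<^esub> B \<otimes>\<^bsub>F\<^esub> g (s k))"
      unfolding g'k by (simp add: g'_def)
    also have "\<dots> = inv\<^bsub>F\<^esub> [a] \<otimes>\<^bsub>F\<^esub> ?U"
      using gF[OF k] gF[OF s(1)[OF k]] l unfolding B_def
      by (simp add: F.inv_mult_group F.m_assoc F_cancel)
    also have "\<dots> = red_cons (inv_letter a) ?U" unfolding inv_letter_F[OF a] by (simp add: free_group_simps)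
    finally have U': "lex k (inv\<^bsub>F\<^esub> g' k \<otimes>\<^bsub>F\<^esub> g' (s k)) = - lval (\<lambda>_. 1) a + lex k ?U"
      using lex_red_cons[of "inv_letter a" k ?U] by (simp add: k_def)
    have V': "inv\<^bsub>F\<^esub> g' k \<otimes>\<^bsub>F\<^esub> g' m = ?V" unfolding g'k using m by (simp add: g'_def)
    \<comment> \<open>Before the new letter acts, the gap is zero or has the desired sign already;
      the new letter then subtracts its sign from it, which makes the inequality strict.\<close>
    have "lval (\<lambda>_. 1) a * (lex k ?U - lex k ?V) \<le> 0"
    proof (cases "w = []")
      case True
      then have "g = (\<lambda>_. [])" using g0(2) by blast
      then show ?thesis by (simp only:) simp
    next
      case w_ne: False
      define k' where "k' = fst (last w)"
      have "last w \<in> set w" using w_ne by (rule last_in_set)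
      then have k': "k' \<in> I" using w unfolding words_on_def k'_def by blast
      show ?thesis
      proof (cases "k' = k")
        case True
        \<comment> \<open>In a reduced word, adjacent letters of equal index are equal, so the
          induction hypothesis concerns the same letter.\<close>
        have "a \<noteq> inv_letter (last w)" using red w_ne by (simp add: reduced_append_iff)
        moreover have "fst (last w) = fst a" using True unfolding k_def k'_def .
        ultimately have last: "last w = a" unfolding inv_letter_def prod_eq_iff by auto
        have "lval (\<lambda>_. 1) a * gap k (s k) m g < 0"
          using g_gap[OF w_ne m(1)] m(2,3) unfolding last k_def[symmetric] by blast
        then show ?thesis unfolding gap_def by (rule less_imp_le)
      next
        case False
        have "card (I - {k, k'}) = 1"
          using card_Diff_subset[of "{k, k'}" I] card False k k' by simp
        then obtain r where r: "I - {k, k'} = {r}" by (rule card_1_singletonE)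
        then have rI: "r \<in> I" "r \<noteq> k" "r \<noteq> k'" by auto
        have Icases: "z = k \<or> z = k' \<or> z = r" if "z \<in> I" for z using r that by blast
        have gp: "gap k' (s k') z g \<noteq> 0" if "z \<in> I" "z \<noteq> k'" "z \<noteq> s k'" for z
        proof
          assume "gap k' (s k') z g = 0"
          then show False using g_gap[OF w_ne that(1)] that(2,3) unfolding k'_def by simp
        qed
        \<comment> \<open>Vertex k' separates k from r. By \<open>lex_separated\<close>, k' and r
          then lie in the same direction from k, and these two are s k and m in some order.\<close>
        have "gap k' k r g \<noteq> 0"
        proof (cases "s k' = k")
          case True
          show ?thesis using gp[OF rI(1,3)] rI(2) unfolding True by blast
        next
          case sk: False
          then have "s k' = r" using Icases[OF s(1)[OF k']] s(2)[OF k'] by blast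
          then have "gap k' r k g \<noteq> 0" using gp[OF k] sk False by metis
          then show ?thesis by (simp add: gap_def)
        qed
        then have ne: "lex k' (inv\<^bsub>F\<^esub> g k' \<otimes>\<^bsub>F\<^esub> g k) \<noteq> lex k' (inv\<^bsub>F\<^esub> g k' \<otimes>\<^bsub>F\<^esub> g r)"
          by (simp add: gap_def)
        have UV: "inv\<^bsub>F\<^esub> g k' \<otimes>\<^bsub>F\<^esub> g k \<in> carrier F" "inv\<^bsub>F\<^esub> g k' \<otimes>\<^bsub>F\<^esub> g r \<in> carrier F"
          by (simp_all add: gF k k' rI)
        have "lex k (inv\<^bsub>F\<^esub> (inv\<^bsub>F\<^esub> g k' \<otimes>\<^bsub>F\<^esub> g k) \<otimes>\<^bsub>F\<^esub> (inv\<^bsub>F\<^esub> g k' \<otimes>\<^bsub>F\<^esub> g r))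
            = lex k (inv\<^bsub>F\<^esub> (inv\<^bsub>F\<^esub> g k' \<otimes>\<^bsub>F\<^esub> g k))"
          unfolding inv_free_group[OF UV(1)] free_group_simps(2)[of n "inv_word (inv\<^bsub>F\<^esub> g k' \<otimes>\<^bsub>F\<^esub> g k)"]
          by (rule lex_separated[OF _ _ ne]) (use UV False in \<open>simp_all only: free_group_simps(1) mem_Collect_eq not_sym\<close>)
        moreover have "inv\<^bsub>F\<^esub> (inv\<^bsub>F\<^esub> g k' \<otimes>\<^bsub>F\<^esub> g k) = inv\<^bsub>F\<^esub> g k \<otimes>\<^bsub>F\<^esub> g k'"
          by (simp add: gF k k' F.inv_mult_group)
        moreover have "inv\<^bsub>F\<^esub> g k \<otimes>\<^bsub>F\<^esub> g k' \<otimes>\<^bsub>F\<^esub> (inv\<^bsub>F\<^esub> g k' \<otimes>\<^bsub>F\<^esub> g r) = inv\<^bsub>F\<^esub> g k \<otimes>\<^bsub>F\<^esub> g r"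
          using gF[OF k] gF[OF k'] gF[OF rI(1)]
          by (simp add: F.m_assoc F_cancel)
        ultimately have eq: "lex k (inv\<^bsub>F\<^esub> g k \<otimes>\<^bsub>F\<^esub> g r) = lex k (inv\<^bsub>F\<^esub> g k \<otimes>\<^bsub>F\<^esub> g k')" by simp
        have "s k = k' \<or> s k = r" using Icases[OF s(1)[OF k]] s(2)[OF k] by blast
        moreover have "m = k' \<or> m = r" using Icases m by blast
        ultimately have "(s k = k' \<and> m = r) \<or> (s k = r \<and> m = k')" using m(3) by blast
        then have "lex k ?U = lex k ?V" using eq by (elim disjE conjE) (simp_all only:)
        then show ?thesis by simp
      qed
    qed
    moreover have "lval (\<lambda>_. 1) a * lval (\<lambda>_. 1) a = 1" by (simp add: lval_def)
    ultimately show ?thesis unfolding gap_def U' V' by (simp add: algebra_simps)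
  qed
  show ?case
  proof (intro exI[of _ g'] conjI impI ballI)
    fix l assume l: "l \<in> I"
    show "g' l \<in> words_on I" "psi s I (w @ [a]) (gen l) = g' l \<otimes>\<^bsub>F\<^esub> gen l \<otimes>\<^bsub>F\<^esub> inv\<^bsub>F\<^esub> g' l"
      using main[OF l] by simp_all
  next
    fix m assume "m \<in> I" "m \<noteq> fst (last (w @ [a]))" "m \<noteq> s (fst (last (w @ [a])))"
    then show "lval (\<lambda>_. 1) (last (w @ [a])) * gap (fst (last (w @ [a]))) (s (fst (last (w @ [a])))) m g' < 0"
      unfolding last_snoc k_def[symmetric] by (rule sep)
  qed simp
qed

end

section \<open>Faithfulness of the sections for pairs and triples\<close>

lemma map_inv_letter_words_on: "w \<in> words_on I \<Longrightarrow> map inv_letter w \<in> words_on I"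
proof -
  assume w: "w \<in> words_on I"
  have "inv_letter b = a \<longleftrightarrow> b = inv_letter a" for a b by auto
  then have "reduced (map inv_letter w)"
    using w by (simp add: words_on_def free_group_simps reduced_def successively_map)
  then show ?thesis using w by (simp add: words_on_def free_group_simps image_image)
qed

context
  fixes s :: "nat \<Rightarrow> nat" and I :: "nat set"
  assumes I: "I \<subseteq> {1..n}" and s: "\<And>l. l \<in> I \<Longrightarrow> s l \<in> I" "\<And>l. l \<in> I \<Longrightarrow> s l \<noteq> l"
begin

text \<open>On a free factor of rank two each \<beta> (s l) l is inner, namely left conjugation by
  the inverse of \<open>x\<^sub>l\<close>. Multiplying these up inverts every letter of w but keeps
  their order.\<close>

lemma psi_pair_conj:
  assumes pair: "\<And>l. l \<in> I \<Longrightarrow> I = {l, s l}" and w: "w \<in> words_on I" and u: "u \<in> carrier F"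
  shows "proj I (psi s I w u) = map inv_letter w \<otimes>\<^bsub>F\<^esub> proj I u \<otimes>\<^bsub>F\<^esub> inv\<^bsub>F\<^esub> map inv_letter w"
  using w
proof (induction w)
  case Nil
  have "psi s I [] u = u"
    using hom_one[OF psi_hom[OF I s] F.is_group G.is_group] u by (simp add: free_group_simps one_G_apply)
  moreover have "\<one>\<^bsub>F\<^esub> \<otimes>\<^bsub>F\<^esub> proj I u \<otimes>\<^bsub>F\<^esub> inv\<^bsub>F\<^esub> \<one>\<^bsub>F\<^esub> = proj I u"
    using proj_app(2)[OF u] by simp
  ultimately show ?case by (simp add: free_group_simps(3))
next
  case (Cons a w)
  have aI: "fst a \<in> I" and w: "w \<in> words_on I" and aw: "a # w \<in> carrier F"
    using Cons.prems by (auto simp: words_on_def free_group_simps reduced_Cons)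
  have a: "fst a \<in> {1..n}" using aI I by blast
  let ?g = "map inv_letter w"
  note l = letter_in_F[OF a]
  have g: "?g \<in> carrier F" using map_inv_letter_words_on[OF w] by (rule words_on_carrier)
  have ag: "map inv_letter (a # w) = inv\<^bsub>F\<^esub> [a] \<otimes>\<^bsub>F\<^esub> ?g"
    using Cons_mult[of "inv_letter a" ?g] words_on_carrier[OF map_inv_letter_words_on[OF Cons.prems]]
    unfolding inv_letter_F[OF a] by simp
  have \<psi>: "psi s I w \<in> carrier G" "psi s I [a] \<in> carrier G"
    using psi_hom[OF I s] words_on_carrier[OF w] l by (auto simp: hom_def)
  have v: "psi s I w u \<in> carrier F" using \<psi>(1) u by (simp add: G_app)
  have "psi s I (a # w) u = psi s I [a] (psi s I w u)"
    unfolding Cons_mult[OF aw]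
    using hom_mult[OF psi_hom[OF I s] l words_on_carrier[OF w]] mult_G_apply[OF \<psi>(2,1) u] by simp
  then have "proj I (psi s I (a # w) u) = proj I (pconj {s (fst a)} a (psi s I w u))"
    using psi_letter[OF I s aI] by simp
  also have "\<dots> = inv\<^bsub>F\<^esub> [a] \<otimes>\<^bsub>F\<^esub> proj I (psi s I w u) \<otimes>\<^bsub>F\<^esub> [a]"
  proof -
    have "fst a \<notin> {s (fst a)}" using s(2)[OF aI] by auto
    from pconj_inner_on[OF a this v] show ?thesis unfolding pair[OF aI, symmetric] .
  qed
  also have "\<dots> = inv\<^bsub>F\<^esub> [a] \<otimes>\<^bsub>F\<^esub> ?g \<otimes>\<^bsub>F\<^esub> proj I u \<otimes>\<^bsub>F\<^esub> inv\<^bsub>F\<^esub> (inv\<^bsub>F\<^esub> [a] \<otimes>\<^bsub>F\<^esub> ?g)"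
    unfolding Cons.IH[OF w] using l g proj_app(2)[OF u] by (simp add: F.inv_mult_group F.m_assoc)
  finally show ?case unfolding ag .
qed

text \<open>The conjugator commutes with both basis elements of the free factor, so its letters have
  both indices at once and there are none.\<close>

lemma psi_pair_inj:
  assumes pair: "\<And>l. l \<in> I \<Longrightarrow> I = {l, s l}" and i: "i \<in> I" and w: "w \<in> words_on I"
    and triv: "psi s I w \<in> trivial_on I {\<one>\<^bsub>F\<^esub>}"
  shows "w = []"
proof -
  let ?g = "map inv_letter w"
  have g: "?g \<in> carrier F" using map_inv_letter_words_on[OF w] by (rule words_on_carrier)
  have letters: "fst ` set ?g \<subseteq> {l}" if l: "l \<in> I" for l
  proof -
    have n: "l \<in> {1..n}" using l I by blast
    note genl = gen_F[OF n]
    have "proj I (psi s I w (gen l)) = \<one>\<^bsub>F\<^esub> \<otimes>\<^bsub>F\<^esub> proj I (gen l) \<otimes>\<^bsub>F\<^esub> inv\<^bsub>F\<^esub> \<one>\<^bsub>F\<^esub>"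
      using triv genl unfolding trivial_on_def by blast
    then have "?g \<otimes>\<^bsub>F\<^esub> gen l \<otimes>\<^bsub>F\<^esub> inv\<^bsub>F\<^esub> ?g = gen l"
      using psi_pair_conj[OF pair w genl] proj_gen[OF n, of I] l genl by simp
    then have "?g \<otimes>\<^bsub>F\<^esub> gen l = gen l \<otimes>\<^bsub>F\<^esub> ?g"
      using F.inv_solve_right'[of "gen l" "?g \<otimes>\<^bsub>F\<^esub> gen l" ?g] g genl by simp
    then show ?thesis using commute_letter[OF g, of "(l, True)"] n by (simp add: gen_def)
  qed
  have "fst ` set ?g \<subseteq> {i} \<inter> {s i}" using letters[OF i] letters[OF s(1)[OF i]] by (rule Int_greatest)
  then show ?thesis using s(2)[OF i] by (cases w) auto
qed

text \<open>If \<open>psi s I w\<close> acts as conjugation by h, then the vertices number l are the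
  h-translates of the vertices \<open>\<langle>x\<^sub>l\<rangle>\<close>, none of which separates
  the other two. After a nonempty word, \<open>ping_pong\<close> says the opposite.\<close>

lemma psi_triple_inj:
  assumes card: "card I = 3" and w: "w \<in> words_on I"
    and triv: "psi s I w \<in> trivial_on I (carrier F)"
  shows "w = []"
proof (rule ccontr)
  assume ne: "w \<noteq> []"
  define k where "k = fst (last w)"
  interpret W: subgroup "words_on I" F by (rule words_on_subgroup)
  have "last w \<in> set w" using ne by (rule last_in_set)
  then have k: "k \<in> I" using w unfolding words_on_def k_def by blast
  have "card (I - {k, s k}) = 1" using card_Diff_subset[of "{k, s k}" I] card k s[OF k] by simp
  then obtain m where "I - {k, s k} = {m}" by (rule card_1_singletonE)
  then have m: "m \<in> I" "m \<noteq> k" "m \<noteq> s k" by auto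
  from ping_pong[OF I s card w] obtain g where G:
    "(\<forall>l\<in>I. g l \<in> words_on I \<and> psi s I w (gen l) = g l \<otimes>\<^bsub>F\<^esub> gen l \<otimes>\<^bsub>F\<^esub> inv\<^bsub>F\<^esub> g l) \<and>
      (w = [] \<longrightarrow> g = (\<lambda>_. [])) \<and>
      (w \<noteq> [] \<longrightarrow> (\<forall>m\<in>I. m \<noteq> fst (last w) \<longrightarrow> m \<noteq> s (fst (last w)) \<longrightarrow>
        lval (\<lambda>_. 1) (last w) * gap (fst (last w)) (s (fst (last w))) m g < 0))" ..
  note g0 = conjunct1[OF G] conjunct2[OF conjunct2[OF G]]
  have g: "g l \<in> words_on I" "psi s I w (gen l) = g l \<otimes>\<^bsub>F\<^esub> gen l \<otimes>\<^bsub>F\<^esub> inv\<^bsub>F\<^esub> g l" if "l \<in> I" for l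
    using bspec[OF g0(1) that] by simp_all
  have gap_ne: "gap k (s k) m g \<noteq> 0"
    using bspec[OF mp[OF g0(2) ne] m(1)] m(2,3) unfolding k_def by auto
  obtain h where h: "h \<in> carrier F"
    "\<And>u. u \<in> carrier F \<Longrightarrow> proj I (psi s I w u) = h \<otimes>\<^bsub>F\<^esub> proj I u \<otimes>\<^bsub>F\<^esub> inv\<^bsub>F\<^esub> h"
    using triv unfolding trivial_on_def by blast
  define c where "c l = inv\<^bsub>F\<^esub> h \<otimes>\<^bsub>F\<^esub> g l" for l
  have gF: "g l \<in> carrier F" if "l \<in> I" for l using g(1)[OF that] by (rule words_on_carrier)
  have cF: "c l \<in> carrier F" if "l \<in> I" for l using gF[OF that] h(1) by (simp add: c_def)
  have letters: "fst ` set (c l) \<subseteq> {l}" if l: "l \<in> I" for l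
  proof -
    have n: "l \<in> {1..n}" using l I by blast
    note genl = gen_F[OF n]
    have "g l \<otimes>\<^bsub>F\<^esub> gen l \<otimes>\<^bsub>F\<^esub> inv\<^bsub>F\<^esub> g l \<in> words_on I"
      using g(1)[OF l] gen_words_on[OF l n] by simp
    then have "g l \<otimes>\<^bsub>F\<^esub> gen l \<otimes>\<^bsub>F\<^esub> inv\<^bsub>F\<^esub> g l = h \<otimes>\<^bsub>F\<^esub> gen l \<otimes>\<^bsub>F\<^esub> inv\<^bsub>F\<^esub> h"
      using h(2)[OF genl] g(2)[OF l] proj_words_on proj_gen[OF n, of I] l by simp
    then have "inv\<^bsub>F\<^esub> h \<otimes>\<^bsub>F\<^esub> (g l \<otimes>\<^bsub>F\<^esub> gen l \<otimes>\<^bsub>F\<^esub> inv\<^bsub>F\<^esub> g l) \<otimes>\<^bsub>F\<^esub> g l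
        = inv\<^bsub>F\<^esub> h \<otimes>\<^bsub>F\<^esub> (h \<otimes>\<^bsub>F\<^esub> gen l \<otimes>\<^bsub>F\<^esub> inv\<^bsub>F\<^esub> h) \<otimes>\<^bsub>F\<^esub> g l"
      by simp
    then have "c l \<otimes>\<^bsub>F\<^esub> gen l = gen l \<otimes>\<^bsub>F\<^esub> c l"
      using gF[OF l] h(1) genl by (simp add: c_def F.m_assoc F_cancel)
    then show ?thesis using commute_letter[OF cF[OF l], of "(l, True)"] n by (simp add: gen_def)
  qed
  have lex_c: "lex k (inv\<^bsub>F\<^esub> g k \<otimes>\<^bsub>F\<^esub> g l) = lex k (inv_word (c k))" if l: "l \<in> I" "l \<noteq> k" for l
  proof -
    have red: "reduced (c k)" "reduced (c l)" using cF k l by (simp_all add: free_group_simps(1))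
    have hd: "fst (hd (c l)) = l" if "c l \<noteq> []" using letters[OF l(1)] that by (cases "c l") auto
    have last: "fst (last (inv_word (c k))) = k" if "c k \<noteq> []"
      using letters[OF k] that by (cases "c k") (auto simp: last_inv_word)
    have "inv\<^bsub>F\<^esub> g k \<otimes>\<^bsub>F\<^esub> g l = inv\<^bsub>F\<^esub> c k \<otimes>\<^bsub>F\<^esub> c l"
      using gF[OF k] gF[OF l(1)] h(1) by (simp add: c_def F.inv_mult_group F.m_assoc F_cancel)
    also have "\<dots> = foldr red_cons (inv_word (c k)) (c l)"
      unfolding inv_free_group[OF cF[OF k]] free_group_simps(2) ..
    also have "\<dots> = inv_word (c k) @ c l"
    proof (rule foldr_red_cons_reduced)
      have "hd (c l) \<noteq> inv_letter (last (inv_word (c k)))" if "c k \<noteq> []" "c l \<noteq> []"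
        using hd[OF that(2)] last[OF that(1)] l(2) by auto
      then show "reduced (inv_word (c k) @ c l)" using red by (auto simp: reduced_append_iff)
    qed
    finally show ?thesis unfolding lex_def
      using takeWhile_append_stop[of "c l" "\<lambda>a. fst a = k" "inv_word (c k)"] hd l(2) by metis
  qed
  have "gap k (s k) m g = 0"
    unfolding gap_def using lex_c[OF s(1)[OF k] s(2)[OF k]] lex_c[OF m(1,2)] by simp
  then show False using gap_ne by simp
qed

end

end

section \<open>The dichotomy for a single character\<close>

context psigma_char
begin

lemma chi_factor:
  assumes f: "f \<in> hom G F"
    and gens: "\<And>p q. p \<in> {1..n} \<Longrightarrow> q \<in> {1..n} \<Longrightarrow> p \<noteq> q \<Longrightarrow> x p q = lsum c (f (\<beta> p q))"
    and g: "g \<in> carrier G"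
  shows "\<chi> g = lsum c (f g)"
proof -
  interpret f: group_hom G F f
    by (simp add: group_hom_def group_hom_axioms_def F.is_group G.is_group f)
  have mult: "\<chi> (g \<otimes>\<^bsub>G\<^esub> h) = \<chi> g + \<chi> h" if "g \<in> carrier G" "h \<in> carrier G" for g h
    using character_mult[OF char that] .
  have one: "\<chi> \<one>\<^bsub>G\<^esub> = 0" using mult[of "\<one>\<^bsub>G\<^esub>" "\<one>\<^bsub>G\<^esub>"] by simp
  have inv: "\<chi> (inv\<^bsub>G\<^esub> g) = - \<chi> g" if "g \<in> carrier G" for g
    using mult[of g "inv\<^bsub>G\<^esub> g"] that one by simp
  have "{g \<in> carrier G. \<chi> g = lsum c (f g)} = carrier G"
  proof (rule PSigma_generated)
    show "subgroup {g \<in> carrier G. \<chi> g = lsum c (f g)} G"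
    proof (rule G.subgroupI)
      show "{g \<in> carrier G. \<chi> g = lsum c (f g)} \<noteq> {}"
        using one f.hom_one by (auto simp: free_group_simps intro!: exI[of _ "\<one>\<^bsub>G\<^esub>"])
      fix g assume g: "g \<in> {g \<in> carrier G. \<chi> g = lsum c (f g)}"
      then have "f (inv\<^bsub>G\<^esub> g) = inv_word (f g)" using inv_free_group[of "f g" n] by simp
      then show "inv\<^bsub>G\<^esub> g \<in> {g \<in> carrier G. \<chi> g = lsum c (f g)}" using g inv by simp
    next
      fix g h assume "g \<in> {g \<in> carrier G. \<chi> g = lsum c (f g)}" "h \<in> {g \<in> carrier G. \<chi> g = lsum c (f g)}"
      then show "g \<otimes>\<^bsub>G\<^esub> h \<in> {g \<in> carrier G. \<chi> g = lsum c (f g)}"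
        using mult f.hom_mult by (simp add: free_group_simps(2))
    qed auto
    show "\<beta> p q \<in> {g \<in> carrier G. \<chi> g = lsum c (f g)}"
      if "p \<in> {1..n}" "q \<in> {1..n}" "p \<noteq> q" for p q
      using gens[OF that] pconj_in_G'[of q "{p}"] that by simp
  qed
  then show ?thesis using g by blast
qed

text \<open>The vanishing of c outside I guarantees, for nonzero \<chi>, a letter of nonzero value
  in the image of f.\<close>

definition free_factor :: bool where
  "free_factor \<longleftrightarrow> (\<exists>f c I. f \<in> hom G F \<and> (\<forall>g\<in>carrier G. \<chi> g = lsum c (f g)) \<and> I \<subseteq> {1..n} \<and>
    (\<exists>p\<in>I. \<exists>q\<in>I. p \<noteq> q) \<and> (\<forall>l\<in>I. \<exists>P\<in>carrier G. f P = gen l) \<and> (\<forall>l. l \<notin> I \<longrightarrow> c l = 0))"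

lemma free_factorI:
  assumes I: "I \<subseteq> {1..n}" "i \<in> I" and s: "\<And>l. l \<in> I \<Longrightarrow> s l \<in> I" "\<And>l. l \<in> I \<Longrightarrow> s l \<noteq> l"
    and D: "subgroup D F" and stable: "\<And>\<theta> g. \<theta> \<in> carrier G \<Longrightarrow> g \<in> D \<Longrightarrow> proj I (\<theta> g) \<in> D"
    and third: "\<And>p q. p \<in> I \<Longrightarrow> q \<in> I \<Longrightarrow> p \<noteq> q \<Longrightarrow> p \<noteq> s q \<Longrightarrow> pconj {p, s q} (q, True) \<in> trivial_on I D"
    and inj: "\<And>w. w \<in> words_on I \<Longrightarrow> psi s I w \<in> trivial_on I D \<Longrightarrow> w = []"
    and supp: "\<And>p q. p \<in> {1..n} \<Longrightarrow> q \<in> {1..n} \<Longrightarrow> p \<noteq> q \<Longrightarrow> p \<notin> I \<or> q \<notin> I \<Longrightarrow> x p q = 0"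
    and sum: "\<And>p q. p \<in> I \<Longrightarrow> q \<in> I \<Longrightarrow> p \<noteq> q \<Longrightarrow> p \<noteq> s q \<Longrightarrow> x p q + x (s q) q = 0"
  shows free_factor
proof -
  obtain f where f: "f \<in> hom G F" "\<And>q. q \<in> I \<Longrightarrow> f (\<beta> (s q) q) = gen q"
    "\<And>p q. p \<in> {1..n} \<Longrightarrow> q \<in> {1..n} \<Longrightarrow> p \<noteq> q \<Longrightarrow> p \<notin> I \<or> q \<notin> I \<Longrightarrow> f (\<beta> p q) = []"
    "\<And>p q. p \<in> I \<Longrightarrow> q \<in> I \<Longrightarrow> p \<noteq> q \<Longrightarrow> p \<noteq> s q \<Longrightarrow> f (\<beta> p q) = inv\<^bsub>F\<^esub> gen q"
  proof (rule free_quotient_hom[where I = I and s = s and D = D, OF I(1) s D])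
    show "proj I (\<theta> g) \<in> D" if "\<theta> \<in> carrier G" "g \<in> D" for \<theta> g by (rule stable[OF that])
    show "pconj {p, s q} (q, True) \<in> trivial_on I D" if "p \<in> I" "q \<in> I" "p \<noteq> q" "p \<noteq> s q" for p q
      by (rule third[OF that])
    show "w = []" if "w \<in> words_on I" "psi s I w \<in> trivial_on I D" for w by (rule inj[OF that])
  qed (assumption, assumption, rule that)
  define c where "c l = (if l \<in> I then x (s l) l else 0)" for l
  have "x p q = lsum c (f (\<beta> p q))" if pq: "p \<in> {1..n}" "q \<in> {1..n}" "p \<noteq> q" for p q
  proof -
    consider "p \<notin> I \<or> q \<notin> I" | "q \<in> I" "p = s q" | "p \<in> I" "q \<in> I" "p \<noteq> s q" by blast
    then show ?thesis
    proof cases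
      case 1
      then show ?thesis using supp[OF pq 1] f(3)[OF pq 1] by simp
    next
      case 2
      then show ?thesis using f(2)[OF 2(1)] by (simp add: gen_def lval_def c_def)
    next
      case 3
      have "lsum c (f (\<beta> p q)) = - c q"
        using f(4)[OF 3(1,2) pq(3) 3(3)] inv_free_group[OF gen_F[OF pq(2)]] by (simp add: gen_def lval_def inv_letter_def)
      then show ?thesis using sum[OF 3(1,2) pq(3) 3(3)] 3 by (simp add: c_def)
    qed
  qed
  then have "\<forall>g\<in>carrier G. \<chi> g = lsum c (f g)" using chi_factor[OF f(1)] by blast
  moreover have "\<forall>l\<in>I. \<exists>P\<in>carrier G. f P = gen l"
  proof
    fix l assume l: "l \<in> I"
    then have "\<beta> (s l) l \<in> carrier G" using pconj_in_G'[of l "{s l}"] I(1) s(2)[OF l] by auto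
    then show "\<exists>P\<in>carrier G. f P = gen l" using f(2)[OF l] by blast
  qed
  moreover have "\<exists>p\<in>I. \<exists>q\<in>I. p \<noteq> q" using I(2) s by metis
  ultimately show ?thesis unfolding free_factor_def using f(1) I(1)
    by (intro exI[of _ f] exI[of _ c] exI[of _ I]) (simp add: c_def)
qed

lemma free_factor_pair:
  assumes ij: "i \<in> {1..n}" "j \<in> {1..n}" "i \<noteq> j" and supp: "supported_on_pair i j"
  shows free_factor
proof (rule free_factorI)
  let ?I = "{i, j}" and ?s = "\<lambda>l. if l = i then j else i"
  show I: "?I \<subseteq> {1..n}" using ij by simp
  show "i \<in> ?I" by simp
  show s: "?s l \<in> ?I" "?s l \<noteq> l" if "l \<in> ?I" for l using that ij by auto
  have pair: "?I = {l, ?s l}" if "l \<in> ?I" for l using that ij by auto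
  show "subgroup {\<one>\<^bsub>F\<^esub>} F" by (rule F.triv_subgroup)
  show "proj ?I (\<theta> g) \<in> {\<one>\<^bsub>F\<^esub>}" if "\<theta> \<in> carrier G" "g \<in> {\<one>\<^bsub>F\<^esub>}" for \<theta> g
    using that(2) hom_one[OF G_hom[OF that(1)] F.is_group F.is_group] hom_one[OF proj_hom F.is_group F.is_group]
    by simp
  show "w = []" if "w \<in> words_on ?I" "psi ?s ?I w \<in> trivial_on ?I {\<one>\<^bsub>F\<^esub>}" for w
    by (rule psi_pair_inj[where i = i, OF I s pair _ that]) simp_all
  show "x p q = 0" if "p \<in> {1..n}" "q \<in> {1..n}" "p \<noteq> q" "p \<notin> ?I \<or> q \<notin> ?I" for p q
    using supp that unfolding supported_on_pair_def by blast
  fix p q assume "p \<in> ?I" "q \<in> ?I" "p \<noteq> q" "p \<noteq> ?s q"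
  then have False using pair by blast
  then show "pconj {p, ?s q} (q, True) \<in> trivial_on ?I {\<one>\<^bsub>F\<^esub>}" "x p q + x (?s q) q = 0" by simp_all
qed

text \<open>Each column of the triple has two entries, whose product restricts to an inner
  automorphism of the free factor and so dies when D is all of F. The three equations say that
  \<chi> vanishes on these products.\<close>

lemma free_factor_triple:
  assumes ijk: "i \<in> {1..n}" "j \<in> {1..n}" "k \<in> {1..n}" "i \<noteq> j" "i \<noteq> k" "j \<noteq> k"
    and supp: "supported_on_triple i j k"
  shows free_factor
proof (rule free_factorI)
  let ?I = "{i, j, k}" and ?s = "\<lambda>l. if l = i then j else i"
  show I: "?I \<subseteq> {1..n}" using ijk by simp
  show "i \<in> ?I" by simp
  show s: "?s l \<in> ?I" "?s l \<noteq> l" if "l \<in> ?I" for l using that ijk by auto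
  have card: "card ?I = 3" using ijk by simp
  show "subgroup (carrier F) F" by (rule F.subgroup_self)
  show "proj ?I (\<theta> g) \<in> carrier F" if "\<theta> \<in> carrier G" "g \<in> carrier F" for \<theta> g
    using that by (simp add: proj_app G_app)
  show "w = []" if "w \<in> words_on ?I" "psi ?s ?I w \<in> trivial_on ?I (carrier F)" for w
    by (rule psi_triple_inj[OF I s card that])
  show "x p q = 0" if "p \<in> {1..n}" "q \<in> {1..n}" "p \<noteq> q" "p \<notin> ?I \<or> q \<notin> ?I" for p q
    using supp that unfolding supported_on_triple_def by blast
  fix p q assume pq: "p \<in> ?I" "q \<in> ?I" "p \<noteq> q" "p \<noteq> ?s q"
  have "q = i \<and> p = k \<or> q = j \<and> p = k \<or> q = k \<and> p = j" using pq ijk by auto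
  then show "x p q + x (?s q) q = 0"
    using supp ijk unfolding supported_on_triple_def by (elim disjE conjE) (simp_all add: add.commute)
  have Iq: "insert q {p, ?s q} = ?I" using pq ijk by auto
  have q: "q \<in> {1..n}" using pq(2) I by blast
  have qn: "fst (q, True) \<notin> {p, ?s q}" using pq s(2)[OF pq(2)] by auto
  have b: "[(q, True)] \<in> carrier F" using letter_in_F[of "(q, True)"] q by simp
  have "proj ?I (pconj {p, ?s q} (q, True) w)
      = inv\<^bsub>F\<^esub> [(q, True)] \<otimes>\<^bsub>F\<^esub> proj ?I w \<otimes>\<^bsub>F\<^esub> inv\<^bsub>F\<^esub> (inv\<^bsub>F\<^esub> [(q, True)])" if "w \<in> carrier F" for w
    using pconj_inner_on[of "(q, True)" "{p, ?s q}" w, OF _ qn that] q b unfolding fst_conv Iq by simp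
  moreover have "pconj {p, ?s q} (q, True) \<in> carrier G" by (rule pconj_in_G) (use q qn in simp_all)
  ultimately show "pconj {p, ?s q} (q, True) \<in> trivial_on ?I (carrier F)"
    unfolding trivial_on_def using F.inv_closed[OF b] by blast
qed

lemma not_resonant:
  assumes t: "t \<in> carrier G" "\<chi> t \<noteq> 0"
    and full: "\<And>A. commutant_closed A \<Longrightarrow> t \<in> A \<Longrightarrow> A = carrier G"
  shows "char_class G \<chi> \<notin> resonance_variety G"
proof
  assume "char_class G \<chi> \<in> resonance_variety G"
  then obtain b h where b: "b \<in> characters G"
    and h: "\<And>g k. g \<in> carrier G \<Longrightarrow> k \<in> carrier G \<Longrightarrow> \<chi> g * b k = h g + h k - h (g \<otimes>\<^bsub>G\<^esub> k)"
    and indep: "\<And>c. \<exists>g\<in>carrier G. b g \<noteq> c * \<chi> g"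
    unfolding resonance_variety_iff[OF G.is_group char] by blast
  \<comment> \<open>Chosen so that b - r \<chi> vanishes at t.\<close>
  define r where "r = b t / \<chi> t"
  define A where "A = {g \<in> carrier G. b g = r * \<chi> g}"
  have mult: "\<chi> (g \<otimes>\<^bsub>G\<^esub> k) = \<chi> g + \<chi> k" "b (g \<otimes>\<^bsub>G\<^esub> k) = b g + b k"
    if "g \<in> carrier G" "k \<in> carrier G" for g k
    using character_mult[OF char that] character_mult[OF b that] .
  have one: "\<chi> \<one>\<^bsub>G\<^esub> = 0" "b \<one>\<^bsub>G\<^esub> = 0" using mult[of "\<one>\<^bsub>G\<^esub>" "\<one>\<^bsub>G\<^esub>"] by simp_all
  have inv: "\<chi> (inv\<^bsub>G\<^esub> g) = - \<chi> g" "b (inv\<^bsub>G\<^esub> g) = - b g" if "g \<in> carrier G" for g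
    using mult[of g "inv\<^bsub>G\<^esub> g"] that one by simp_all
  have "commutant_closed A" unfolding commutant_closed_def
  proof (intro conjI ballI impI)
    show "subgroup A G"
    proof (rule G.subgroupI)
      show "A \<noteq> {}" using one by (auto simp: A_def intro!: exI[of _ "\<one>\<^bsub>G\<^esub>"])
    qed (auto simp: A_def mult inv algebra_simps)
    fix z g assume z: "z \<in> A" "\<chi> z \<noteq> 0" and g: "g \<in> carrier G" "g \<otimes>\<^bsub>G\<^esub> z = z \<otimes>\<^bsub>G\<^esub> g"
    have zc: "z \<in> carrier G" "b z = r * \<chi> z" using z(1) by (simp_all add: A_def)
    \<comment> \<open>The coboundary of h is symmetric in commuting arguments.\<close>
    have "\<chi> z * b g = \<chi> g * b z" using h[OF zc(1) g(1)] h[OF g(1) zc(1)] g(2) by simp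
    then have "\<chi> z * b g = \<chi> z * (r * \<chi> g)" by (simp add: zc(2) mult.commute)
    then show "g \<in> A" using z(2) g(1) by (simp add: A_def)
  qed
  moreover have "t \<in> A" using t by (simp add: A_def r_def)
  ultimately have "A = carrier G" by (rule full)
  then show False using indep[of r] by (auto simp: A_def)
qed

lemma bns_iff_not_resonant:
  assumes n: "n \<ge> 2" and S: "finite S" "S \<subseteq> carrier G" "generate G S = carrier G"
  shows "\<chi> \<in> bns_invariant G S \<longleftrightarrow> char_class G \<chi> \<notin> resonance_variety G"
proof (cases free_factor)
  case True
  then obtain f c I where f: "f \<in> hom G F" "\<forall>g\<in>carrier G. \<chi> g = lsum c (f g)" "I \<subseteq> {1..n}"
    "\<exists>p\<in>I. \<exists>q\<in>I. p \<noteq> q" "\<forall>l\<in>I. \<exists>P\<in>carrier G. f P = gen l" "\<forall>l. l \<notin> I \<longrightarrow> c l = 0"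
    unfolding free_factor_def by blast
  \<comment> \<open>\<open>not_in_bns\<close> asks for a letter p of nonzero value. If c is zero
    then so is \<chi>, which the BNS invariant excludes by definition, and which
    \<open>resonant\<close> still covers.\<close>
  obtain p q where pq: "p \<in> I" "q \<in> I" "p \<noteq> q" "c p \<noteq> 0 \<or> c = (\<lambda>_. 0)"
  proof (cases "c = (\<lambda>_. 0)")
    case True
    then show thesis using f(4) that by blast
  next
    case False
    then obtain p where "c p \<noteq> 0" by auto
    moreover have "p \<in> I" using f(6) calculation by blast
    moreover have "\<exists>q\<in>I. p \<noteq> q" using f(4) by metis
    ultimately show thesis using that by blast
  qed
  obtain P Q where PQ: "P \<in> carrier G" "f P = gen p" "Q \<in> carrier G" "f Q = gen q"
    using f(5) pq by blast
  interpret Q: free_quotient G \<chi> S n f c p q P Q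
    by unfold_locales (use char S f(1,2,3) pq PQ in auto)
  have "\<chi> \<notin> bns_invariant G S"
  proof (cases "c = (\<lambda>_. 0)")
    case True
    have "\<chi> g = (\<lambda>x\<in>carrier G. 0) g" for g
    proof (cases "g \<in> carrier G")
      case True
      have "lsum (\<lambda>_. 0) w = 0" for w by (induction w) (simp_all add: lval_def)
      then show ?thesis using f(2) True \<open>c = (\<lambda>_. 0)\<close> by simp
    next
      case False
      then show ?thesis using char by (simp add: characters_def extensional_def)
    qed
    then have "\<chi> = (\<lambda>x\<in>carrier G. 0)" ..
    then show ?thesis unfolding bns_invariant_def by blast
  next
    case False
    then show ?thesis using Q.not_in_bns[OF S(1)] pq(4) by blast
  qed
  then show ?thesis using Q.resonant by blast
next
  case False
  interpret C: group_character G \<chi> S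
    by unfold_locales (use char S in auto)
  obtain t where t: "t \<in> carrier G" "\<chi> t \<noteq> 0"
    "\<And>A. commutant_closed A \<Longrightarrow> t \<in> A \<Longrightarrow> A = carrier G"
    using commutant_closed_full[OF n] False free_factor_pair free_factor_triple by blast
  have "\<chi> \<in> bns_invariant G S"
  proof (rule C.bns_criterion[OF t(1,2)])
    fix A assume "subgroup A G" "t \<in> A"
      "\<And>z h. \<lbrakk>z \<in> A; \<chi> z \<noteq> 0; h \<in> carrier G; h \<otimes>\<^bsub>G\<^esub> z = z \<otimes>\<^bsub>G\<^esub> h\<rbrakk> \<Longrightarrow> h \<in> A"
    then show "A = carrier G" by (intro t(3)) (auto simp: commutant_closed_def)
  qed
  then show ?thesis using not_resonant[OF t] by blast
qed

end

theorem theorem2: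
  fixes n :: nat and S :: "(word \<Rightarrow> word) set"
  assumes "n \<ge> 2"
    and "finite S" and "S \<subseteq> carrier (PSigma n)" and "generate (PSigma n) S = carrier (PSigma n)"
  shows "char_class (PSigma n) ` bns_invariant (PSigma n) S =
    carrier (cohomology (PSigma n) 1) - resonance_variety (PSigma n)"
proof -
  let ?G = "PSigma n"
  have bij: "bij_betw (char_class ?G) (characters ?G) (carrier (cohomology ?G 1))"
    by (rule char_class_bij[OF group_PSigma])
  have iff: "\<chi> \<in> bns_invariant ?G S \<longleftrightarrow> char_class ?G \<chi> \<notin> resonance_variety ?G"
    if "\<chi> \<in> characters ?G" for \<chi>
    by (rule psigma_char.bns_iff_not_resonant[OF psigma_char.intro[OF that] assms])
  have sub: "bns_invariant ?G S \<subseteq> characters ?G" by (auto simp: bns_invariant_def)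
  have "carrier (cohomology ?G 1) = char_class ?G ` characters ?G"
    using bij by (simp add: bij_betw_def)
  moreover have "bns_invariant ?G S = {\<chi> \<in> characters ?G. char_class ?G \<chi> \<notin> resonance_variety ?G}"
    using iff sub by blast
  ultimately show ?thesis by auto
qed

end
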